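(* Let $\mathsf{G}$ be a group, $\mathbb{F}$ an algebraically closed field, and $\mathfrak{A}$ and $\mathfrak{B}$ two finite dimensional simple $\mathsf{G}$-graded $\mathbb{F}$-algebras. Suppose that either $\mathsf{char}(\mathbb{F})=0$ or $\mathsf{char}(\mathbb{F})$ is coprime with the order of each finite subgroup of $\mathsf{G}$, and that any subgroup of $\mathsf{G}$ is normal. Then $\mathsf{T}^{\mathsf{G}}(\mathfrak{A})=\mathsf{T}^{\mathsf{G}}(\mathfrak{B})$ if and only if $\mathfrak{A}\cong_{\mathsf{G}}\mathfrak{B}$.
   Context: Algebras are associative $\mathbb{F}$-algebras. A $\mathsf{G}$-grading on $\mathfrak{A}$ is a vector space decomposition $\mathfrak{A}=\bigoplus_{\xi\in\mathsf{G}}\mathfrak{A}_\xi$ with $\mathfrak{A}_\xi\mathfrak{A}_\zeta\subseteq\mathfrak{A}_{\xi\zeta}$. An ideal $I$ is graded if $I=\bigoplus_{\xi}(I\cap\mathfrak{A}_\xi)$. $\mathfrak{A}$ is simple $\mathsf{G}$-graded if $\mathfrak{A}^2\neq\{0\}$ and its only graded ideals are $\{0\}$ and $\mathfrak{A}$. $\mathfrak{A}\cong_{\mathsf{G}}\mathfrak{B}$ means that there is an algebra isomorphism $\varphi:\mathfrak{A}\to\mathfrak{B}$ with $\varphi(\mathfrak{A}_\xi)=\mathfrak{B}_\xi$ for all $\xi\in\mathsf{G}$. $\mathbb{F}\langle X^{\mathsf{G}}\rangle$ is the free $\mathsf{G}$-graded associative algebra freely generated by $X^{\mathsf{G}}=\bigcup_{\xi\in\mathsf{G}}X_\xi$,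 $X_\xi=\{x_1^{(\xi)},x_2^{(\xi)},\dots\}$, where $x_i^{(\xi)}$ has degree $\xi$. $\mathsf{T}^{\mathsf{G}}(\mathfrak{A})$ is the set of graded polynomial identities of $\mathfrak{A}$: those $f\in\mathbb{F}\langle X^{\mathsf{G}}\rangle$ that vanish under every substitution of the variables $x_i^{(\xi)}$ by elements of $\mathfrak{A}_\xi$. *)

theory Defs
  imports
    Complex_Main
    "HOL-Library.Poly_Mapping"
    "HOL-Computational_Algebra.Polynomial"
    "HOL-Algebra.Coset"
begin

section \<open>Associative algebras and gradings\<close>

text \<open>
  Algebras need not have a unit: the class \<open>ring\<close> does not provide one. The carrier of the
  algebra is the whole type. The degrees are elements of \<open>carrier G\<close>; the value of a grading
  outside \<open>carrier G\<close> is irrelevant.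
\<close>

locale assoc_algebra = vector_space scale
  for scale :: "'f::field \<Rightarrow> 'a::ring \<Rightarrow> 'a" (infixr \<open>*s\<close> 75) +
  assumes scale_mult_left: "(c *s x) * y = c *s (x * y)"
    and scale_mult_right: "x * (c *s y) = c *s (x * y)"
begin

definition direct_sum_decomp :: "'i set \<Rightarrow> ('i \<Rightarrow> 'a set) \<Rightarrow> 'a set \<Rightarrow> bool" where
  "direct_sum_decomp I V W \<longleftrightarrow>
     subspace W \<and> (\<forall>i\<in>I. subspace (V i) \<and> V i \<subseteq> W) \<and>
     (\<forall>x\<in>W. \<exists>!v. (\<forall>i\<in>I. v i \<in> V i) \<and> (\<forall>i. i \<notin> I \<longrightarrow> v i = 0) \<and>
        finite {i. v i \<noteq> 0} \<and> x = (\<Sum>i | v i \<noteq> 0. v i))"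

definition algebra_ideal :: "'a set \<Rightarrow> bool" where
  "algebra_ideal I \<longleftrightarrow> subspace I \<and> (\<forall>x\<in>I. \<forall>a. a * x \<in> I \<and> x * a \<in> I)"

end

locale graded_algebra = assoc_algebra scale + group G
  for G :: "('g, 'm) monoid_scheme" (structure)
    and scale :: "'f::field \<Rightarrow> 'a::ring \<Rightarrow> 'a" (infixr \<open>*s\<close> 75) +
  fixes A :: "'g \<Rightarrow> 'a set"
  assumes decomposition: "direct_sum_decomp (carrier G) A UNIV"
    and mult_component:
      "\<lbrakk>g \<in> carrier G; h \<in> carrier G; x \<in> A g; y \<in> A h\<rbrakk> \<Longrightarrow> x * y \<in> A (g \<otimes> h)"
begin

definition graded_ideal :: "'a set \<Rightarrow> bool" where
  "graded_ideal I \<longleftrightarrow> algebra_ideal I \<and> direct_sum_decomp (carrier G) (\<lambda>g. I \<inter> A g) I"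

end

locale simple_graded_algebra = graded_algebra +
  assumes square_nonzero: "span {x * y | x y. True} \<noteq> {0}"
    and graded_ideal_trivial: "graded_ideal I \<Longrightarrow> I = {0} \<or> I = UNIV"

definition graded_isomorphism ::
  "('g, 'm) monoid_scheme \<Rightarrow> ('f::field \<Rightarrow> 'a::ring \<Rightarrow> 'a) \<Rightarrow> ('g \<Rightarrow> 'a set) \<Rightarrow>
     ('f \<Rightarrow> 'b::ring \<Rightarrow> 'b) \<Rightarrow> ('g \<Rightarrow> 'b set) \<Rightarrow> ('a \<Rightarrow> 'b) \<Rightarrow> bool" where
  "graded_isomorphism G scaleA A scaleB B \<phi> \<longleftrightarrow>
     Vector_Spaces.linear scaleA scaleB \<phi> \<and> (\<forall>x y. \<phi> (x * y) = \<phi> x * \<phi> y) \<and> bij \<phi> \<and>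
     (\<forall>g\<in>carrier G. \<phi> ` A g = B g)"

definition graded_isomorphic ::
  "('g, 'm) monoid_scheme \<Rightarrow> ('f::field \<Rightarrow> 'a::ring \<Rightarrow> 'a) \<Rightarrow> ('g \<Rightarrow> 'a set) \<Rightarrow>
     ('f \<Rightarrow> 'b::ring \<Rightarrow> 'b) \<Rightarrow> ('g \<Rightarrow> 'b set) \<Rightarrow> bool" where
  "graded_isomorphic G scaleA A scaleB B \<longleftrightarrow> (\<exists>\<phi>. graded_isomorphism G scaleA A scaleB B \<phi>)"


section \<open>The free graded algebra and graded identities\<close>

text \<open>
  Words with concatenation form the free monoid, so with the convolution product of
  \<open>Poly_Mapping\<close> the type \<open>'x free_word \<Rightarrow>\<^sub>0 'f\<close> is the free unital associative algebra on \<open>'x\<close>.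
  As algebras are not assumed to be unital, the free algebra is its subalgebra of elements with
  zero constant term, i.e. the linear combinations of nonempty words.
\<close>

datatype 'x free_word = Word (letters: "'x list")

instantiation free_word :: (type) monoid_add
begin

definition zero_free_word :: "'a free_word" where
  "0 = Word []"

definition plus_free_word :: "'a free_word \<Rightarrow> 'a free_word \<Rightarrow> 'a free_word" where
  "v + w = Word (letters v @ letters w)"

instance
  by standard (auto simp: zero_free_word_def plus_free_word_def)

end

text \<open>The pair \<open>(g, i)\<close> stands for the \<open>i\<close>-th variable of degree \<open>g\<close>.\<close>

definition free_graded_algebra ::
  "('g, 'm) monoid_scheme \<Rightarrow> (('g \<times> nat) free_word \<Rightarrow>\<^sub>0 'f::field) set" where
  "free_graded_algebra G =
     {f. Poly_Mapping.lookup f 0 = 0 \<and>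
         (\<forall>w\<in>Poly_Mapping.keys f. fst ` set (letters w) \<subseteq> carrier G)}"

text \<open>The value at the empty word is a dummy: there need not be a unit, and the words of elements
  of \<open>free_graded_algebra G\<close> are nonempty.\<close>

fun word_value :: "('x \<Rightarrow> 'a::ring) \<Rightarrow> 'x list \<Rightarrow> 'a" where
  "word_value s [] = 0"
| "word_value s [x] = s x"
| "word_value s (x # y # ys) = s x * word_value s (y # ys)"

definition substitute ::
  "('f::field \<Rightarrow> 'a::ring \<Rightarrow> 'a) \<Rightarrow> ('x \<Rightarrow> 'a) \<Rightarrow> ('x free_word \<Rightarrow>\<^sub>0 'f) \<Rightarrow> 'a" where
  "substitute scale s f =
     (\<Sum>w\<in>Poly_Mapping.keys f. scale (Poly_Mapping.lookup f w) (word_value s (letters w)))"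

definition graded_identities ::
  "('g, 'm) monoid_scheme \<Rightarrow> ('f::field \<Rightarrow> 'a::ring \<Rightarrow> 'a) \<Rightarrow> ('g \<Rightarrow> 'a set) \<Rightarrow>
     (('g \<times> nat) free_word \<Rightarrow>\<^sub>0 'f) set" where
  "graded_identities G scale A =
     {f \<in> free_graded_algebra G.
        \<forall>s. (\<forall>g\<in>carrier G. \<forall>i. s (g, i) \<in> A g) \<longrightarrow> substitute scale s f = 0}"

text \<open>Substitution is the homomorphism given by the universal property of the free algebra.\<close>

lemma word_value_append:
  "v \<noteq> [] \<Longrightarrow> w \<noteq> [] \<Longrightarrow> word_value s (v @ w) = word_value s v * word_value s w"
proof (induction v)
  case (Cons x v)
  show ?case
  proof (cases v)
    case Nil
    then show ?thesis using Cons.prems by (cases w) auto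
  next
    case (Cons y ys)
    then show ?thesis using Cons.IH Cons.prems by (simp add: mult.assoc)
  qed
qed simp

context assoc_algebra
begin

lemma substitute_superset:
  assumes "finite K" "Poly_Mapping.keys f \<subseteq> K"
  shows "substitute scale s f =
    (\<Sum>w\<in>K. Poly_Mapping.lookup f w *s word_value s (letters w))"
  unfolding substitute_def using assms
  by (intro sum.mono_neutral_left) (auto simp: in_keys_iff)

lemma substitute_variable:
  "substitute scale s (Poly_Mapping.single (Word [x]) 1) = s x"
  by (simp add: substitute_def)

lemma substitute_add:
  "substitute scale s (f + g) = substitute scale s f + substitute scale s g"
proof -
  let ?K = "Poly_Mapping.keys f \<union> Poly_Mapping.keys g"
  have "Poly_Mapping.keys (f + g) \<subseteq> ?K"
    by (rule Poly_Mapping.keys_add)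
  then show ?thesis
    by (simp add: substitute_superset[of ?K] lookup_add scale_left_distrib sum.distrib)
qed

lemma substitute_sum: "substitute scale s (sum F I) = (\<Sum>i\<in>I. substitute scale s (F i))"
  by (induction I rule: infinite_finite_induct) (simp_all add: substitute_add, simp_all add: substitute_def)

lemma substitute_single:
  "substitute scale s (Poly_Mapping.single w c) = c *s word_value s (letters w)"
  by (simp add: substitute_def)

lemma substitute_mult:
  assumes "Poly_Mapping.lookup f 0 = 0" "Poly_Mapping.lookup g 0 = 0"
  shows "substitute scale s (f * g) = substitute scale s f * substitute scale s g"
proof -
  have ne: "letters w \<noteq> []" if "w \<in> Poly_Mapping.keys h" "Poly_Mapping.lookup h 0 = 0"
    for w and h :: "'x free_word \<Rightarrow>\<^sub>0 'f"
    using that by (cases w) (auto simp: zero_free_word_def in_keys_iff)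
  have decomp: "h = (\<Sum>w\<in>Poly_Mapping.keys h. Poly_Mapping.single w (Poly_Mapping.lookup h w))"
    for h :: "'x free_word \<Rightarrow>\<^sub>0 'f"
    by (rule poly_mapping_eqI)
      (auto simp: lookup_sum lookup_single when_def in_keys_iff)
  have "f * g = (\<Sum>v\<in>Poly_Mapping.keys f. \<Sum>w\<in>Poly_Mapping.keys g.
      Poly_Mapping.single (v + w) (Poly_Mapping.lookup f v * Poly_Mapping.lookup g w))"
    by (subst (1) decomp[of f], subst (1) decomp[of g])
      (simp add: sum_product mult_single)
  then show ?thesis
    by (simp add: substitute_sum substitute_single)
      (simp add: substitute_def sum_product plus_free_word_def word_value_append ne assms
        scale_mult_left scale_mult_right mult.commute)
qed

end

end

theory Submission
  imports Defs "HOL-Combinatorics.Permutations"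
begin

text \<open>
  Let \<open>d\<close> list the degrees of a homogeneous basis of \<open>\<BB>\<close>. The structure constants of \<open>\<AA>\<close> in
  homogeneous bases of degrees \<open>d\<close> form the image of a polynomial map. By density and graded
  primeness, for every homogeneous basis some Capelli polynomial, alternating within each degree,
  does not vanish on it. Replacing an entry of a basis by a product of two entries multiplies the
  value of the Capelli polynomial by a structure constant. Hence a polynomial vanishes on the
  structure constants of \<open>\<AA>\<close> if and only if associated graded polynomials are identities of \<open>\<AA>\<close>, and
  equality of identities means that the two sets of structure constants have the same Zariski
  closure. The image of a polynomial map contains a dense open subset of its closure, so the two
  sets meet, and a common point yields an isomorphism.
\<close>

section \<open>Extending homomorphisms into algebraically closed fields\<close>

text \<open>The structure constants of a homogeneous basis are rational, not polynomial, functions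
  of its coordinates. A coordinate \<open>S\<close> of a Capelli value takes the part of the
  determinant as a common denominator: it is polynomial, it vanishes on dependent families, and its
  product with a structure constant is the same coordinate after a product has been inserted into
  the family. The polynomial map is therefore \<open>S c\<close> instead of \<open>c\<close>. For
  nonzero \<open>S\<close> this is harmless, since the basis \<open>S x\<close> has the structure
  constants \<open>S c\<close>. Where \<open>S\<close> vanishes, the values need not be structure
  constants of any basis, so the common point must be found off the zero set of \<open>S\<close>. It
  is found algebraically: a point of the structure constants of \<BB> is a ring homomorphism from
  the algebra generated by the components of the map into the field, and an extension of it to all
  polynomial functions is a choice of parameters. Hence only bases of \<AA> have to be parametrized.
  That both algebras have the same dimension and admit the same list \<open>d\<close> results from
  the same transfer, applied to the constant polynomial 1.\<close>

definition is_subring :: "'d::comm_ring_1 set \<Rightarrow> bool" where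
  "is_subring R \<longleftrightarrow> 1 \<in> R \<and> (\<forall>x\<in>R. \<forall>y\<in>R. x - y \<in> R \<and> x * y \<in> R)"

text \<open>Subrings are sets, so a homomorphism is a total function whose values off
  \<open>R\<close> carry no information; extending it means agreeing on \<open>R\<close>.\<close>

definition is_hom_on :: "'d::comm_ring_1 set \<Rightarrow> ('d \<Rightarrow> 'e::comm_ring_1) \<Rightarrow> bool" where
  "is_hom_on R \<phi> \<longleftrightarrow>
     \<phi> 1 = 1 \<and> (\<forall>x\<in>R. \<forall>y\<in>R. \<phi> (x + y) = \<phi> x + \<phi> y \<and> \<phi> (x * y) = \<phi> x * \<phi> y)"

definition polys_over :: "'d::comm_ring_1 set \<Rightarrow> 'd poly set" where
  "polys_over R = {p. \<forall>i. coeff p i \<in> R}"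

definition adjoin :: "'d::comm_ring_1 set \<Rightarrow> 'd \<Rightarrow> 'd set" where
  "adjoin R t = (\<lambda>p. poly p t) ` polys_over R"

context
  fixes R :: "'d::comm_ring_1 set"
  assumes R: "is_subring R"
begin

lemma subring_one: "1 \<in> R"
  and subring_diff: "x \<in> R \<Longrightarrow> y \<in> R \<Longrightarrow> x - y \<in> R"
  and subring_mult: "x \<in> R \<Longrightarrow> y \<in> R \<Longrightarrow> x * y \<in> R"
  using R by (auto simp: is_subring_def)

lemma subring_zero: "0 \<in> R"
  using subring_diff[OF subring_one subring_one] by simp

lemma subring_add: "x \<in> R \<Longrightarrow> y \<in> R \<Longrightarrow> x + y \<in> R"
  using subring_diff[of x "0 - y"] subring_diff[OF subring_zero, of y] by simp

lemma subring_power: "x \<in> R \<Longrightarrow> x ^ n \<in> R"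
  by (induction n) (auto simp: subring_one subring_mult)

lemma subring_sum: "(\<And>i. i \<in> I \<Longrightarrow> f i \<in> R) \<Longrightarrow> sum f I \<in> R"
  by (induction I rule: infinite_finite_induct) (auto simp: subring_zero subring_add)

lemma polys_over_diff: "p \<in> polys_over R \<Longrightarrow> q \<in> polys_over R \<Longrightarrow> p - q \<in> polys_over R"
  and polys_over_add: "p \<in> polys_over R \<Longrightarrow> q \<in> polys_over R \<Longrightarrow> p + q \<in> polys_over R"
  and polys_over_mult: "p \<in> polys_over R \<Longrightarrow> q \<in> polys_over R \<Longrightarrow> p * q \<in> polys_over R"
  and polys_over_smult: "c \<in> R \<Longrightarrow> p \<in> polys_over R \<Longrightarrow> smult c p \<in> polys_over R"
  and polys_over_monom: "c \<in> R \<Longrightarrow> monom c n \<in> polys_over R"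
  and polys_over_zero: "0 \<in> polys_over R"
  by (auto simp: polys_over_def coeff_mult coeff_monom subring_zero
      intro: subring_diff subring_add subring_mult subring_sum)

lemma polys_over_const: "c \<in> R \<Longrightarrow> [:c:] \<in> polys_over R"
  using polys_over_monom[of c 0] by (simp add: monom_0)

lemma subset_adjoin: "R \<subseteq> adjoin R t"
  unfolding adjoin_def using polys_over_const by (auto intro!: image_eqI[of _ _ "[:_:]"])

lemma generator_in_adjoin: "t \<in> adjoin R t"
  unfolding adjoin_def using polys_over_monom[OF subring_one, of 1]
  by (auto intro!: image_eqI[of _ _ "monom 1 1"] simp: poly_monom)

lemma is_subring_adjoin: "is_subring (adjoin R t)"
  unfolding is_subring_def
proof (intro conjI ballI)
  show "1 \<in> adjoin R t" using subset_adjoin subring_one by blast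
next
  fix x y assume "x \<in> adjoin R t" "y \<in> adjoin R t"
  then obtain p q where "p \<in> polys_over R" "q \<in> polys_over R" "x = poly p t" "y = poly q t"
    by (auto simp: adjoin_def)
  then show "x - y \<in> adjoin R t" "x * y \<in> adjoin R t"
    using polys_over_diff[of p q] polys_over_mult[of p q]
    by (simp_all add: adjoin_def image_iff flip: poly_diff poly_mult) blast+
qed

text \<open>Leading coefficients need not be invertible in \<open>R\<close>, so the dividend is
  multiplied by a power of that of \<open>q\<close>. Each round passes from \<open>p\<close> to
  \<open>c p - m q\<close>, which cancels the top term and keeps the coefficients in
  \<open>R\<close>. The alternative \<open>v = 0\<close> covers constant \<open>q\<close>.\<close>

lemma pseudo_division_over:
  assumes q: "q \<in> polys_over R" and "p \<in> polys_over R"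
  shows "\<exists>k u v. u \<in> polys_over R \<and> v \<in> polys_over R \<and>
    smult (lead_coeff q ^ k) p = q * u + v \<and> (v = 0 \<or> degree v < degree q)"
  using assms(2)
proof (induction "degree p" arbitrary: p rule: less_induct)
  case less
  show ?case
  proof (cases "p = 0 \<or> degree p < degree q")
    case True
    then have "smult (lead_coeff q ^ 0) p = q * 0 + p" by simp
    then show ?thesis using True less.prems polys_over_zero by blast
  next
    case False
    define c m where "c = lead_coeff q" and "m = monom (lead_coeff p) (degree p - degree q)"
    define p' where "p' = smult c p - m * q"
    have R': "c \<in> R" "lead_coeff p \<in> R"
      using q less.prems by (auto simp: c_def polys_over_def)
    have m: "m \<in> polys_over R" unfolding m_def by (intro polys_over_monom R')
    have p': "p' \<in> polys_over R" unfolding p'_def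
      by (intro polys_over_diff polys_over_smult polys_over_mult R' m q less.prems)
    have "degree m \<le> degree p - degree q" unfolding m_def by (rule degree_monom_le)
    then have "degree (m * q) \<le> degree p"
      using degree_mult_le[of m q] False by linarith
    then have deg: "degree p' \<le> degree p" unfolding p'_def
      by (intro degree_diff_le degree_smult_le)
    have "coeff (m * q) (degree p) = lead_coeff p * c"
      using False by (simp add: m_def coeff_monom_mult c_def)
    then have "coeff p' (degree p) = 0" by (simp add: p'_def mult.commute)
    then have "p' = 0 \<or> degree p' < degree p"
      using deg by (metis leading_coeff_0_iff le_neq_implies_less)
    then obtain k u v where uv: "u \<in> polys_over R" "v \<in> polys_over R"
        "smult (c ^ k) p' = q * u + v" "v = 0 \<or> degree v < degree q"
    proof
      assume "p' = 0"
      then show ?thesis using that[of 0 0 0] polys_over_zero by auto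
    next
      assume "degree p' < degree p"
      from less.hyps[OF this p'] show ?thesis using that by (auto simp: c_def)
    qed
    have "smult (c ^ Suc k) p = smult (c ^ k) p' + smult (c ^ k) (m * q)"
      by (simp add: p'_def smult_diff_right mult.commute)
    also have "\<dots> = q * (u + smult (c ^ k) m) + v"
      by (simp add: uv algebra_simps)
    finally have "smult (c ^ Suc k) p = q * (u + smult (c ^ k) m) + v" .
    moreover have "u + smult (c ^ k) m \<in> polys_over R"
      by (intro polys_over_add polys_over_smult uv m subring_power R')
    ultimately show ?thesis using uv unfolding c_def by blast
  qed
qed

section \<open>Homomorphisms on a subring and their action on coefficients\<close>

context
  fixes \<phi> :: "'d \<Rightarrow> 'e::comm_ring_1"
  assumes \<phi>: "is_hom_on R \<phi>"
begin

lemma hom_on_one: "\<phi> 1 = 1"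
  and hom_on_add: "x \<in> R \<Longrightarrow> y \<in> R \<Longrightarrow> \<phi> (x + y) = \<phi> x + \<phi> y"
  and hom_on_mult: "x \<in> R \<Longrightarrow> y \<in> R \<Longrightarrow> \<phi> (x * y) = \<phi> x * \<phi> y"
  using \<phi> by (auto simp: is_hom_on_def)

lemma hom_on_zero: "\<phi> 0 = 0"
  using hom_on_add[OF subring_zero subring_zero] by simp

lemma hom_on_power: "x \<in> R \<Longrightarrow> \<phi> (x ^ n) = \<phi> x ^ n"
  by (induction n) (auto simp: hom_on_one hom_on_mult subring_power)

lemma hom_on_diff: "x \<in> R \<Longrightarrow> y \<in> R \<Longrightarrow> \<phi> (x - y) = \<phi> x - \<phi> y"
  using hom_on_add[of "x - y" y] by (auto simp: subring_diff)

lemma hom_on_sum: "(\<And>i. i \<in> I \<Longrightarrow> f i \<in> R) \<Longrightarrow> \<phi> (sum f I) = (\<Sum>i\<in>I. \<phi> (f i))"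
  by (induction I rule: infinite_finite_induct) (auto simp: hom_on_zero hom_on_add subring_sum)

lemma map_poly_hom_on_mult:
  "p \<in> polys_over R \<Longrightarrow> q \<in> polys_over R \<Longrightarrow>
     map_poly \<phi> (p * q) = map_poly \<phi> p * map_poly \<phi> q"
  by (intro poly_eqI)
    (auto simp: coeff_map_poly hom_on_zero coeff_mult polys_over_def hom_on_sum hom_on_mult
      subring_mult)

lemma map_poly_hom_on_add:
  "p \<in> polys_over R \<Longrightarrow> q \<in> polys_over R \<Longrightarrow>
     map_poly \<phi> (p + q) = map_poly \<phi> p + map_poly \<phi> q"
  by (intro poly_eqI) (auto simp: coeff_map_poly hom_on_zero polys_over_def hom_on_add)

lemma map_poly_hom_on_diff:
  "p \<in> polys_over R \<Longrightarrow> q \<in> polys_over R \<Longrightarrow>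
     map_poly \<phi> (p - q) = map_poly \<phi> p - map_poly \<phi> q"
  by (intro poly_eqI) (auto simp: coeff_map_poly hom_on_zero polys_over_def hom_on_diff)

lemma map_poly_hom_on_smult:
  "c \<in> R \<Longrightarrow> p \<in> polys_over R \<Longrightarrow> map_poly \<phi> (smult c p) = smult (\<phi> c) (map_poly \<phi> p)"
  by (intro poly_eqI) (auto simp: coeff_map_poly hom_on_zero polys_over_def hom_on_mult)

lemma map_poly_hom_on_const: "map_poly \<phi> [:c:] = [:\<phi> c:]"
  by (simp add: hom_on_zero map_poly_pCons)

text \<open>Sending \<open>poly p t\<close> to the value of the mapped polynomial at
  \<open>\<tau>\<close> is well defined once \<open>\<tau>\<close> inherits the relations of
  \<open>t\<close> over \<open>R\<close>, which is \<open>wd\<close>.\<close>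

lemma hom_on_extend:
  assumes wd: "\<And>p. p \<in> polys_over R \<Longrightarrow> poly p t = 0 \<Longrightarrow> poly (map_poly \<phi> p) \<tau> = 0"
  obtains \<phi>' where "is_hom_on (adjoin R t) \<phi>'" "\<And>x. x \<in> R \<Longrightarrow> \<phi>' x = \<phi> x"
    "\<And>p. p \<in> polys_over R \<Longrightarrow> \<phi>' (poly p t) = poly (map_poly \<phi> p) \<tau>"
proof -
  define \<phi>' where
    "\<phi>' x = poly (map_poly \<phi> (SOME p. p \<in> polys_over R \<and> poly p t = x)) \<tau>" for x
  have \<phi>': "\<phi>' (poly p t) = poly (map_poly \<phi> p) \<tau>" if p: "p \<in> polys_over R" for p
  proof -
    define q where "q = (SOME q. q \<in> polys_over R \<and> poly q t = poly p t)"
    have q: "q \<in> polys_over R \<and> poly q t = poly p t"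
      unfolding q_def by (rule someI[of _ p]) (use p in simp)
    then have "poly (map_poly \<phi> (q - p)) \<tau> = 0"
      using p by (intro wd) (auto intro: polys_over_diff)
    then show ?thesis
      using q p by (simp add: \<phi>'_def q_def[symmetric] map_poly_hom_on_diff)
  qed
  have const: "\<phi>' x = \<phi> x" if "x \<in> R" for x
    using \<phi>'[OF polys_over_const[OF that]] by (simp add: map_poly_hom_on_const)
  have "is_hom_on (adjoin R t) \<phi>'"
    unfolding is_hom_on_def
  proof (intro conjI ballI)
    show "\<phi>' 1 = 1" using const[OF subring_one] hom_on_one by simp
  next
    fix x y assume "x \<in> adjoin R t" "y \<in> adjoin R t"
    then obtain p q where pq: "p \<in> polys_over R" "q \<in> polys_over R" "x = poly p t" "y = poly q t"
      by (auto simp: adjoin_def)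
    show "\<phi>' (x + y) = \<phi>' x + \<phi>' y"
      using \<phi>'[OF polys_over_add[OF pq(1,2)]] pq by (simp add: \<phi>' map_poly_hom_on_add)
    show "\<phi>' (x * y) = \<phi>' x * \<phi>' y"
      using \<phi>'[OF polys_over_mult[OF pq(1,2)]] pq by (simp add: \<phi>' map_poly_hom_on_mult)
  qed
  then show ?thesis using const \<phi>' that by blast
qed

end

end

text \<open>In a finite field the product of all \<open>X - a\<close>, plus 1, would be nonconstant
  without a root.\<close>

lemma infinite_UNIV_alg_closed_field: "infinite (UNIV :: 'f::alg_closed_field set)"
proof
  assume fin: "finite (UNIV :: 'f set)"
  define p where "p = (\<Prod>a\<in>(UNIV :: 'f set). [:- a, 1:]) + 1"
  have "poly p x = 1" for x
    using fin by (auto simp: p_def poly_prod intro!: prod_zero exI[of _ x])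
  moreover have "degree (\<Prod>a\<in>(UNIV :: 'f set). [:- a, 1:]) = card (UNIV :: 'f set)"
    by (subst degree_prod_eq_sum_degree) auto
  then have "degree p > 0"
    using fin by (simp add: p_def degree_add_eq_left card_gt_0_iff)
  ultimately show False using alg_closed_imp_poly_has_root[of p] by auto
qed

text \<open>One step of Chevalley's theorem on images. If \<open>t\<close> is transcendental over
  \<open>R\<close>, all but finitely many targets \<open>\<tau>\<close> will do. If \<open>t\<close>
  is algebraic, \<open>\<tau>\<close> must be a root of the image of a polynomial of least degree,
  and \<open>s\<close> stays nonzero because it divides a nonzero element of
  \<open>R\<close>.\<close>

lemma hom_on_extend_adjoin:
  fixes R :: "'d::idom set" and t s :: 'd
  assumes R: "is_subring R" and s: "s \<in> adjoin R t" "s \<noteq> 0"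
  obtains r where "r \<in> R" "r \<noteq> 0"
    "\<And>\<phi> :: 'd \<Rightarrow> 'f::alg_closed_field. is_hom_on R \<phi> \<Longrightarrow> \<phi> r \<noteq> 0 \<Longrightarrow>
       \<exists>\<phi>'. is_hom_on (adjoin R t) \<phi>' \<and> (\<forall>x\<in>R. \<phi>' x = \<phi> x) \<and> \<phi>' s \<noteq> 0"
proof -
  obtain g where g: "g \<in> polys_over R" "s = poly g t" using s by (auto simp: adjoin_def)
  show thesis
  proof (cases "\<exists>q\<in>polys_over R. q \<noteq> 0 \<and> poly q t = 0")
    case False
    \<comment> \<open>If this coefficient survives, the image of \<open>g\<close> is a nonzero
      polynomial with only finitely many roots to avoid.\<close>
    define r where "r = lead_coeff g"
    have "r \<in> R" "r \<noteq> 0" using g s by (auto simp: r_def polys_over_def)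
    moreover have "\<exists>\<phi>'. is_hom_on (adjoin R t) \<phi>' \<and> (\<forall>x\<in>R. \<phi>' x = \<phi> x) \<and> \<phi>' s \<noteq> 0"
      if \<phi>: "is_hom_on R \<phi>" "\<phi> r \<noteq> 0" for \<phi> :: "'d \<Rightarrow> 'f"
    proof -
      have "coeff (map_poly \<phi> g) (degree g) \<noteq> 0"
        using \<phi> by (simp add: coeff_map_poly hom_on_zero[OF R \<phi>(1)] r_def)
      then have "map_poly \<phi> g \<noteq> 0" by auto
      then have "finite {x. poly (map_poly \<phi> g) x = 0}" by (rule poly_roots_finite)
      then obtain \<tau> where \<tau>: "poly (map_poly \<phi> g) \<tau> \<noteq> 0"
        using infinite_UNIV_alg_closed_field[where 'f = 'f] by (metis (mono_tags, lifting) Collect_cong UNIV_def)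
      have "poly (map_poly \<phi> p) \<tau> = 0" if "p \<in> polys_over R" "poly p t = 0" for p
        using False that by auto
      then show ?thesis
        using hom_on_extend[OF R \<phi>(1), of t \<tau>] \<tau> g by metis
    qed
    ultimately show ?thesis using that by blast
  next
    case True
    \<comment> \<open>\<open>q\<close> replaces the minimal polynomial. It need not be monic, so it
      divides the relations of \<open>t\<close> only up to powers of its leading coefficient
      \<open>c\<close>.\<close>
    obtain q where q: "q \<in> polys_over R" "q \<noteq> 0" "poly q t = 0"
      and q_min: "\<And>p. p \<in> polys_over R \<Longrightarrow> p \<noteq> 0 \<Longrightarrow> poly p t = 0 \<Longrightarrow> degree q \<le> degree p"
    proof -
      let ?P = "\<lambda>q. q \<in> polys_over R \<and> q \<noteq> 0 \<and> poly q t = 0"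
      from True have ex: "\<exists>q. ?P q" by blast
      then show ?thesis
        using ex_has_least_nat[of ?P _ degree] that by blast
    qed
    define c where "c = lead_coeff q"
    have c: "c \<in> R" "c \<noteq> 0" using q by (auto simp: c_def polys_over_def)
    have small: "v = 0" if "v \<in> polys_over R" "poly v t = 0" "v = 0 \<or> degree v < degree q" for v
      using q_min that by force
    have degq: "degree q > 0"
    proof (rule ccontr)
      assume "\<not> ?thesis"
      then obtain a where "q = [:a:]" by (auto elim: degree_eq_zeroE)
      then show False using q by simp
    qed
    \<comment> \<open>An element of least degree in the ideal generated by \<open>s\<close> is a constant, because it
      divides \<open>q\<close> up to a factor from \<open>R\<close>.\<close>
    define Q where "Q h \<longleftrightarrow> h \<in> polys_over R \<and> poly h t \<noteq> 0 \<and>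
      (\<exists>u\<in>polys_over R. poly h t = s * poly u t) \<and> (degree h < degree q)" for h
    have "\<exists>h. Q h"
    proof -
      obtain k u v where kuv: "u \<in> polys_over R" "v \<in> polys_over R"
        "smult (c ^ k) g = q * u + v" "v = 0 \<or> degree v < degree q"
        using pseudo_division_over[OF R q(1) g(1)] unfolding c_def by blast
      have "poly v t = s * c ^ k"
        using arg_cong[OF kuv(3), of "\<lambda>p. poly p t"] q g by (simp add: mult.commute)
      moreover have "[:c ^ k:] \<in> polys_over R"
        by (intro polys_over_const R subring_power c)
      moreover have "v \<noteq> 0" using \<open>poly v t = s * c ^ k\<close> s c by auto
      ultimately have "Q v" unfolding Q_def using kuv s c by (auto intro!: bexI[of _ "[:c ^ k:]"])
      then show ?thesis by blast
    qed
    then obtain h where h: "Q h" and h_min: "\<And>p. Q p \<Longrightarrow> degree h \<le> degree p"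
      using ex_has_least_nat[of Q _ degree] by blast
    obtain w where w: "w \<in> polys_over R" "poly h t = s * poly w t"
      and hR: "h \<in> polys_over R" and ht: "poly h t \<noteq> 0" and hq: "degree h < degree q"
      using h by (auto simp: Q_def)
    have "degree h = 0"
    proof (rule ccontr)
      assume h0: "degree h \<noteq> 0"
      obtain k u v where kuv: "u \<in> polys_over R" "v \<in> polys_over R"
        "smult (lead_coeff h ^ k) q = h * u + v" "v = 0 \<or> degree v < degree h"
        using pseudo_division_over[OF R hR q(1)] by blast
      have eq: "0 = poly h t * poly u t + poly v t"
        using arg_cong[OF kuv(3), of "\<lambda>p. poly p t"] q by simp
      have "v = 0"
      proof (rule ccontr)
        assume v0: "v \<noteq> 0"
        then have "poly v t \<noteq> 0" using small[OF kuv(2)] kuv(4) hq by auto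
        moreover have "poly v t = s * poly (w * (0 - u)) t" using eq w by (simp add: algebra_simps eq_neg_iff_add_eq_0)
        moreover have "w * (0 - u) \<in> polys_over R"
          by (intro polys_over_mult polys_over_diff polys_over_zero R w kuv)
        ultimately have "Q v" unfolding Q_def using kuv v0 hq by fastforce
        then show False using h_min[of v] kuv v0 by auto
      qed
      then have "poly u t = 0" using eq ht by simp
      have h1: "h \<noteq> 0" using ht by auto
      have "smult (lead_coeff h ^ k) q \<noteq> 0" using h1 q by simp
      then have u0: "u \<noteq> 0" using kuv \<open>v = 0\<close> by auto
      have "degree q = degree h + degree u"
        using arg_cong[OF kuv(3), of degree] \<open>v = 0\<close> h1 u0 by (simp add: degree_mult_eq)
      then show False using q_min[OF kuv(1) u0 \<open>poly u t = 0\<close>] h0 by simp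
    qed
    then obtain d where d: "h = [:d:]" by (auto elim: degree_eq_zeroE)
    have dR: "d \<in> R" "d \<noteq> 0" and ds: "d = s * poly w t"
      using hR ht w d by (auto simp: polys_over_def dest: spec[of _ 0])
    \<comment> \<open>A nonzero image of \<open>c\<close> keeps the image of \<open>q\<close>
      nonconstant, so that it has a root; \<open>d\<close> is a multiple of \<open>s\<close>, so a
      nonzero image of \<open>d\<close> keeps that of \<open>s\<close> nonzero.\<close>
    have "c * d \<in> R" "c * d \<noteq> 0" using c dR subring_mult[OF R] by auto
    moreover have "\<exists>\<phi>'. is_hom_on (adjoin R t) \<phi>' \<and> (\<forall>x\<in>R. \<phi>' x = \<phi> x) \<and> \<phi>' s \<noteq> 0"
      if \<phi>: "is_hom_on R \<phi>" "\<phi> (c * d) \<noteq> 0" for \<phi> :: "'d \<Rightarrow> 'f"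
    proof -
      have nz: "\<phi> c \<noteq> 0" "\<phi> d \<noteq> 0" using \<phi> hom_on_mult[OF R \<phi>(1) c(1) dR(1)] by auto
      have "coeff (map_poly \<phi> q) (degree q) \<noteq> 0"
        using nz by (simp add: coeff_map_poly hom_on_zero[OF R \<phi>(1)] c_def)
      then have "degree (map_poly \<phi> q) > 0" using degq le_degree by fastforce
      then obtain \<tau> where \<tau>: "poly (map_poly \<phi> q) \<tau> = 0" using alg_closed_imp_poly_has_root by blast
      have wd: "poly (map_poly \<phi> p) \<tau> = 0" if p: "p \<in> polys_over R" "poly p t = 0" for p
      proof -
        obtain k u v where kuv: "u \<in> polys_over R" "v \<in> polys_over R"
          "smult (c ^ k) p = q * u + v" "v = 0 \<or> degree v < degree q"
          using pseudo_division_over[OF R q(1) p(1)] unfolding c_def by blast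
        have "poly v t = 0"
          using arg_cong[OF kuv(3), of "\<lambda>p. poly p t"] q p by simp
        then have "smult (c ^ k) p = q * u" using small[OF kuv(2)] kuv by auto
        then have "smult (\<phi> (c ^ k)) (map_poly \<phi> p) = map_poly \<phi> q * map_poly \<phi> u"
          using map_poly_hom_on_smult[OF R \<phi>(1) subring_power[OF R c(1)] p(1), of k]
            map_poly_hom_on_mult[OF R \<phi>(1) q(1) kuv(1)] by metis
        from arg_cong[OF this, of "\<lambda>p. poly p \<tau>"] show ?thesis
          using nz \<tau> by (simp add: hom_on_power[OF R \<phi>(1) c(1)])
      qed
      obtain \<phi>' where \<phi>': "is_hom_on (adjoin R t) \<phi>'" "\<And>x. x \<in> R \<Longrightarrow> \<phi>' x = \<phi> x"
        using hom_on_extend[OF R \<phi>(1) wd] by blast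
      have "\<phi>' d = \<phi>' s * \<phi>' (poly w t)"
        unfolding ds by (intro hom_on_mult[OF is_subring_adjoin[OF R] \<phi>'(1)] s)
          (use w in \<open>auto simp: adjoin_def\<close>)
      then have "\<phi>' s \<noteq> 0" using \<phi>'(2)[OF dR(1)] nz by auto
      then show ?thesis using \<phi>' by blast
    qed
    ultimately show ?thesis using that by blast
  qed
qed

section \<open>Adjoining finitely many elements\<close>

lemma is_subring_fold_adjoin: "is_subring R \<Longrightarrow> is_subring (foldl adjoin R ts)"
  by (induction ts arbitrary: R) (auto simp: is_subring_adjoin)

lemma subset_fold_adjoin: "is_subring R \<Longrightarrow> R \<subseteq> foldl adjoin R ts"
  by (induction ts arbitrary: R) (auto dest: is_subring_adjoin subset_adjoin)

lemma generators_in_fold_adjoin: "is_subring R \<Longrightarrow> set ts \<subseteq> foldl adjoin R ts"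
proof (induction ts arbitrary: R)
  case (Cons t ts)
  have "is_subring (adjoin R t)" by (rule is_subring_adjoin[OF Cons.prems])
  then show ?case
    using Cons.IH[of "adjoin R t"] subset_fold_adjoin[of "adjoin R t" ts]
      generator_in_adjoin[OF Cons.prems, of t] by auto
qed simp

text \<open>The condition on \<open>\<phi>\<close> is pushed down the tower: the element
  \<open>r'\<close> that controls the later generators takes the place of \<open>s\<close> for the
  first one.\<close>

lemma hom_on_extend_fold_adjoin:
  fixes R :: "'d::idom set" and s :: 'd
  assumes "is_subring R" "s \<in> foldl adjoin R ts" "s \<noteq> 0"
  shows "\<exists>r\<in>R. r \<noteq> 0 \<and>
    (\<forall>\<phi> :: 'd \<Rightarrow> 'f::alg_closed_field. is_hom_on R \<phi> \<longrightarrow> \<phi> r \<noteq> 0 \<longrightarrow>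
       (\<exists>\<phi>'. is_hom_on (foldl adjoin R ts) \<phi>' \<and> (\<forall>x\<in>R. \<phi>' x = \<phi> x) \<and> \<phi>' s \<noteq> 0))"
  using assms(1,2)
proof (induction ts arbitrary: R)
  case Nil
  then show ?case using \<open>s \<noteq> 0\<close> by (intro bexI[of _ s]) auto
next
  case (Cons t ts)
  obtain r' where r': "r' \<in> adjoin R t" "r' \<noteq> 0"
    "\<And>\<phi> :: 'd \<Rightarrow> 'f. is_hom_on (adjoin R t) \<phi> \<Longrightarrow> \<phi> r' \<noteq> 0 \<Longrightarrow>
       \<exists>\<phi>'. is_hom_on (foldl adjoin (adjoin R t) ts) \<phi>' \<and> (\<forall>x\<in>adjoin R t. \<phi>' x = \<phi> x) \<and> \<phi>' s \<noteq> 0"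
    using Cons.IH[OF is_subring_adjoin[OF Cons.prems(1)], of t] Cons.prems(2) by auto
  obtain r where r: "r \<in> R" "r \<noteq> 0"
    "\<And>\<phi> :: 'd \<Rightarrow> 'f. is_hom_on R \<phi> \<Longrightarrow> \<phi> r \<noteq> 0 \<Longrightarrow>
       \<exists>\<phi>'. is_hom_on (adjoin R t) \<phi>' \<and> (\<forall>x\<in>R. \<phi>' x = \<phi> x) \<and> \<phi>' r' \<noteq> 0"
    using hom_on_extend_adjoin[OF Cons.prems(1) r'(1,2), where 'f = 'f] by metis
  have "\<exists>\<phi>'. is_hom_on (foldl adjoin R (t # ts)) \<phi>' \<and> (\<forall>x\<in>R. \<phi>' x = \<phi> x) \<and> \<phi>' s \<noteq> 0"
    if "is_hom_on R \<phi>" "\<phi> r \<noteq> 0" for \<phi> :: "'d \<Rightarrow> 'f"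
    using r(3)[OF that] r'(3) subset_adjoin[OF Cons.prems(1), of t] by (metis foldl_Cons subsetD)
  then show ?case using r by blast
qed

section \<open>Polynomial functions\<close>

inductive_set polynomial_functions :: "'v set \<Rightarrow> (('v \<Rightarrow> 'f::field) \<Rightarrow> 'f) set"
  for V :: "'v set" where
  const: "(\<lambda>_. c) \<in> polynomial_functions V"
| var: "v \<in> V \<Longrightarrow> (\<lambda>t. t v) \<in> polynomial_functions V"
| add: "f \<in> polynomial_functions V \<Longrightarrow> g \<in> polynomial_functions V \<Longrightarrow>
    (\<lambda>t. f t + g t) \<in> polynomial_functions V"
| mult: "f \<in> polynomial_functions V \<Longrightarrow> g \<in> polynomial_functions V \<Longrightarrow>
    (\<lambda>t. f t * g t) \<in> polynomial_functions V"

lemma polynomial_functions_mono: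
  assumes "V \<subseteq> W" shows "polynomial_functions V \<subseteq> polynomial_functions W"
proof
  fix f assume "f \<in> polynomial_functions V"
  then show "f \<in> polynomial_functions W"
    by induction (use assms in \<open>auto intro: polynomial_functions.intros\<close>)
qed

text \<open>The extension lemmas ask for an integral domain as a type. It contains the polynomial
  functions in all variables; those in a finite set \<open>V\<close> come back as a subring with
  adjoined generators.\<close>

typedef (overloaded) ('v, 'f) polyfun =
  "polynomial_functions UNIV :: (('v \<Rightarrow> 'f::field) \<Rightarrow> 'f) set"
  morphisms eval_polyfun Polyfun
  by (rule exI[of _ "\<lambda>_. 0"]) (rule polynomial_functions.const)

setup_lifting type_definition_polyfun

instantiation polyfun :: (type, field) comm_ring_1
begin

lift_definition zero_polyfun :: "('a, 'b) polyfun" is "\<lambda>_. 0"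
  by (rule polynomial_functions.const)
lift_definition one_polyfun :: "('a, 'b) polyfun" is "\<lambda>_. 1"
  by (rule polynomial_functions.const)
lift_definition plus_polyfun :: "('a, 'b) polyfun \<Rightarrow> ('a, 'b) polyfun \<Rightarrow> ('a, 'b) polyfun"
  is "\<lambda>f g t. f t + g t" by (rule polynomial_functions.add)
lift_definition times_polyfun :: "('a, 'b) polyfun \<Rightarrow> ('a, 'b) polyfun \<Rightarrow> ('a, 'b) polyfun"
  is "\<lambda>f g t. f t * g t" by (rule polynomial_functions.mult)
lift_definition uminus_polyfun :: "('a, 'b) polyfun \<Rightarrow> ('a, 'b) polyfun"
  is "\<lambda>f t. - 1 * f t" by (intro polynomial_functions.mult polynomial_functions.const)
definition minus_polyfun :: "('a, 'b) polyfun \<Rightarrow> ('a, 'b) polyfun \<Rightarrow> ('a, 'b) polyfun" where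
  "minus_polyfun f g = f + - g"

instance
  by standard
    (simp add: minus_polyfun_def | transfer, auto simp: fun_eq_iff algebra_simps)+

end

lift_definition const_polyfun :: "'f::field \<Rightarrow> ('v, 'f) polyfun" is "\<lambda>c _. c"
  by (rule polynomial_functions.const)

lemma eval_polyfun_simps [simp]:
  "eval_polyfun 0 t = 0" "eval_polyfun 1 t = 1" "eval_polyfun (const_polyfun c) t = c"
  "eval_polyfun (f + g) t = eval_polyfun f t + eval_polyfun g t"
  "eval_polyfun (f * g) t = eval_polyfun f t * eval_polyfun g t"
  by (transfer; simp)+

lemma const_polyfun_simps:
  "const_polyfun 0 = 0" "const_polyfun 1 = 1"
  "const_polyfun (a + b) = const_polyfun a + const_polyfun b"
  "const_polyfun (a * b) = const_polyfun a * const_polyfun b"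
  by (transfer; simp)+

lemma polynomial_function_on_line:
  fixes a b :: "'v \<Rightarrow> 'f::field"
  assumes "f \<in> polynomial_functions V"
  shows "\<exists>p. \<forall>x. f (\<lambda>v. a v + x * (b v - a v)) = poly p x"
  using assms
proof induction
  case (const c)
  show ?case by (rule exI[of _ "[:c:]"]) simp
next
  case (var v)
  show ?case by (rule exI[of _ "[:a v, b v - a v:]"]) simp
next
  case (add f g)
  then obtain p q where "\<forall>x. f (\<lambda>v. a v + x * (b v - a v)) = poly p x"
    "\<forall>x. g (\<lambda>v. a v + x * (b v - a v)) = poly q x" by blast
  then show ?case by (intro exI[of _ "p + q"]) simp
next
  case (mult f g)
  then obtain p q where "\<forall>x. f (\<lambda>v. a v + x * (b v - a v)) = poly p x"
    "\<forall>x. g (\<lambda>v. a v + x * (b v - a v)) = poly q x" by blast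
  then show ?case by (intro exI[of _ "p * q"]) simp
qed

text \<open>On the line through \<open>a\<close> and \<open>b\<close> both functions become nonzero
  polynomials in one parameter, and the infinite field has a point that is no root of their
  product.\<close>

lemma polynomial_functions_no_zero_divisors:
  fixes f g :: "('v \<Rightarrow> 'f::alg_closed_field) \<Rightarrow> 'f"
  assumes fg: "f \<in> polynomial_functions V" "g \<in> polynomial_functions V"
    and nz: "f a \<noteq> 0" "g b \<noteq> 0"
  shows "\<exists>t. f t * g t \<noteq> 0"
proof -
  obtain p q where p: "\<And>x. f (\<lambda>v. a v + x * (b v - a v)) = poly p x"
    and q: "\<And>x. g (\<lambda>v. a v + x * (b v - a v)) = poly q x"
    using polynomial_function_on_line[OF fg(1), of a b]
      polynomial_function_on_line[OF fg(2), of a b] by blast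
  have "poly p 0 \<noteq> 0" "poly q 1 \<noteq> 0" using nz by (simp_all flip: p q)
  then have "p * q \<noteq> 0" by auto
  then have "finite {x. poly (p * q) x = 0}" by (rule poly_roots_finite)
  then obtain x where "poly (p * q) x \<noteq> 0"
    using infinite_UNIV_alg_closed_field[where 'f = 'f]
    by (metis (mono_tags, lifting) Collect_cong UNIV_def)
  then show ?thesis by (auto simp flip: p q)
qed

instance polyfun :: (type, alg_closed_field) idom
proof
  fix f g :: "('a, 'b) polyfun"
  assume "f \<noteq> 0" "g \<noteq> 0"
  then obtain a b where "eval_polyfun f a \<noteq> 0" "eval_polyfun g b \<noteq> 0"
    by (metis eval_polyfun_inject eval_polyfun_simps(1) ext)
  then obtain t where "eval_polyfun (f * g) t \<noteq> 0"
    using polynomial_functions_no_zero_divisors[OF eval_polyfun eval_polyfun] by fastforce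
  then show "f * g \<noteq> 0" by (metis eval_polyfun_simps(1))
qed

text \<open>A formal polynomial is a list of coefficients with words of variables, without
  collecting like terms. The map \<open>h\<close> lets the same list be evaluated in the field and
  in the ring of polynomial functions; later each word is turned into a product of Capelli
  values.\<close>

definition formal_value ::
  "('f \<Rightarrow> 'r::comm_ring_1) \<Rightarrow> ('i \<Rightarrow> 'r) \<Rightarrow> ('f \<times> 'i list) list \<Rightarrow> 'r" where
  "formal_value h c Q = (\<Sum>(q, w)\<leftarrow>Q. h q * (\<Prod>i\<leftarrow>w. c i))"

definition formal_mult ::
  "('f::comm_ring_1 \<times> 'i list) list \<Rightarrow> ('f \<times> 'i list) list \<Rightarrow> ('f \<times> 'i list) list" where
  "formal_mult Q Q' = concat (map (\<lambda>(q, w). map (\<lambda>(q', w'). (q * q', w @ w')) Q') Q)"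

lemma formal_value_append: "formal_value h c (Q @ Q') = formal_value h c Q + formal_value h c Q'"
  by (simp add: formal_value_def)

lemma formal_value_mult:
  assumes "\<And>a b. h (a * b) = h a * h b"
  shows "formal_value h c (formal_mult Q Q') = formal_value h c Q * formal_value h c Q'"
proof (induction Q)
  case (Cons a Q)
  obtain q w where a: "a = (q, w)" by (cases a)
  have "formal_value h c (map (\<lambda>(q', w'). (q * q', w @ w')) Q') =
      h q * (\<Prod>i\<leftarrow>w. c i) * formal_value h c Q'"
    by (induction Q') (auto simp: formal_value_def assms algebra_simps)
  with Cons show ?case
    by (simp add: a formal_mult_def formal_value_append algebra_simps)
      (simp add: formal_value_def algebra_simps)
qed (simp add: formal_value_def formal_mult_def)

lemma eval_polyfun_formal_value:
  "eval_polyfun (formal_value const_polyfun P Q) t =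
    formal_value (\<lambda>x. x) (\<lambda>i. eval_polyfun (P i) t) Q"
proof -
  have "eval_polyfun (\<Prod>i\<leftarrow>w. P i) t = (\<Prod>i\<leftarrow>w. eval_polyfun (P i) t)" for w
    by (induction w) auto
  then show ?thesis
    by (induction Q) (auto simp: formal_value_def)
qed

text \<open>The last assumption says that \<open>C\<close> and the image of \<open>p\<close> have the same Zariski closure; the
  image contains a nonempty open part of it.\<close>

lemma polynomial_image_meets_dense_set:
  fixes p :: "'i \<Rightarrow> ('v \<Rightarrow> 'f::alg_closed_field) \<Rightarrow> 'f"
  assumes "finite V" and p: "\<And>i. p i \<in> polynomial_functions V"
    and s: "s \<in> polynomial_functions V" "s t0 \<noteq> 0"
    and closure: "\<And>Q. (\<forall>t. formal_value (\<lambda>x. x) (\<lambda>i. p i t) Q = 0) \<longleftrightarrow>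
      (\<forall>c\<in>C. formal_value (\<lambda>x. x) c Q = 0)"
  shows "\<exists>t. s t \<noteq> 0 \<and> (\<lambda>i. p i t) \<in> C"
proof -
  have V_UNIV: "polynomial_functions V \<subseteq> polynomial_functions UNIV"
    by (intro polynomial_functions_mono) auto
  define P where "P i = Polyfun (p i)" for i
  have P: "eval_polyfun (P i) = p i" for i
    unfolding P_def using subsetD[OF V_UNIV p] by (rule Polyfun_inverse)
  define S where "S = Polyfun s"
  have S: "eval_polyfun S = s" unfolding S_def using subsetD[OF V_UNIV s(1)] by (rule Polyfun_inverse)
  define E where "E = formal_value (const_polyfun :: 'f \<Rightarrow> ('v, 'f) polyfun) P"
  define ev where "ev c = formal_value (\<lambda>x::'f. x) c" for c :: "'i \<Rightarrow> 'f"
  have eval_E: "eval_polyfun (E Q) t = ev (\<lambda>i. p i t) Q" for Q t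
    by (simp add: E_def ev_def eval_polyfun_formal_value P)
  have E0: "E Q = 0 \<longleftrightarrow> (\<forall>c\<in>C. ev c Q = 0)" for Q
  proof -
    have "E Q = 0 \<longleftrightarrow> (\<forall>t. ev (\<lambda>i. p i t) Q = 0)"
      by (metis eval_E eval_polyfun_inject eval_polyfun_simps(1) ext)
    then show ?thesis using closure by (simp add: ev_def)
  qed
  define neg where "neg Q = formal_mult [(- 1, [])] Q" for Q :: "('f \<times> 'i list) list"
  have E_hom: "E (Q @ Q') = E Q + E Q'" "E (formal_mult Q Q') = E Q * E Q'"
      "E [(q, [])] = const_polyfun q" "E [(1, [i])] = P i" for Q Q' q i
    by (simp_all add: E_def formal_value_append formal_value_mult const_polyfun_simps)
      (simp_all add: formal_value_def const_polyfun_simps)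
  have ev_hom: "ev c (Q @ Q') = ev c Q + ev c Q'" "ev c (formal_mult Q Q') = ev c Q * ev c Q'"
      "ev c [(q, [])] = q" "ev c [(1, [i])] = c i" for c Q Q' q i
    by (simp_all add: ev_def formal_value_append formal_value_mult)
      (simp_all add: formal_value_def)
  have neg1: "const_polyfun (- 1 :: 'f) = (- 1 :: ('v, 'f) polyfun)"
    using const_polyfun_simps(3)[of "- 1 :: 'f" 1]
    by (simp add: const_polyfun_simps eq_neg_iff_add_eq_0)
  have E_neg: "E (neg Q) = - E Q" and ev_neg: "ev c (neg Q) = - ev c Q" for Q c
    by (simp_all add: neg_def E_hom ev_hom neg1)
  define R where "R = range E"
  have R: "is_subring R"
    unfolding is_subring_def
  proof (intro conjI ballI)
    show "1 \<in> R" unfolding R_def using E_hom(3)[of 1] const_polyfun_simps(2) by (metis rangeI)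
  next
    fix x y assume "x \<in> R" "y \<in> R"
    then obtain Q Q' where "x = E Q" "y = E Q'" by (auto simp: R_def)
    then have "x - y = E (Q @ neg Q')" "x * y = E (formal_mult Q Q')"
      by (simp_all add: E_hom E_neg)
    then show "x - y \<in> R" "x * y \<in> R" by (simp_all add: R_def)
  qed
  obtain vs where vs: "set vs = V" using \<open>finite V\<close> finite_list by blast
  define X where "X v = Polyfun (\<lambda>t::'v \<Rightarrow> 'f. t v)" for v
  define ts where "ts = map X vs"
  define M where "M = foldl adjoin R ts"
  have M: "is_subring M" unfolding M_def by (rule is_subring_fold_adjoin[OF R])
  have RM: "R \<subseteq> M" unfolding M_def by (rule subset_fold_adjoin[OF R])
  have XM: "X v \<in> M" if "v \<in> V" for v
    using generators_in_fold_adjoin[OF R, of ts] that by (auto simp: M_def ts_def vs)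
  have constR: "const_polyfun q \<in> R" for q using E_hom(3) by (metis R_def rangeI)
  have eval_Pf: "eval_polyfun (Polyfun f) = f" if "f \<in> polynomial_functions V" for f :: "('v \<Rightarrow> 'f) \<Rightarrow> 'f"
    using subsetD[OF V_UNIV that] by (rule Polyfun_inverse)
  have Pf_simps:
    "Polyfun (\<lambda>_::'v \<Rightarrow> 'f. c) = const_polyfun c"
    "f \<in> polynomial_functions V \<Longrightarrow> g \<in> polynomial_functions V \<Longrightarrow>
       Polyfun (\<lambda>t. f t + g t) = Polyfun f + Polyfun g"
    "f \<in> polynomial_functions V \<Longrightarrow> g \<in> polynomial_functions V \<Longrightarrow>
       Polyfun (\<lambda>t. f t * g t) = Polyfun f * Polyfun g" for c and f g :: "('v \<Rightarrow> 'f) \<Rightarrow> 'f"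
    by (intro eval_polyfun_inject[THEN iffD1] ext, simp add: eval_Pf polynomial_functions.intros)+
  have in_M: "Polyfun f \<in> M" if "f \<in> polynomial_functions V" for f
    using that
  proof induction
    case (const c)
    then show ?case using constR RM by (auto simp: Pf_simps)
  next
    case (var v)
    then show ?case using XM by (simp add: X_def)
  qed (simp_all add: Pf_simps subring_add[OF M] subring_mult[OF M])
  have SM: "S \<in> M" unfolding S_def by (rule in_M[OF s(1)])
  have "S \<noteq> 0" using S s(2) by auto
  then obtain r where r: "r \<in> R" "r \<noteq> 0"
    and ext: "\<And>\<phi> :: ('v, 'f) polyfun \<Rightarrow> 'f. is_hom_on R \<phi> \<Longrightarrow> \<phi> r \<noteq> 0 \<Longrightarrow>
       \<exists>\<phi>'. is_hom_on M \<phi>' \<and> (\<forall>x\<in>R. \<phi>' x = \<phi> x) \<and> \<phi>' S \<noteq> 0"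
    using hom_on_extend_fold_adjoin[OF R SM[unfolded M_def], where 'f = 'f] unfolding M_def by metis
  \<comment> \<open>Being nonzero, \<open>r\<close> cannot vanish on all of \<open>C\<close>, so
    some \<open>c\<close> in \<open>C\<close> avoids its zero set.\<close>
  obtain Q0 where Q0: "r = E Q0" using r by (auto simp: R_def)
  then obtain c where c: "c \<in> C" "ev c Q0 \<noteq> 0" using r E0 by blast
  \<comment> \<open>Evaluation at \<open>c\<close>. It does not depend on the chosen
    \<open>Q\<close>, because every relation among the \<open>p i\<close> holds on
    \<open>C\<close>.\<close>
  define \<phi> where "\<phi> x = ev c (SOME Q. E Q = x)" for x
  have \<phi>: "\<phi> (E Q) = ev c Q" for Q
  proof -
    define Q' where "Q' = (SOME Q'. E Q' = E Q)"
    have "E Q' = E Q" unfolding Q'_def by (rule someI[of _ Q]) simp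
    then have "E (Q' @ neg Q) = 0" by (simp add: E_hom E_neg)
    then have "ev c (Q' @ neg Q) = 0" using E0 c by blast
    then show ?thesis by (simp add: \<phi>_def Q'_def[symmetric] ev_hom ev_neg)
  qed
  have "is_hom_on R \<phi>"
    unfolding is_hom_on_def
  proof (intro conjI ballI)
    show "\<phi> 1 = 1" using \<phi>[of "[(1, [])]"] by (simp add: E_hom ev_hom const_polyfun_simps)
  next
    fix x y assume "x \<in> R" "y \<in> R"
    then obtain Q Q' where Q: "x = E Q" "y = E Q'" by (auto simp: R_def)
    show "\<phi> (x + y) = \<phi> x + \<phi> y"
      using \<phi>[of "Q @ Q'"] by (simp add: Q E_hom ev_hom \<phi>)
    show "\<phi> (x * y) = \<phi> x * \<phi> y"
      using \<phi>[of "formal_mult Q Q'"] by (simp add: Q E_hom ev_hom \<phi>)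
  qed
  moreover have "\<phi> r \<noteq> 0" using c by (simp add: Q0 \<phi>)
  ultimately obtain \<phi>' where \<phi>': "is_hom_on M \<phi>'" "\<And>x. x \<in> R \<Longrightarrow> \<phi>' x = \<phi> x" "\<phi>' S \<noteq> 0"
    using ext by blast
  \<comment> \<open>The values of the extension at the coordinate functions are the parameters of a
    point above \<open>c\<close>.\<close>
  define t where "t v = \<phi>' (X v)" for v
  have at_t: "\<phi>' (Polyfun f) = f t" if "f \<in> polynomial_functions V" for f
    using that
  proof induction
    case (const c)
    show ?case using \<phi>'(2)[OF constR] \<phi>[of "[(c, [])]"] by (simp add: Pf_simps E_hom ev_hom)
  next
    case (var v)
    show ?case by (simp add: t_def X_def)
  qed (simp_all add: Pf_simps hom_on_add[OF M \<phi>'(1)] hom_on_mult[OF M \<phi>'(1)] in_M)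
  have "p i t = c i" for i
  proof -
    have "P i \<in> R" using E_hom(4) by (metis R_def rangeI)
    then show ?thesis
      using at_t[OF p, of i] \<phi>'(2)[of "P i"] \<phi>[of "[(1, [i])]"]
      by (simp add: E_hom ev_hom P_def)
  qed
  then have "(\<lambda>i. p i t) = c" by auto
  moreover have "s t \<noteq> 0" using at_t[OF s(1)] \<phi>'(3) by (simp add: S_def)
  ultimately show ?thesis using c by auto
qed

section \<open>Families of vectors and density\<close>

text \<open>Families indexed by numbers rather than sets of vectors, because degrees, permutations
  and structure constants all refer to positions.\<close>

definition indep_family :: "('f::zero \<Rightarrow> 'b \<Rightarrow> 'b::comm_monoid_add) \<Rightarrow> nat \<Rightarrow> (nat \<Rightarrow> 'b) \<Rightarrow> bool" where
  "indep_family scale n v \<longleftrightarrow> (\<forall>c. (\<Sum>i<n. scale (c i) (v i)) = 0 \<longrightarrow> (\<forall>i<n. c i = 0))"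

context vector_space
begin

lemma indep_familyD: "indep_family scale n v \<Longrightarrow> (\<Sum>i<n. c i *s v i) = 0 \<Longrightarrow> i < n \<Longrightarrow> c i = 0"
  by (auto simp: indep_family_def)

lemma indep_family_unique:
  assumes "indep_family scale n v" "(\<Sum>i<n. c i *s v i) = (\<Sum>i<n. d i *s v i)" "i < n"
  shows "c i = d i"
  using indep_familyD[OF assms(1), of "\<lambda>i. c i - d i"] assms(2,3)
  by (simp add: scale_left_diff_distrib sum_subtractf)

lemma indep_family_if_independent:
  assumes "bij_betw v {..<n} B" "independent B"
  shows "indep_family scale n v"
  unfolding indep_family_def
proof (intro allI impI)
  fix c i assume c: "(\<Sum>i<n. c i *s v i) = 0" and i: "i < n"
  have inj: "inj_on v {..<n}" and B: "B = v ` {..<n}" using assms(1) by (auto simp: bij_betw_def)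
  have "(\<Sum>b\<in>B. c (the_inv_into {..<n} v b) *s b) = 0"
    unfolding B using c by (simp add: sum.reindex[OF inj] the_inv_into_f_f[OF inj])
  moreover have "finite B" using B by simp
  ultimately have "c (the_inv_into {..<n} v (v i)) = 0"
    using independentD[OF assms(2), of B "\<lambda>b. c (the_inv_into {..<n} v b)" "v i"] i
    by (auto simp: B)
  then show "c i = 0" using i by (simp add: the_inv_into_f_f[OF inj])
qed

end

context finite_dimensional_vector_space
begin

lemma indep_family_le_dimension:
  assumes "indep_family scale n v" shows "n \<le> dimension"
proof -
  have inj: "inj_on v {..<n}"
  proof (rule inj_onI, rule ccontr)
    fix i j assume ij: "i \<in> {..<n}" "j \<in> {..<n}" "v i = v j" "i \<noteq> j"
    have "(\<Sum>k<n. ((if k = i then 1 else 0) - (if k = j then 1 else 0)) *s v k) = 0"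
      using ij by (simp add: scale_left_diff_distrib sum_subtractf if_distribR cong: if_cong)
        (simp add: if_distrib[where f = "\<lambda>c. c *s _"] sum.delta cong: if_cong)
    from indep_familyD[OF assms this, of i] show False using ij by simp
  qed
  have "independent (v ` {..<n})"
  proof (rule independent_if_scalars_zero)
    fix f x assume f: "(\<Sum>x\<in>v ` {..<n}. f x *s x) = 0" and "x \<in> v ` {..<n}"
    then obtain i where "i < n" "x = v i" by auto
    moreover have "(\<Sum>i<n. f (v i) *s v i) = 0" using f by (simp add: sum.reindex[OF inj])
    ultimately show "f x = 0" using indep_familyD[OF assms, of "\<lambda>i. f (v i)"] by simp
  qed simp
  then have "card (v ` {..<n}) \<le> dimension"
    using independent_card_le_dim[of "v ` {..<n}" UNIV] by (simp add: dimension_def)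
  then show ?thesis by (simp add: card_image[OF inj])
qed

text \<open>With \<open>y\<close> appended there are \<open>dimension + 1\<close> vectors; they are
  dependent, and the dependence must involve \<open>y\<close>.\<close>

lemma indep_family_spans:
  assumes v: "indep_family scale dimension v"
  obtains c where "y = (\<Sum>i<dimension. c i *s v i)"
proof -
  define w where "w = v(dimension := y)"
  have "\<not> indep_family scale (Suc dimension) w" using indep_family_le_dimension by force
  then obtain c j where c: "(\<Sum>i<Suc dimension. c i *s w i) = 0" "j < Suc dimension" "c j \<noteq> 0"
    by (auto simp: indep_family_def)
  have eq: "(\<Sum>i<dimension. c i *s v i) + c dimension *s y = 0"
    using c(1) by (simp add: w_def)
  have c0: "c dimension \<noteq> 0"
  proof
    assume "c dimension = 0"
    with eq have "(\<Sum>i<dimension. c i *s v i) = 0" by simp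
    then show False using indep_familyD[OF v, of c j] c \<open>c dimension = 0\<close> less_Suc_eq by auto
  qed
  have "c dimension *s y = - (\<Sum>i<dimension. c i *s v i)"
    using eq by (simp add: eq_neg_iff_add_eq_0 add.commute)
  then have "inverse (c dimension) *s (c dimension *s y) =
      - (\<Sum>i<dimension. (inverse (c dimension) * c i) *s v i)"
    by (simp add: scale_sum_right)
  then have "y = (\<Sum>i<dimension. (- inverse (c dimension) * c i) *s v i)"
    using c0 by (simp add: sum_negf)
  then show ?thesis by (rule that)
qed

end

text \<open>Take \<open>p\<close> of least degree with \<open>p(\<phi>) u = 0\<close> and split off
  a root, \<open>p = (X - l) q\<close>; then \<open>q(\<phi>) u\<close> is an eigenvector. Linearity
  is asked on \<open>V\<close> only, since the operator in the density argument is constructed on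
  \<open>V\<close> alone. Existence of roots is a premise because the scalars of the locale form an
  arbitrary field.\<close>

lemma (in finite_dimensional_vector_space) eigenvector_exists:
  assumes alg_closed: "\<And>p :: 'a poly. degree p > 0 \<Longrightarrow> \<exists>x. poly p x = 0"
    and V: "subspace V" "u \<in> V" "u \<noteq> 0"
    and \<phi>_add: "\<And>x y. x \<in> V \<Longrightarrow> y \<in> V \<Longrightarrow> \<phi> (x + y) = \<phi> x + \<phi> y"
    and \<phi>_scale: "\<And>c x. x \<in> V \<Longrightarrow> \<phi> (c *s x) = c *s \<phi> x"
    and \<phi>_V: "\<And>x. x \<in> V \<Longrightarrow> \<phi> x \<in> V"
  obtains l y where "y \<in> V" "y \<noteq> 0" "\<phi> y = l *s y"
proof -
  have pow_V: "(\<phi> ^^ i) u \<in> V" for i by (induction i) (auto simp: V \<phi>_V)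
  have \<phi>_sum: "\<phi> (\<Sum>i\<in>I. c i *s (\<phi> ^^ i) u) = (\<Sum>i\<in>I. c i *s (\<phi> ^^ Suc i) u)"
    if "finite I" for I c
    using that
  proof (induction I rule: finite_induct)
    case empty
    show ?case using \<phi>_scale[OF V(2), of 0] by simp
  next
    case (insert i I)
    then show ?case
      using pow_V V(1) by (simp add: \<phi>_add \<phi>_scale subspace_scale subspace_sum)
  qed
  define ev where "ev p = (\<Sum>i\<le>degree p. coeff p i *s (\<phi> ^^ i) u)" for p
  have ev: "ev p = (\<Sum>i\<le>N. coeff p i *s (\<phi> ^^ i) u)" if "degree p \<le> N" for p N
    unfolding ev_def using that by (intro sum.mono_neutral_left) (auto simp: coeff_eq_0)
  define P where "P p \<longleftrightarrow> p \<noteq> 0 \<and> ev p = 0" for p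
  have "\<exists>p. P p"
  proof -
    have "\<not> indep_family scale (Suc dimension) (\<lambda>i. (\<phi> ^^ i) u)"
      using indep_family_le_dimension by force
    then obtain c j where c: "(\<Sum>i\<le>dimension. c i *s (\<phi> ^^ i) u) = 0" "j \<le> dimension" "c j \<noteq> 0"
      by (auto simp: indep_family_def lessThan_Suc_atMost less_Suc_eq_le)
    define p where "p = (\<Sum>i\<le>dimension. monom (c i) i)"
    have co: "coeff p i = (if i \<le> dimension then c i else 0)" for i
      by (simp add: p_def coeff_sum)
    have "degree p \<le> dimension" by (rule degree_le) (simp add: co)
    then have "ev p = 0" using c(1) by (simp add: ev co)
    moreover have "p \<noteq> 0" using co[of j] c by auto
    ultimately show ?thesis unfolding P_def by blast
  qed
  then obtain p where p: "P p" and p_min: "\<And>q. P q \<Longrightarrow> degree p \<le> degree q"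
    using ex_has_least_nat[of P _ degree] by blast
  have "degree p > 0"
  proof (rule ccontr)
    assume "\<not> ?thesis"
    then obtain a where "p = [:a:]" by (auto elim: degree_eq_zeroE)
    then show False using p V by (auto simp: P_def ev_def)
  qed
  then obtain l where "poly p l = 0" using alg_closed by blast
  then obtain q where q: "p = [:- l, 1:] * q" by (auto simp: poly_eq_0_iff_dvd dvd_def)
  have q0: "q \<noteq> 0" using p q by (auto simp: P_def)
  have degq: "degree p = Suc (degree q)" unfolding q using q0 by (subst degree_mult_eq) auto
  have "ev q \<noteq> 0" using p_min[of q] q0 degq by (auto simp: P_def)
  moreover have "ev q \<in> V" unfolding ev_def using V(1) pow_V by (intro subspace_sum subspace_scale)
  moreover have "\<phi> (ev q) - l *s ev q = ev p"
  proof -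
    let ?n = "Suc (degree q)"
    have "\<phi> (ev q) = (\<Sum>i\<le>degree q. coeff q i *s (\<phi> ^^ Suc i) u)"
      unfolding ev_def by (rule \<phi>_sum) simp
    also have "\<dots> = (\<Sum>i\<le>?n. coeff (pCons 0 q) i *s (\<phi> ^^ i) u)"
      by (subst sum.atMost_Suc_shift) simp
    finally have "\<phi> (ev q) = (\<Sum>i\<le>?n. coeff (pCons 0 q) i *s (\<phi> ^^ i) u)" .
    moreover have "l *s ev q = (\<Sum>i\<le>?n. (l * coeff q i) *s (\<phi> ^^ i) u)"
      by (subst ev[of q ?n]) (simp_all add: scale_sum_right scale_right_distrib)
    moreover have "ev p = (\<Sum>i\<le>?n. (coeff (pCons 0 q) i - l * coeff q i) *s (\<phi> ^^ i) u)"
      by (subst ev[of p ?n]) (simp_all add: degq, simp_all add: q)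
    ultimately show ?thesis by (simp add: scale_left_diff_distrib sum_subtractf)
  qed
  moreover have "ev p = 0" using p by (simp add: P_def)
  ultimately show ?thesis using that[of "ev q" l] by simp
qed

text \<open>Jacobson density. By Schur's lemma an operator commuting with \<open>E\<close> is a scalar, so the
  commutant does not enter.\<close>

lemma (in finite_dimensional_vector_space) density:
  assumes alg_closed: "\<And>p :: 'a poly. degree p > 0 \<Longrightarrow> \<exists>x. poly p x = 0"
    and V: "subspace V"
    and lin_add: "\<And>T a b. T \<in> E \<Longrightarrow> T (a + b) = T a + T b"
    and lin_scale: "\<And>T c a. T \<in> E \<Longrightarrow> T (c *s a) = c *s T a"
    and E_V: "\<And>T x. T \<in> E \<Longrightarrow> x \<in> V \<Longrightarrow> T x \<in> V"
    and E_add: "\<And>T S. T \<in> E \<Longrightarrow> S \<in> E \<Longrightarrow> (\<lambda>x. T x + S x) \<in> E"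
    and E_scale: "\<And>c T. T \<in> E \<Longrightarrow> (\<lambda>x. c *s T x) \<in> E"
    and E_comp: "\<And>T S. T \<in> E \<Longrightarrow> S \<in> E \<Longrightarrow> (\<lambda>x. T (S x)) \<in> E"
    and E_irred: "\<And>x y. x \<in> V \<Longrightarrow> x \<noteq> 0 \<Longrightarrow> y \<in> V \<Longrightarrow> \<exists>T\<in>E. T x = y"
    and "finite S" "S \<subseteq> V" "x \<in> V" "x \<notin> span S"
  shows "\<exists>T\<in>E. (\<forall>w\<in>S. T w = 0) \<and> T x \<noteq> 0"
  using assms(10-)
proof (induction S arbitrary: x rule: finite_induct)
  case empty
  then have "x \<noteq> 0" using span_zero by auto
  then obtain T where "T \<in> E" "T x = x" using E_irred[of x x] empty by blast
  then show ?case using \<open>x \<noteq> 0\<close> by (intro bexI[of _ T]) auto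
next
  case (insert w S)
  have lin_diff: "T (a - b) = T a - T b" if "T \<in> E" for T a b
    using lin_add[OF that, of "a - b" b] by simp
  show ?case
  proof (rule ccontr)
    assume neg: "\<not> ?thesis"
    let ?ann = "\<lambda>T. T \<in> E \<and> (\<forall>w\<in>S. T w = 0)"
    have kill: "T x = 0" if "?ann T" "T w = 0" for T using neg that by blast
    have ann_scale: "?ann (\<lambda>x. c *s T x)" if "?ann T" for c T using that E_scale[of T c] by simp
    have ann_add: "?ann (\<lambda>x. T x + U x)" if "?ann T" "?ann U" for T U
      using that E_add[of T U] by simp
    have ann_comp: "?ann (\<lambda>x. U (T x))" if "?ann T" "U \<in> E" for T U
      using that E_comp[of U T] lin_scale[of U 0 0] by simp
    have wV: "w \<in> V" and SV: "S \<subseteq> V" using insert.prems by auto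
    have "span S \<subseteq> span (insert w S)" by (rule span_mono) (rule subset_insertI)
    then have xS: "x \<notin> span S" using insert.prems(3) by blast
    have wS: "w \<notin> span S"
    proof
      assume w: "w \<in> span S"
      obtain T where T: "?ann T" "T x \<noteq> 0" using insert.IH[OF SV insert.prems(2) xS] by blast
      have "T w = 0"
        by (rule span_induct[OF w, of "\<lambda>w. T w = 0"])
          (use T lin_add[of T] lin_scale[of T] lin_scale[of T 0 0] in \<open>simp_all add: subspace_def\<close>)
      then show False using kill[OF T(1)] T(2) by blast
    qed
    obtain T0 where T0: "?ann T0" "T0 w \<noteq> 0" using insert.IH[OF SV wV wS] by blast
    have ex: "\<exists>T. ?ann T \<and> T w = y" if "y \<in> V" for y
    proof -
      have "T0 w \<in> V" using T0(1) wV E_V by simp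
      from E_irred[OF this T0(2) that] obtain U where U: "U \<in> E" "U (T0 w) = y" ..
      show ?thesis by (intro exI[of _ "\<lambda>x. U (T0 x)"] conjI[OF ann_comp[OF T0(1) U(1)]] U(2))
    qed
    \<comment> \<open>The map \<open>T w \<mapsto> T x\<close> for \<open>T\<close> annihilating
      \<open>S\<close>. By \<open>kill\<close> it is well defined, and every vector of
      \<open>V\<close> has the form \<open>T w\<close>.\<close>
    define \<phi> where "\<phi> y = (SOME T. ?ann T \<and> T w = y) x" for y
    have \<phi>: "\<phi> y = T x" if T: "?ann T" "T w = y" "y \<in> V" for T y
    proof -
      define T' where "T' = (SOME T. ?ann T \<and> T w = y)"
      have T': "?ann T'" "T' w = y" using someI_ex[OF ex[OF that(3)]] by (auto simp: T'_def)
      have "T' x + (- 1) *s T x = 0"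
        by (rule kill[OF ann_add[OF T'(1) ann_scale[OF T(1)]]]) (use T T' in simp)
      then show ?thesis by (simp add: \<phi>_def T'_def)
    qed
    have \<phi>_V: "\<phi> y \<in> V" if y: "y \<in> V" for y
    proof -
      obtain T where "?ann T" "T w = y" using ex[OF y] by blast
      then show ?thesis using \<phi>[OF _ _ y, of T] E_V[of T x] insert.prems(2) by simp
    qed
    obtain l y where y: "y \<in> V" "y \<noteq> 0" "\<phi> y = l *s y"
    proof (rule eigenvector_exists[OF alg_closed V wV, of \<phi>])
      show "w \<noteq> 0" using wS span_zero by auto
    next
      fix a b assume ab: "a \<in> V" "b \<in> V"
      obtain T U where TU: "?ann T" "T w = a" "?ann U" "U w = b"
        using ex[OF ab(1)] ex[OF ab(2)] by blast
      show "\<phi> (a + b) = \<phi> a + \<phi> b"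
        using \<phi>[OF ann_add[OF TU(1,3)], of "a + b"] \<phi>[OF TU(1,2)] \<phi>[OF TU(3,4)] ab TU(2,4)
        by (simp add: subspace_add[OF V])
    next
      fix c a assume a: "a \<in> V"
      obtain T where T: "?ann T" "T w = a" using ex[OF a] by blast
      show "\<phi> (c *s a) = c *s \<phi> a"
        using \<phi>[OF ann_scale[OF T(1)], of c "c *s a"] \<phi>[OF T] a T(2)
        by (simp add: subspace_scale[OF V])
    qed (auto intro: \<phi>_V)
    \<comment> \<open>\<open>\<phi>\<close> commutes with \<open>E\<close>, and \<open>E\<close>
      carries the eigenvector \<open>y\<close> to any vector, so the eigenvalue is the same
      everywhere.\<close>
    have scalar: "\<phi> z = l *s z" if z: "z \<in> V" for z
    proof -
      obtain U where U: "U \<in> E" "U y = z" using E_irred[OF y(1,2) z] ..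
      obtain T where T: "?ann T" "T w = y" using ex[OF y(1)] by blast
      have "\<phi> z = U (T x)" by (rule \<phi>[OF ann_comp[OF T(1) U(1)]]) (use T U z in auto)
      also have "T x = l *s y" using \<phi>[OF T y(1)] y by simp
      finally show ?thesis using U(2) lin_scale[OF U(1)] by simp
    qed
    \<comment> \<open>No operator annihilating \<open>S\<close> separates \<open>x - l *s w\<close>
      from 0, so the induction hypothesis puts this vector into the span of
      \<open>S\<close>.\<close>
    have "T (x - l *s w) = 0" if "?ann T" for T
      using scalar[of "T w"] \<phi>[OF that refl] E_V[of T w] that wV by (simp add: lin_diff lin_scale)
    then have "x - l *s w \<in> span S"
      using insert.IH[OF SV, of "x - l *s w"]
        subspace_diff[OF V insert.prems(2) subspace_scale[OF V wV]] by blast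
    then have "x \<in> span (insert w S)" unfolding span_insert by blast
    then show False using insert.prems by blast
  qed
qed

section \<open>Graded simple algebras\<close>

context assoc_algebra
begin

lemma span_mult_closed:
  assumes I: "subspace I" and "\<And>x y. x \<in> X \<Longrightarrow> y \<in> Y \<Longrightarrow> x * y \<in> I"
    and "x \<in> span X" "y \<in> span Y"
  shows "x * y \<in> I"
proof -
  have "x * y \<in> I" if y: "y \<in> Y" for y
    by (rule span_induct[OF assms(3), of "\<lambda>x. x * y \<in> I"])
      (use I assms(2) y in \<open>auto simp: subspace_def distrib_right scale_mult_left\<close>)
  then show ?thesis
    by (intro span_induct[OF assms(4), of "\<lambda>y. x * y \<in> I"])
      (use I in \<open>auto simp: subspace_def distrib_left scale_mult_right\<close>)
qed

end

context graded_algebra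
begin

section \<open>Homogeneous components\<close>

definition homog :: "'a set" where "homog = (\<Union>g\<in>carrier G. A g)"

definition is_decomp :: "('g \<Rightarrow> 'a) \<Rightarrow> 'a \<Rightarrow> bool" where
  "is_decomp v x \<longleftrightarrow> (\<forall>g\<in>carrier G. v g \<in> A g) \<and> (\<forall>g. g \<notin> carrier G \<longrightarrow> v g = 0) \<and>
     finite {g. v g \<noteq> 0} \<and> x = (\<Sum>g | v g \<noteq> 0. v g)"

definition component :: "'g \<Rightarrow> 'a \<Rightarrow> 'a" where
  "component g x = (THE v. is_decomp v x) g"

lemma subspace_A: "g \<in> carrier G \<Longrightarrow> subspace (A g)"
  using decomposition by (auto simp: direct_sum_decomp_def)

lemma is_decomp_ex1: "\<exists>!v. is_decomp v x"
  using decomposition unfolding direct_sum_decomp_def is_decomp_def by blast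

lemma component_eqI: "is_decomp v x \<Longrightarrow> component g x = v g"
  unfolding component_def using is_decomp_ex1 the1_equality by metis

lemma is_decomp_component: "is_decomp (\<lambda>g. component g x) x"
  unfolding component_def using theI'[OF is_decomp_ex1] by simp

lemma component_in: "g \<in> carrier G \<Longrightarrow> component g x \<in> A g"
  and component_outside: "g \<notin> carrier G \<Longrightarrow> component g x = 0"
  and finite_components: "finite {g. component g x \<noteq> 0}"
  and sum_components: "(\<Sum>g | component g x \<noteq> 0. component g x) = x"
  using is_decomp_component[of x] by (auto simp: is_decomp_def)

lemma component_sum:
  assumes "finite S" "S \<subseteq> carrier G" "\<And>g. g \<in> S \<Longrightarrow> v g \<in> A g"
  shows "component h (\<Sum>g\<in>S. v g) = (if h \<in> S then v h else 0)"
proof (rule component_eqI, unfold is_decomp_def, intro conjI ballI allI impI)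
  let ?v = "\<lambda>h. if h \<in> S then v h else 0"
  show "?v g \<in> A g" if "g \<in> carrier G" for g
    using that assms subspace_0[OF subspace_A] by auto
  show "finite {g. ?v g \<noteq> 0}" by (rule finite_subset[OF _ assms(1)]) auto
  show "(\<Sum>g\<in>S. v g) = (\<Sum>g | ?v g \<noteq> 0. ?v g)"
    by (rule sum.mono_neutral_cong_right) (use assms in auto)
qed (use assms in auto)

lemma component_homog:
  "g \<in> carrier G \<Longrightarrow> x \<in> A g \<Longrightarrow> component h x = (if h = g then x else 0)"
  using component_sum[of "{g}" "\<lambda>_. x" h] by auto

lemma component_sum_superset:
  "finite S \<Longrightarrow> {g. component g x \<noteq> 0} \<subseteq> S \<Longrightarrow> (\<Sum>g\<in>S. component g x) = x"
  by (rule trans[OF sum.mono_neutral_right sum_components]) auto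

lemma component_zero [simp]: "component g 0 = 0"
  using component_sum[of "{}" undefined g] by simp

lemma component_add: "component g (x + y) = component g x + component g y"
proof -
  let ?S = "{g. component g x \<noteq> 0} \<union> {g. component g y \<noteq> 0}"
  have S: "finite ?S" using finite_components by simp
  have eq: "(\<Sum>g\<in>?S. component g x + component g y) = x + y"
    unfolding sum.distrib
    by (rule arg_cong2[of _ _ _ _ "(+)"]; rule component_sum_superset[OF S]) auto
  have car: "?S \<subseteq> carrier G" using component_outside by auto
  have mem: "component g x + component g y \<in> A g" if "g \<in> ?S" for g
    using car that by (intro subspace_add subspace_A component_in) auto
  have "component g (x + y) = (if g \<in> ?S then component g x + component g y else 0)"
    using component_sum[OF S car mem, of g] unfolding eq .
  then show ?thesis by auto
qed

lemma component_scale: "component g (c *s x) = c *s component g x"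
proof -
  let ?S = "{g. component g x \<noteq> 0}"
  have eq: "(\<Sum>g\<in>?S. c *s component g x) = c *s x"
    by (simp add: sum_components flip: scale_sum_right)
  have car: "?S \<subseteq> carrier G" using component_outside by auto
  have mem: "c *s component g x \<in> A g" if "g \<in> ?S" for g
    using car that by (intro subspace_scale subspace_A component_in) auto
  have "component g (c *s x) = (if g \<in> ?S then c *s component g x else 0)"
    using component_sum[OF finite_components car mem, of g] unfolding eq .
  then show ?thesis by auto
qed

lemma component_sum_distrib: "component g (\<Sum>i\<in>I. f i) = (\<Sum>i\<in>I. component g (f i))"
  by (induction I rule: infinite_finite_induct) (auto simp: component_add)

lemma in_span_homog: "x \<in> span homog"
proof -
  have "component g x \<in> homog" if "component g x \<noteq> 0" for g
    using component_in[of g x] component_outside[of g x] that unfolding homog_def by blast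
  then have "(\<Sum>g | component g x \<noteq> 0. component g x) \<in> span homog"
    by (intro span_sum span_base) simp
  then show ?thesis by (simp add: sum_components)
qed

text \<open>Left translation in a group is injective, so a homogeneous factor moves components
  without mixing them.\<close>

lemma component_mult_left:
  assumes "h \<in> carrier G" "a \<in> A h" "g \<in> carrier G"
  shows "component (h \<otimes> g) (a * x) = a * component g x"
proof (rule span_induct[OF in_span_homog[of x], of "\<lambda>x. component (h \<otimes> g) (a * x) = a * component g x"])
  show "subspace {x. component (h \<otimes> g) (a * x) = a * component g x}"
    by (auto simp: subspace_def distrib_left component_add scale_mult_right component_scale)
next
  fix x assume "x \<in> homog"
  then obtain k where k: "k \<in> carrier G" "x \<in> A k" by (auto simp: homog_def)
  have "a * x \<in> A (h \<otimes> k)" using assms k by (intro mult_component)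
  then have "component (h \<otimes> g) (a * x) = (if h \<otimes> g = h \<otimes> k then a * x else 0)"
    using assms k by (intro component_homog) auto
  moreover have "h \<otimes> g = h \<otimes> k \<longleftrightarrow> g = k" using assms k by simp
  ultimately show "component (h \<otimes> g) (a * x) = a * component g x"
    by (simp add: component_homog[OF k])
qed

lemma component_mult_right:
  assumes "h \<in> carrier G" "a \<in> A h" "g \<in> carrier G"
  shows "component (g \<otimes> h) (x * a) = component g x * a"
proof (rule span_induct[OF in_span_homog[of x], of "\<lambda>x. component (g \<otimes> h) (x * a) = component g x * a"])
  show "subspace {x. component (g \<otimes> h) (x * a) = component g x * a}"
    by (auto simp: subspace_def distrib_right component_add scale_mult_left component_scale)
next
  fix x assume "x \<in> homog"
  then obtain k where k: "k \<in> carrier G" "x \<in> A k" by (auto simp: homog_def)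
  have "x * a \<in> A (k \<otimes> h)" using assms k by (intro mult_component)
  then have "component (g \<otimes> h) (x * a) = (if g \<otimes> h = k \<otimes> h then x * a else 0)"
    using assms k by (intro component_homog) auto
  moreover have "g \<otimes> h = k \<otimes> h \<longleftrightarrow> g = k" using assms k by simp
  ultimately show "component (g \<otimes> h) (x * a) = component g x * a"
    by (simp add: component_homog[OF k])
qed

text \<open>Homogeneous multipliers suffice because they span the algebra; uniqueness of the
  decomposition is inherited from the whole algebra.\<close>

lemma graded_idealI:
  assumes I: "subspace I" and "\<And>x a. x \<in> I \<Longrightarrow> a \<in> homog \<Longrightarrow> a * x \<in> I"
    and "\<And>x a. x \<in> I \<Longrightarrow> a \<in> homog \<Longrightarrow> x * a \<in> I"
    and comp: "\<And>x g. x \<in> I \<Longrightarrow> g \<in> carrier G \<Longrightarrow> component g x \<in> I"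
  shows "graded_ideal I"
proof -
  have left: "a * x \<in> I" if x: "x \<in> I" for a x
  proof (rule span_mult_closed[of I homog I a x])
    show "x \<in> span I" using x by (rule span_base)
  qed (rule I assms(2) in_span_homog; assumption)+
  have right: "x * a \<in> I" if x: "x \<in> I" for a x
  proof (rule span_mult_closed[of I I homog x a])
    show "x \<in> span I" using x by (rule span_base)
  qed (rule I assms(3) in_span_homog; assumption)+
  have "algebra_ideal I" using I left right by (simp add: algebra_ideal_def)
  moreover have "direct_sum_decomp (carrier G) (\<lambda>g. I \<inter> A g) I"
    unfolding direct_sum_decomp_def
  proof (intro conjI ballI)
    fix g assume "g \<in> carrier G"
    then show "subspace (I \<inter> A g)" by (intro subspace_inter I subspace_A)
  next
    fix x assume x: "x \<in> I"
    show "\<exists>!v. (\<forall>i\<in>carrier G. v i \<in> I \<inter> A i) \<and> (\<forall>i. i \<notin> carrier G \<longrightarrow> v i = 0) \<and>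
        finite {i. v i \<noteq> 0} \<and> x = (\<Sum>i | v i \<noteq> 0. v i)" (is "\<exists>!v. ?P v")
    proof (rule ex1I[of _ "\<lambda>g. component g x"])
      show "?P (\<lambda>g. component g x)"
        using is_decomp_component[of x] comp[OF x] by (auto simp: is_decomp_def)
    next
      fix v assume "?P v"
      then have "is_decomp v x" by (auto simp: is_decomp_def)
      then show "v = (\<lambda>g. component g x)" by (auto simp: component_eqI)
    qed
  qed (use I in auto)
  ultimately show ?thesis by (simp add: graded_ideal_def)
qed

lemma homog_mult: "x \<in> homog \<Longrightarrow> y \<in> homog \<Longrightarrow> x * y \<in> homog"
  unfolding homog_def using mult_component by blast

end

section \<open>Graded simplicity and graded primeness\<close>

context simple_graded_algebra
begin

text \<open>This stands in for a unit. The vectors \<open>x\<close> with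
  \<open>a * x * b = 0\<close> for all homogeneous \<open>a\<close>, \<open>b\<close> form a graded
  ideal. It could be everything only if all triple products were 0, although products span the
  algebra.\<close>

lemma two_sided_annihilator_trivial:
  assumes "\<And>a b. a \<in> homog \<Longrightarrow> b \<in> homog \<Longrightarrow> a * x * b = 0"
  shows "x = 0"
proof -
  define J where "J = {x. \<forall>a\<in>homog. \<forall>b\<in>homog. a * x * b = 0}"
  have J: "subspace J"
    by (simp add: J_def subspace_def distrib_left distrib_right scale_mult_left scale_mult_right)
  have "graded_ideal J"
  proof (rule graded_idealI[OF J])
    fix x a assume xa: "x \<in> J" "a \<in> homog"
    have "(b * a) * x * c = 0" "b * x * (a * c) = 0" if "b \<in> homog" "c \<in> homog" for b c
      using xa that homog_mult unfolding J_def by blast+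
    then show "a * x \<in> J" "x * a \<in> J" by (simp_all add: J_def mult.assoc)
  next
    fix x g assume x: "x \<in> J" and g: "g \<in> carrier G"
    have "a * component g x * b = 0" if ab: "a \<in> homog" "b \<in> homog" for a b
    proof -
      obtain h k where hk: "h \<in> carrier G" "a \<in> A h" "k \<in> carrier G" "b \<in> A k"
        using ab by (auto simp: homog_def)
      have "component (h \<otimes> g \<otimes> k) (a * x * b) = a * component g x * b"
        using hk g by (simp add: component_mult_left component_mult_right)
      moreover have "a * x * b = 0" using x ab by (auto simp: J_def)
      ultimately show ?thesis by simp
    qed
    then show "component g x \<in> J" by (simp add: J_def)
  qed
  then consider "J = {0}" | "J = UNIV" using graded_ideal_trivial by blast
  then show ?thesis
  proof cases
    case 1
    then show ?thesis using assms by (auto simp: J_def)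
  next
    case 2
    \<comment> \<open>The square of the algebra is a nonzero graded ideal, hence the whole
      algebra.\<close>
    define S where "S = span {x * y | x y. True}"
    have S: "subspace S" unfolding S_def by (rule subspace_span)
    have prod: "x * y \<in> S" for x y unfolding S_def by (intro span_base) blast
    have "graded_ideal S"
    proof (rule graded_idealI[OF S])
      fix x g assume x: "x \<in> S"
      from x show "component g x \<in> S"
        unfolding S_def
      proof (rule span_induct[of _ _ "\<lambda>x. component g x \<in> span {x * y | x y. True}"])
        show "subspace {x. component g x \<in> span {x * y |x y. True}}"
          using S by (auto simp: subspace_def component_add component_scale S_def)
      next
        fix z :: 'd assume "z \<in> {x * y | x y. True}"
        then obtain x y where z: "z = x * y" by blast
        have "component g (x * y) \<in> S"
        proof (rule span_mult_closed[of "{z. component g z \<in> S}" homog homog, simplified])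
          show "subspace {z. component g z \<in> S}"
            using S by (auto simp: subspace_def component_add component_scale)
          fix x y assume xy: "x \<in> homog" "y \<in> homog"
          then obtain h k where "h \<in> carrier G" "k \<in> carrier G" "x * y \<in> A (h \<otimes> k)"
            unfolding homog_def using mult_component by blast
          then show "component g (x * y) \<in> S"
            using prod[of x y] subspace_0[OF S] component_homog[of "h \<otimes> k" "x * y" g] by auto
        qed (rule in_span_homog)+
        then show "component g z \<in> span {x * y | x y. True}" by (simp add: z S_def)
      qed
    qed (auto intro: prod)
    then have SU: "S = UNIV" using graded_ideal_trivial square_nonzero S_def by auto
    \<comment> \<open>Here every triple product vanishes, which contradicts that products span the algebra.\<close>
    have triple: "x * y * z = 0" for x y z :: 'd
    proof -
      have 3: "a * y * b = 0" if "a \<in> homog" "b \<in> homog" for a b using 2 that by (auto simp: J_def)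
      have "x * y * b = 0" if b: "b \<in> homog" for b
        by (rule span_induct[OF in_span_homog[of x], of "\<lambda>x. x * y * b = 0"])
          (use 3 b in \<open>auto simp: subspace_def distrib_right scale_mult_left\<close>)
      then show ?thesis
        by (intro span_induct[OF in_span_homog[of z], of "\<lambda>z. x * y * z = 0"])
          (auto simp: subspace_def distrib_left scale_mult_right)
    qed
    have "u * z = 0" for u z :: 'd
      by (rule span_induct[of u "{x * y | x y. True}" "\<lambda>u. u * z = 0"])
        (use SU S_def triple in \<open>auto simp: subspace_def distrib_right scale_mult_left\<close>)
    then have "{x * y | x y :: 'd. True} \<subseteq> {0}" by auto
    then have "S \<subseteq> {0}" unfolding S_def by (metis span_empty span_insert_0 span_mono)
    then show ?thesis using SU by auto
  qed
qed

text \<open>The span is a graded ideal. Without a unit it does not visibly contain \<open>x\<close>;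
  it is nonzero because otherwise \<open>x\<close> would be annihilated from both sides.\<close>

lemma span_sandwiches:
  assumes x: "x \<in> homog" "x \<noteq> 0"
  shows "span {a * x * b | a b. a \<in> homog \<and> b \<in> homog} = UNIV"
proof -
  define X where "X = {a * x * b | a b. a \<in> homog \<and> b \<in> homog}"
  have XI: "a * x * b \<in> X" if "a \<in> homog" "b \<in> homog" for a b using that by (auto simp: X_def)
  have X_homog: "X \<subseteq> homog" using x homog_mult by (auto simp: X_def)
  have "graded_ideal (span X)"
  proof (rule graded_idealI[OF subspace_span])
    fix y c assume "y \<in> span X" and c: "c \<in> homog"
    from \<open>y \<in> span X\<close> have "c * y \<in> span X \<and> y * c \<in> span X"
    proof (rule span_induct)
      show "subspace {y. c * y \<in> span X \<and> y * c \<in> span X}"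
        by (simp add: subspace_def distrib_left distrib_right scale_mult_left
            scale_mult_right span_add span_scale span_zero)
    next
      fix y assume "y \<in> X"
      then obtain a b where ab: "a \<in> homog" "b \<in> homog" "y = a * x * b" unfolding X_def by blast
      have "c * y = (c * a) * x * b" "y * c = a * x * (b * c)" by (simp_all add: ab mult.assoc)
      then show "c * y \<in> span X \<and> y * c \<in> span X"
        using XI[OF homog_mult[OF c ab(1)] ab(2)] XI[OF ab(1) homog_mult[OF ab(2) c]]
        by (simp add: span_base)
    qed
    then show "c * y \<in> span X" "y * c \<in> span X" by simp_all
  next
    fix y g assume y: "y \<in> span X"
    from y show "component g y \<in> span X"
    proof (rule span_induct)
      show "subspace {y. component g y \<in> span X}"
        by (simp add: subspace_def component_add component_scale span_add span_scale span_zero)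
    next
      fix y assume y: "y \<in> X"
      then obtain k where "k \<in> carrier G" "y \<in> A k" using X_homog unfolding homog_def by blast
      then show "component g y \<in> span X" using y by (simp add: component_homog span_base span_zero)
    qed
  qed
  then consider "span X = {0}" | "span X = UNIV" using graded_ideal_trivial by blast
  then show ?thesis
  proof cases
    case 1
    then have "X \<subseteq> {0}" using span_superset by blast
    then have "x = 0" using two_sided_annihilator_trivial[of x] XI by blast
    then show ?thesis using x by simp
  qed (simp add: X_def)
qed

text \<open>If all \<open>u * z * v\<close> were 0, the sandwiches of \<open>u\<close>, which span
  the algebra, would annihilate \<open>v\<close> from the left.\<close>

lemma graded_prime:
  assumes u: "u \<in> homog" "u \<noteq> 0" and v: "v \<in> homog" "v \<noteq> 0"
  obtains z where "z \<in> homog" "u * z * v \<noteq> 0"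
proof -
  have "\<exists>z\<in>homog. u * z * v \<noteq> 0"
  proof (rule ccontr)
    assume neg: "\<not> ?thesis"
    have "y * v = 0" for y
    proof (rule span_induct[of y "{a * u * b | a b. a \<in> homog \<and> b \<in> homog}" "\<lambda>y. y * v = 0"])
      show "y \<in> span {a * u * b | a b. a \<in> homog \<and> b \<in> homog}"
        using span_sandwiches[OF u] by simp
    next
      fix y assume "y \<in> {a * u * b | a b. a \<in> homog \<and> b \<in> homog}"
      then obtain a b where "b \<in> homog" "y = a * u * b" by auto
      then have "y * v = a * (u * b * v)" by (simp add: mult.assoc)
      then show "y * v = 0" using neg \<open>b \<in> homog\<close> by simp
    qed (auto simp: subspace_def distrib_right scale_mult_left)
    then have "a * v * b = 0" for a b by simp
    then have "v = 0" by (rule two_sided_annihilator_trivial)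
    then show False using v by simp
  qed
  then show ?thesis using that by blast
qed

end

section \<open>Capelli polynomials\<close>

text \<open>The product \<open>f 0 * (f 1 * (... * (f (n - 1) * u)))\<close>. The end factor
  \<open>u\<close> gives the empty product a meaning without a unit.\<close>

fun chain :: "(nat \<Rightarrow> 'a::times) \<Rightarrow> nat \<Rightarrow> 'a \<Rightarrow> 'a" where
  "chain f 0 u = u"
| "chain f (Suc n) u = chain f n (f n * u)"

lemma chain_cong: "(\<And>i. i < n \<Longrightarrow> f i = g i) \<Longrightarrow> chain f n u = chain g n u"
  by (induction n arbitrary: u) auto

lemma chain_zero_right [simp]: "chain f n (0 :: 'a::ring) = 0"
  by (induction n) auto

lemma chain_add_right: "chain f n (u + v) = chain f n u + chain f n (v :: 'a::ring)"
  by (induction n arbitrary: u v) (auto simp: distrib_left)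

lemma chain_eq_0: "k < n \<Longrightarrow> f k = 0 \<Longrightarrow> chain f n (u :: 'a::ring) = 0"
  by (induction n arbitrary: u) (auto simp: less_Suc_eq)

lemma chain_add:
  fixes f g h :: "nat \<Rightarrow> 'a::ring"
  assumes "k < n" "h k = f k + g k" "\<And>i. i < n \<Longrightarrow> i \<noteq> k \<Longrightarrow> f i = h i \<and> g i = h i"
  shows "chain h n u = chain f n u + chain g n u"
  using assms
proof (induction n arbitrary: u)
  case (Suc n)
  show ?case
  proof (cases "k = n")
    case True
    have "chain f n v = chain h n v" "chain g n v = chain h n v" for v
      using Suc.prems True by (auto intro!: chain_cong)
    then show ?thesis using Suc.prems True by (simp add: distrib_right chain_add_right)
  next
    case False
    then have "f n = h n" "g n = h n" using Suc.prems by auto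
    then show ?thesis using Suc False by simp
  qed
qed simp

lemma (in assoc_algebra) chain_scale_right: "chain f n (c *s u) = c *s chain f n u"
  by (induction n arbitrary: u) (auto simp: scale_mult_right)

lemma (in assoc_algebra) chain_scale:
  assumes "k < n" "h k = c *s f k" "\<And>i. i < n \<Longrightarrow> i \<noteq> k \<Longrightarrow> f i = h i"
  shows "chain h n u = c *s chain f n u"
  using assms
proof (induction n arbitrary: u)
  case (Suc n)
  show ?case
  proof (cases "k = n")
    case True
    have "chain f n v = chain h n v" for v
      using Suc.prems True by (auto intro!: chain_cong)
    then show ?thesis using Suc.prems True by (simp add: scale_mult_left chain_scale_right)
  next
    case False
    then have "f n = h n" using Suc.prems by auto
    then show ?thesis using Suc False by simp
  qed
qed simp

definition degree_perms :: "(nat \<Rightarrow> 'g) \<Rightarrow> nat \<Rightarrow> (nat \<Rightarrow> nat) set" where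
  "degree_perms d n = {\<sigma>. \<sigma> permutes {..<n} \<and> (\<forall>i. d (\<sigma> i) = d i)}"

definition signed :: "(nat \<Rightarrow> nat) \<Rightarrow> 'a::ring \<Rightarrow> 'a" where
  "signed \<sigma> v = (if evenperm \<sigma> then v else - v)"

text \<open>The Capelli polynomial in \<open>x 0, \<dots>, x (n - 1)\<close>, alternated only within each degree, because
  only such permutations respect the degrees of the variables.\<close>

definition capelli ::
  "(nat \<Rightarrow> 'g) \<Rightarrow> nat \<Rightarrow> (nat \<Rightarrow> 'a::ring \<Rightarrow> 'a) \<Rightarrow> (nat \<Rightarrow> 'a) \<Rightarrow> 'a \<Rightarrow> 'a" where
  "capelli d n T x u =
     (\<Sum>\<sigma>\<in>degree_perms d n. signed \<sigma> (chain (\<lambda>i. T i (x (\<sigma> i))) n u))"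

lemma finite_degree_perms: "finite (degree_perms d n)"
  by (rule finite_subset[OF _ finite_permutations[of "{..<n}"]]) (auto simp: degree_perms_def)

lemma degree_perms_less: "\<sigma> \<in> degree_perms d n \<Longrightarrow> \<sigma> i < n \<longleftrightarrow> i < n"
  unfolding degree_perms_def using permutes_in_image[of \<sigma> "{..<n}" i] by auto

lemma degree_perms_transpose_comp:
  assumes "\<sigma> \<in> degree_perms d n" "i < n" "j < n" "d i = d j"
  shows "transpose i j \<circ> \<sigma> \<in> degree_perms d n"
proof -
  have "transpose i j permutes {..<n}" using assms by (intro permutes_swap_id) auto
  moreover have "d (transpose i j l) = d l" for l using assms by (simp add: transpose_def)
  ultimately show ?thesis using assms by (simp add: degree_perms_def permutes_compose)
qed

lemma signed_add: "signed \<sigma> (a + b) = signed \<sigma> a + signed \<sigma> b"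
  and signed_zero [simp]: "signed \<sigma> 0 = 0"
  by (auto simp: signed_def)

lemma capelli_cong:
  "(\<And>i. i < n \<Longrightarrow> x i = x' i) \<Longrightarrow> capelli d n T x u = capelli d n T x' u"
proof -
  assume x: "\<And>i. i < n \<Longrightarrow> x i = x' i"
  have "chain (\<lambda>i. T i (x (\<sigma> i))) n u = chain (\<lambda>i. T i (x' (\<sigma> i))) n u"
    if "\<sigma> \<in> degree_perms d n" for \<sigma>
    by (rule chain_cong) (simp add: x degree_perms_less[OF that])
  then show ?thesis by (simp add: capelli_def)
qed

lemma capelli_add_operator:
  assumes "k < n"
  shows "capelli d n (T(k := \<lambda>x. R x + S x)) x u =
    capelli d n (T(k := R)) x u + capelli d n (T(k := S)) x u"
proof -
  have "chain (\<lambda>i. (T(k := \<lambda>x. R x + S x)) i (x (\<sigma> i))) n u =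
      chain (\<lambda>i. (T(k := R)) i (x (\<sigma> i))) n u + chain (\<lambda>i. (T(k := S)) i (x (\<sigma> i))) n u" for \<sigma>
    by (rule chain_add[OF assms]) simp_all
  then show ?thesis by (simp add: capelli_def signed_add sum.distrib)
qed

text \<open>Composition with the transposition of \<open>i\<close> and \<open>j\<close> keeps the
  chain and changes the parity, so the even and the odd part cancel. Matching the two parts, rather
  than showing that the value equals its negative, also covers characteristic 2.\<close>

lemma capelli_alternating:
  fixes T :: "nat \<Rightarrow> 'a::ring \<Rightarrow> 'a"
  assumes ij: "i < n" "j < n" "i \<noteq> j" "d i = d j" and x: "x i = x j"
  shows "capelli d n T x u = 0"
proof -
  let ?P = "degree_perms d n" and ?t = "transpose i j"
  let ?v = "\<lambda>\<sigma>. chain (\<lambda>i. T i (x (\<sigma> i))) n u"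
  have perm: "permutation \<sigma>" if "\<sigma> \<in> ?P" for \<sigma>
    using that by (auto simp: degree_perms_def permutation_permutes)
  have even_t: "evenperm (?t \<circ> \<sigma>) \<longleftrightarrow> \<not> evenperm \<sigma>" if "\<sigma> \<in> ?P" for \<sigma>
    using perm[OF that] ij by (simp add: evenperm_comp permutation_swap_id evenperm_swap)
  have "x (?t l) = x l" for l using x by (auto simp: transpose_def)
  then have v_t: "?v (?t \<circ> \<sigma>) = ?v \<sigma>" for \<sigma> by simp
  have "capelli d n T x u = (\<Sum>\<sigma>\<in>?P. if evenperm \<sigma> then ?v \<sigma> else - ?v \<sigma>)"
    by (simp add: capelli_def signed_def)
  also have "\<dots> = (\<Sum>\<sigma>\<in>{\<sigma>\<in>?P. evenperm \<sigma>}. ?v \<sigma>) - (\<Sum>\<sigma>\<in>{\<sigma>\<in>?P. \<not> evenperm \<sigma>}. ?v \<sigma>)"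
    by (simp add: sum.If_cases finite_degree_perms Int_def Collect_neg_eq[symmetric] sum_negf)
  also have "(\<Sum>\<sigma>\<in>{\<sigma>\<in>?P. \<not> evenperm \<sigma>}. ?v \<sigma>) = (\<Sum>\<sigma>\<in>{\<sigma>\<in>?P. evenperm \<sigma>}. ?v \<sigma>)"
  proof (rule sum.reindex_bij_witness[of _ "\<lambda>\<sigma>. ?t \<circ> \<sigma>" "\<lambda>\<sigma>. ?t \<circ> \<sigma>"])
    fix \<sigma> :: "nat \<Rightarrow> nat"
    show "?t \<circ> (?t \<circ> \<sigma>) = \<sigma>" "?t \<circ> (?t \<circ> \<sigma>) = \<sigma>" by (simp_all flip: comp_assoc)
    show "?t \<circ> \<sigma> \<in> {\<sigma>\<in>?P. evenperm \<sigma>}" if "\<sigma> \<in> {\<sigma>\<in>?P. \<not> evenperm \<sigma>}"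
      using that even_t degree_perms_transpose_comp[of \<sigma> d n i j] ij by simp
    show "?t \<circ> \<sigma> \<in> {\<sigma>\<in>?P. \<not> evenperm \<sigma>}" if "\<sigma> \<in> {\<sigma>\<in>?P. evenperm \<sigma>}"
      using that even_t degree_perms_transpose_comp[of \<sigma> d n i j] ij by simp
    show "?v (?t \<circ> \<sigma>) = ?v \<sigma>" by (rule v_t)
  qed
  finally show ?thesis by simp
qed

text \<open>A permutation other than the identity moves some position to another one of the same
  degree, where its chain has a factor 0.\<close>

lemma capelli_diagonal:
  assumes "\<And>i j. i < n \<Longrightarrow> j < n \<Longrightarrow> i \<noteq> j \<Longrightarrow> d j = d i \<Longrightarrow> T i (x j) = 0"
  shows "capelli d n T x u = chain (\<lambda>i. T i (x i)) n u"
proof -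
  have id: "id \<in> degree_perms d n" by (simp add: degree_perms_def permutes_id)
  have "chain (\<lambda>i. T i (x (\<sigma> i))) n u = 0" if \<sigma>: "\<sigma> \<in> degree_perms d n - {id}" for \<sigma>
  proof -
    obtain k where k: "\<sigma> k \<noteq> k" using \<sigma> by (auto simp: fun_eq_iff)
    have "k < n" using \<sigma> k by (auto simp: degree_perms_def permutes_def)
    then show ?thesis
      using \<sigma> k assms[of k "\<sigma> k"] degree_perms_less[of \<sigma> d n k]
      by (intro chain_eq_0[of k]) (auto simp: degree_perms_def)
  qed
  then have "capelli d n T x u = (\<Sum>\<sigma>\<in>{id}. signed \<sigma> (chain (\<lambda>i. T i (x (\<sigma> i))) n u))"
    unfolding capelli_def using id finite_degree_perms
    by (intro sum.mono_neutral_right) auto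
  then show ?thesis by (simp add: signed_def evenperm_id)
qed

section \<open>Multilinearity of the Capelli polynomial\<close>

context assoc_algebra
begin

definition linear_operator :: "('a \<Rightarrow> 'a) \<Rightarrow> bool" where
  "linear_operator T \<longleftrightarrow> (\<forall>x y. T (x + y) = T x + T y) \<and> (\<forall>c x. T (c *s x) = c *s T x)"

lemma linear_operator_sandwich: "linear_operator (\<lambda>x. a * x * b)"
  by (simp add: linear_operator_def distrib_left distrib_right scale_mult_left scale_mult_right)

lemma signed_scale: "signed \<sigma> (c *s v) = c *s signed \<sigma> v"
  by (simp add: signed_def)

text \<open>In each chain the entry \<open>x k\<close> occurs at exactly one position, the preimage
  of \<open>k\<close> under \<open>\<sigma>\<close>.\<close>

lemma capelli_add:
  assumes "k < n" and T: "\<And>i. i < n \<Longrightarrow> linear_operator (T i)"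
  shows "capelli d n T (x(k := v + w)) u = capelli d n T (x(k := v)) u + capelli d n T (x(k := w)) u"
  unfolding capelli_def sum.distrib[symmetric] signed_add[symmetric]
proof (rule sum.cong[OF refl], rule arg_cong[of _ _ "signed _"])
  fix \<sigma> assume \<sigma>: "\<sigma> \<in> degree_perms d n"
  then have p: "\<sigma> permutes {..<n}" by (simp add: degree_perms_def)
  have inv: "\<sigma> (inv_into UNIV \<sigma> k) = k" "inv_into UNIV \<sigma> k < n"
    using permutes_inverses[OF p] degree_perms_less[OF \<sigma>, of "inv_into UNIV \<sigma> k"] assms by auto
  have other: "\<sigma> i \<noteq> k" if "i \<noteq> inv_into UNIV \<sigma> k" for i
    using that permutes_inverses[OF p] by metis
  show "chain (\<lambda>i. T i ((x(k := v + w)) (\<sigma> i))) n u =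
      chain (\<lambda>i. T i ((x(k := v)) (\<sigma> i))) n u + chain (\<lambda>i. T i ((x(k := w)) (\<sigma> i))) n u"
    by (rule chain_add[OF inv(2)]) (use inv other T in \<open>auto simp: linear_operator_def\<close>)
qed

lemma capelli_scale:
  assumes "k < n" and T: "\<And>i. i < n \<Longrightarrow> linear_operator (T i)"
  shows "capelli d n T (x(k := c *s v)) u = c *s capelli d n T (x(k := v)) u"
  unfolding capelli_def scale_sum_right signed_scale[symmetric]
proof (rule sum.cong[OF refl], rule arg_cong[of _ _ "signed _"])
  fix \<sigma> assume \<sigma>: "\<sigma> \<in> degree_perms d n"
  then have p: "\<sigma> permutes {..<n}" by (simp add: degree_perms_def)
  have inv: "\<sigma> (inv_into UNIV \<sigma> k) = k" "inv_into UNIV \<sigma> k < n"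
    using permutes_inverses[OF p] degree_perms_less[OF \<sigma>, of "inv_into UNIV \<sigma> k"] assms by auto
  have other: "\<sigma> i \<noteq> k" if "i \<noteq> inv_into UNIV \<sigma> k" for i
    using that permutes_inverses[OF p] by metis
  show "chain (\<lambda>i. T i ((x(k := c *s v)) (\<sigma> i))) n u = c *s chain (\<lambda>i. T i ((x(k := v)) (\<sigma> i))) n u"
    by (rule chain_scale[OF inv(2)]) (use inv other T in \<open>auto simp: linear_operator_def\<close>)
qed

lemma capelli_sum:
  assumes "k < n" and T: "\<And>i. i < n \<Longrightarrow> linear_operator (T i)"
  shows "capelli d n T (x(k := (\<Sum>l\<in>I. c l *s v l))) u = (\<Sum>l\<in>I. c l *s capelli d n T (x(k := v l)) u)"
proof (induction I rule: infinite_finite_induct)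
  case empty
  have "capelli d n T (x(k := 0 *s 0)) u = 0 *s capelli d n T (x(k := 0)) u"
    by (rule capelli_scale[OF assms])
  then show ?case by (simp only: sum.empty scale_zero_left)
next
  case (infinite I)
  have "capelli d n T (x(k := 0 *s 0)) u = 0 *s capelli d n T (x(k := 0)) u"
    by (rule capelli_scale[OF assms])
  then show ?case using infinite by (simp only: sum.infinite scale_zero_left not_False_eq_True)
next
  case (insert l I)
  show ?case
    by (simp only: sum.insert[OF insert.hyps] capelli_add[OF assms] capelli_scale[OF assms] insert.IH)
qed

text \<open>By multilinearity and alternation, \<open>capelli\<close> is multiplied by the coordinate \<open>c k\<close> of the new
  entry, as in Cramer's rule.\<close>

lemma capelli_replace:
  assumes "k < n" and T: "\<And>i. i < n \<Longrightarrow> linear_operator (T i)"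
    and c: "\<And>l. l < n \<Longrightarrow> d l \<noteq> d k \<Longrightarrow> c l = 0"
  shows "capelli d n T (x(k := (\<Sum>l<n. c l *s x l))) u = c k *s capelli d n T x u"
proof -
  have "capelli d n T (x(k := x l)) u = 0" if "l < n" "l \<noteq> k" "d l = d k" for l
    by (rule capelli_alternating[of k n l]) (use that assms in auto)
  then have zero: "c l *s capelli d n T (x(k := x l)) u = 0" if "l \<in> {..<n} - {k}" for l
    using that c by fastforce
  have "capelli d n T (x(k := (\<Sum>l<n. c l *s x l))) u = (\<Sum>l<n. c l *s capelli d n T (x(k := x l)) u)"
    by (rule capelli_sum[OF assms(1,2)])
  also have "\<dots> = (\<Sum>l\<in>{k}. c l *s capelli d n T (x(k := x l)) u)"
    by (rule sum.mono_neutral_right) (use zero assms in auto)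
  finally show ?thesis by simp
qed

end

context graded_algebra
begin

lemma component_family:
  assumes "\<And>i. i < n \<Longrightarrow> d i \<in> carrier G \<and> x i \<in> A (d i)"
  shows "component g (\<Sum>i<n. c i *s x i) = (\<Sum>i<n. (if d i = g then c i else 0) *s x i)"
  unfolding component_sum_distrib component_scale
proof (rule sum.cong[OF refl])
  fix i assume "i \<in> {..<n}"
  then have "component g (x i) = (if g = d i then x i else 0)"
    using assms by (intro component_homog) auto
  then show "c i *s component g (x i) = (if d i = g then c i else 0) *s x i" by auto
qed

lemma family_coeff_degree:
  assumes x: "\<And>i. i < n \<Longrightarrow> d i \<in> carrier G \<and> x i \<in> A (d i)" and indep: "indep_family scale n x"
    and y: "(\<Sum>i<n. c i *s x i) \<in> A g" "g \<in> carrier G" and l: "l < n" "d l \<noteq> g"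
  shows "c l = 0"
proof -
  have "component (d l) (\<Sum>i<n. c i *s x i) = 0" using component_homog[OF y(2,1)] l by simp
  then have "(\<Sum>i<n. (if d i = d l then c i else 0) *s x i) = 0"
    using component_family[of n d x "d l" c] x by simp
  from indep_familyD[OF indep this l(1)] show ?thesis by simp
qed

text \<open>As for determinants: replacing \<open>x k\<close> by a combination equal to 0 makes the
  value 0, and it also multiplies the value by the coefficient of \<open>x k\<close>.\<close>

lemma capelli_nonzero_imp_indep:
  assumes x: "\<And>i. i < n \<Longrightarrow> d i \<in> carrier G \<and> x i \<in> A (d i)"
    and T: "\<And>i. i < n \<Longrightarrow> linear_operator (T i)"
    and nz: "capelli d n T x u \<noteq> 0"
  shows "indep_family scale n x"
  unfolding indep_family_def
proof (intro allI impI, rule ccontr)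
  fix c k assume c: "(\<Sum>i<n. c i *s x i) = 0" and k: "k < n" "c k \<noteq> 0"
  \<comment> \<open>The relation is cut down to degree \<open>d k\<close>, because
    \<open>capelli_replace\<close> admits no coefficients in other degrees.\<close>
  define b where "b i = (if d i = d k then c i else 0)" for i
  have zero: "capelli d n T (x(k := 0 *s 0)) u = 0 *s capelli d n T (x(k := 0)) u"
    by (rule capelli_scale[OF k(1) T])
  have "(\<Sum>i<n. b i *s x i) = 0"
    using component_family[of n d x "d k" c] x c by (simp add: b_def)
  then have "0 = capelli d n T (x(k := (\<Sum>l<n. b l *s x l))) u"
    using zero by (simp only: scale_zero_left)
  also have "\<dots> = b k *s capelli d n T x u"
    by (rule capelli_replace[OF k(1) T]) (auto simp: b_def)
  finally show False using nz k by (simp add: b_def)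
qed

end

text \<open>Closure under sums only: a scalar can be absorbed into a factor of a sandwich.\<close>

inductive_set add_closure :: "('a \<Rightarrow> 'b::plus) set \<Rightarrow> ('a \<Rightarrow> 'b) set" for X :: "('a \<Rightarrow> 'b) set" where
  base: "T \<in> X \<Longrightarrow> T \<in> add_closure X"
| add: "T \<in> add_closure X \<Longrightarrow> S \<in> add_closure X \<Longrightarrow> (\<lambda>x. T x + S x) \<in> add_closure X"

text \<open>The value is additive in each operator, so when a sum is expanded some summand still
  gives a nonzero value; the operators are treated one after another.\<close>

lemma capelli_generating_operators:
  assumes "\<And>i. i < n \<Longrightarrow> T i \<in> add_closure X" "capelli d n T x u \<noteq> 0"
  obtains T' where "\<And>i. i < n \<Longrightarrow> T' i \<in> X" "capelli d n T' x u \<noteq> 0"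
proof -
  have "\<exists>T'. (\<forall>i<k. T' i \<in> X) \<and> (\<forall>i. k \<le> i \<longrightarrow> T' i = T i) \<and> capelli d n T' x u \<noteq> 0" if "k \<le> n" for k
    using that
  proof (induction k)
    case 0
    show ?case using assms(2) by auto
  next
    case (Suc k)
    then obtain T' where T': "\<forall>i<k. T' i \<in> X" "\<forall>i. k \<le> i \<longrightarrow> T' i = T i" "capelli d n T' x u \<noteq> 0"
      by auto
    have kn: "k < n" using Suc by simp
    have "\<exists>R\<in>X. capelli d n (T'(k := R)) x u \<noteq> 0"
      if "S \<in> add_closure X" "capelli d n (T'(k := S)) x u \<noteq> 0" for S
      using that
    proof induction
      case (add R S)
      then have "capelli d n (T'(k := R)) x u \<noteq> 0 \<or> capelli d n (T'(k := S)) x u \<noteq> 0"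
        unfolding capelli_add_operator[OF kn] by (metis add.right_neutral)
      then show ?case using add.IH by blast
    qed auto
    from this[OF assms(1)[OF kn]] obtain R where R: "R \<in> X" "capelli d n (T'(k := R)) x u \<noteq> 0"
      using T' by (metis fun_upd_triv order_refl)
    show ?case
    proof (intro exI conjI)
      show "\<forall>i<Suc k. (T'(k := R)) i \<in> X" using R T' by (auto simp: less_Suc_eq)
      show "\<forall>i. Suc k \<le> i \<longrightarrow> (T'(k := R)) i = T i" using T' by auto
    qed (rule R(2))
  qed
  from this[of n] show ?thesis using that by auto
qed

lemma (in finite_dimensional_vector_space) indep_family_notin_span:
  assumes v: "indep_family scale n v" and i: "i < n" and J: "J \<subseteq> {..<n} - {i}"
  shows "v i \<notin> span (v ` J)"
proof
  assume "v i \<in> span (v ` J)"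
  moreover have fin: "finite J" using J finite_subset by blast
  ultimately have "\<exists>c. v i = (\<Sum>j\<in>J. c j *s v j)"
  proof (induction rule: span_induct_alt)
    case base
    show ?case by (rule exI[of _ "\<lambda>_. 0"]) simp
  next
    case (step a x y)
    then obtain j c where "j \<in> J" "x = v j" "y = (\<Sum>j\<in>J. c j *s v j)" by auto
    then have "a *s x + y = (\<Sum>l\<in>J. (c l + (if l = j then a else 0)) *s v l)"
      using fin by (simp add: scale_left_distrib sum.distrib if_distrib[of "\<lambda>c. c *s _"] cong: if_cong)
    then show ?case by (rule exI[of _ "\<lambda>l. c l + (if l = j then a else 0)"])
  qed
  then obtain c where c: "v i = (\<Sum>j\<in>J. c j *s v j)" by blast
  define b where "b l = (if l = i then - 1 else if l \<in> J then c l else 0)" for l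
  have "(\<Sum>l<n. b l *s v l) = b i *s v i + (\<Sum>l\<in>{..<n} - {i}. b l *s v l)"
    using i by (intro sum.remove) auto
  also have "(\<Sum>l\<in>{..<n} - {i}. b l *s v l) = (\<Sum>l\<in>J. c l *s v l)"
    using J by (intro sum.mono_neutral_cong_right) (auto simp: b_def)
  finally have "(\<Sum>l<n. b l *s v l) = 0" using c by (simp add: b_def)
  from indep_familyD[OF v this i] show False by (simp add: b_def)
qed

section \<open>Density within one degree and nonvanishing of Capelli polynomials\<close>

locale fd_simple = simple_graded_algebra G scale A + finite_dimensional_vector_space scale Basis
  for G :: "('g, 'm) monoid_scheme" (structure)
    and scale :: "'f::alg_closed_field \<Rightarrow> 'a::ring \<Rightarrow> 'a" (infixr \<open>*s\<close> 75)
    and A :: "'g \<Rightarrow> 'a set" and Basis :: "'a set"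
begin

definition sandwiches :: "('a \<Rightarrow> 'a) set" where
  "sandwiches = {\<lambda>x. a * x * b | a b. a \<in> homog \<and> b \<in> homog}"

text \<open>Two-sided multiplications that leave \<open>A g\<close> invariant, as density on
  \<open>A g\<close> requires. In a noncommutative group the condition on \<open>h\<close> and
  \<open>k\<close> depends on \<open>g\<close>.\<close>

definition degree_sandwiches :: "'g \<Rightarrow> ('a \<Rightarrow> 'a) set" where
  "degree_sandwiches g = {\<lambda>x. a * x * b | a b.
     \<exists>h\<in>carrier G. \<exists>k\<in>carrier G. a \<in> A h \<and> b \<in> A k \<and> h \<otimes> g \<otimes> k = g}"

lemma degree_sandwichesI:
  "a \<in> A h \<Longrightarrow> b \<in> A k \<Longrightarrow> h \<in> carrier G \<Longrightarrow> k \<in> carrier G \<Longrightarrow> h \<otimes> g \<otimes> k = g \<Longrightarrow>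
     (\<lambda>x. a * x * b) \<in> degree_sandwiches g"
  unfolding degree_sandwiches_def by blast

lemma degree_sandwichesE:
  assumes "T \<in> degree_sandwiches g"
  obtains a b h k where "T = (\<lambda>x. a * x * b)" "a \<in> A h" "b \<in> A k" "h \<in> carrier G" "k \<in> carrier G"
    "h \<otimes> g \<otimes> k = g"
  using assms unfolding degree_sandwiches_def by blast

lemma linear_operator_add_closure:
  "T \<in> add_closure (degree_sandwiches g) \<Longrightarrow> linear_operator T"
proof (induction rule: add_closure.induct)
  case (base T)
  then show ?case using linear_operator_sandwich by (auto elim: degree_sandwichesE)
qed (auto simp: linear_operator_def algebra_simps scale_right_distrib)

lemma degree_op_degree:
  "T \<in> add_closure (degree_sandwiches g) \<Longrightarrow> g \<in> carrier G \<Longrightarrow> x \<in> A g \<Longrightarrow> T x \<in> A g"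
proof (induction rule: add_closure.induct)
  case (base T)
  from base(1) obtain a b h k where T: "T = (\<lambda>x. a * x * b)" "a \<in> A h" "b \<in> A k"
    "h \<in> carrier G" "k \<in> carrier G" "h \<otimes> g \<otimes> k = g" by (rule degree_sandwichesE)
  then have "a * x * b \<in> A (h \<otimes> g \<otimes> k)" using base by (intro mult_component) auto
  then show ?case using T by simp
qed (simp add: subspace_add[OF subspace_A])

lemma degree_op_scale:
  "T \<in> add_closure (degree_sandwiches g) \<Longrightarrow> (\<lambda>x. c *s T x) \<in> add_closure (degree_sandwiches g)"
proof (induction rule: add_closure.induct)
  case (base T)
  from base(1) obtain a b h k where T: "T = (\<lambda>x. a * x * b)" "a \<in> A h" "b \<in> A k"
    "h \<in> carrier G" "k \<in> carrier G" "h \<otimes> g \<otimes> k = g" by (rule degree_sandwichesE)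
  have "(\<lambda>x. (c *s a) * x * b) \<in> degree_sandwiches g"
    using T by (intro degree_sandwichesI[of _ h _ k] subspace_scale[OF subspace_A]) auto
  then show ?case using T by (auto simp: scale_mult_left intro: add_closure.base)
next
  case (add T S)
  then show ?case using add_closure.add[OF add.IH] by (simp add: scale_right_distrib)
qed

lemma degree_op_comp:
  assumes "T \<in> add_closure (degree_sandwiches g)" "S \<in> add_closure (degree_sandwiches g)"
    and g: "g \<in> carrier G"
  shows "(\<lambda>x. T (S x)) \<in> add_closure (degree_sandwiches g)"
  using assms(1,2)
proof (induction arbitrary: S rule: add_closure.induct)
  case (base T)
  from base(1) obtain a b h k where T: "T = (\<lambda>x. a * x * b)" "a \<in> A h" "b \<in> A k"
    "h \<in> carrier G" "k \<in> carrier G" "h \<otimes> g \<otimes> k = g" by (rule degree_sandwichesE)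
  from base(2) show ?case
  proof (induction rule: add_closure.induct)
    case (base S)
    then obtain a' b' h' k' where S: "S = (\<lambda>x. a' * x * b')" "a' \<in> A h'" "b' \<in> A k'"
      "h' \<in> carrier G" "k' \<in> carrier G" "h' \<otimes> g \<otimes> k' = g" by (rule degree_sandwichesE)
    have "(h \<otimes> h') \<otimes> g \<otimes> (k' \<otimes> k) = h \<otimes> (h' \<otimes> g \<otimes> k') \<otimes> k"
      using S(4,5) T(4,5) g by (simp add: m_assoc)
    also have "\<dots> = h \<otimes> g \<otimes> k" by (simp only: S(6))
    also have "\<dots> = g" by (rule T(6))
    finally have deg: "(h \<otimes> h') \<otimes> g \<otimes> (k' \<otimes> k) = g" .
    have "(\<lambda>x. (a * a') * x * (b' * b)) \<in> degree_sandwiches g"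
      by (rule degree_sandwichesI[OF _ _ _ _ deg]) (use S T in \<open>auto intro: mult_component\<close>)
    then show ?case using S T by (auto simp: mult.assoc intro: add_closure.base)
  next
    case (add R S)
    then show ?case using add_closure.add[OF add.IH] T by (simp add: distrib_left distrib_right)
  qed
next
  case (add T R)
  then show ?case using add_closure.add by blast
qed

text \<open>\<open>y\<close> is a linear combination of sandwiches of \<open>x\<close>; taking the
  component of degree \<open>g\<close> discards exactly the sandwiches that leave this
  degree.\<close>

lemma degree_op_transitive:
  assumes g: "g \<in> carrier G" and x: "x \<in> A g" "x \<noteq> 0" and y: "y \<in> A g"
  shows "\<exists>T\<in>add_closure (degree_sandwiches g). T x = y"
proof -
  let ?E = "add_closure (degree_sandwiches g)"
  have "0 \<in> A \<one>" using subspace_0[OF subspace_A] by simp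
  then have "(\<lambda>x. 0 * x * 0) \<in> degree_sandwiches g"
    using g by (intro degree_sandwichesI[of _ \<one> _ \<one>]) auto
  then have zero: "(\<lambda>x. 0) \<in> ?E" by (auto intro: add_closure.base)
  have xh: "x \<in> homog" using g x by (auto simp: homog_def)
  have "\<exists>T\<in>?E. T x = component g z" if z: "z \<in> span {a * x * b | a b. a \<in> homog \<and> b \<in> homog}" for z
    using z
  proof (rule span_induct)
    show "subspace {z. \<exists>T\<in>?E. T x = component g z}"
    proof (rule subspaceI)
      show "0 \<in> {z. \<exists>T\<in>?E. T x = component g z}" using zero by (auto intro!: bexI[of _ "\<lambda>_. 0"])
    next
      fix v w assume "v \<in> {z. \<exists>T\<in>?E. T x = component g z}" "w \<in> {z. \<exists>T\<in>?E. T x = component g z}"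
      then obtain T S where "T \<in> ?E" "T x = component g v" "S \<in> ?E" "S x = component g w" by auto
      then show "v + w \<in> {z. \<exists>T\<in>?E. T x = component g z}"
        using add_closure.add[of T _ S] by (auto simp: component_add intro!: bexI[of _ "\<lambda>x. T x + S x"])
    next
      fix c v assume "v \<in> {z. \<exists>T\<in>?E. T x = component g z}"
      then obtain T where "T \<in> ?E" "T x = component g v" by auto
      then show "c *s v \<in> {z. \<exists>T\<in>?E. T x = component g z}"
        using degree_op_scale[of T g c] by (auto simp: component_scale intro!: bexI[of _ "\<lambda>x. c *s T x"])
    qed
  next
    fix z assume "z \<in> {a * x * b | a b. a \<in> homog \<and> b \<in> homog}"
    then obtain a b h k where ab: "z = a * x * b" "h \<in> carrier G" "k \<in> carrier G" "a \<in> A h" "b \<in> A k"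
      by (auto simp: homog_def)
    have "a * x * b \<in> A (h \<otimes> g \<otimes> k)" using ab x g by (intro mult_component) auto
    then have comp: "component g z = (if g = h \<otimes> g \<otimes> k then z else 0)"
      using ab g component_homog[of "h \<otimes> g \<otimes> k" z g] by auto
    show "\<exists>T\<in>?E. T x = component g z"
    proof (cases "g = h \<otimes> g \<otimes> k")
      case True
      then have "(\<lambda>x. a * x * b) \<in> degree_sandwiches g"
        using ab by (intro degree_sandwichesI[of _ h _ k]) auto
      then show ?thesis
        using ab True comp by (intro bexI[of _ "\<lambda>x. a * x * b"] add_closure.base) auto
    next
      case False
      then show ?thesis using comp zero by (intro bexI[of _ "\<lambda>_. 0"]) auto
    qed
  qed
  from this[of y] show ?thesis
    using span_sandwiches[OF xh x(2)] component_homog[OF g y, of g] by simp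
qed

lemma separating_operator:
  assumes g: "g \<in> carrier G" and S: "finite S" "S \<subseteq> A g" and x: "x \<in> A g" "x \<notin> span S"
  shows "\<exists>T\<in>add_closure (degree_sandwiches g). (\<forall>w\<in>S. T w = 0) \<and> T x \<noteq> 0"
proof (rule density[OF alg_closed_imp_poly_has_root subspace_A[OF g] _ _ _ _ _ _ _ S x])
  let ?E = "add_closure (degree_sandwiches g)"
  show "T (a + b) = T a + T b" "T (c *s a) = c *s T a" if "T \<in> ?E" for T a b c
    using linear_operator_add_closure[OF that] by (simp_all add: linear_operator_def)
  show "T x \<in> A g" if "T \<in> ?E" "x \<in> A g" for T x using degree_op_degree[OF that(1) g that(2)] .
  show "(\<lambda>x. T x + S x) \<in> ?E" if "T \<in> ?E" "S \<in> ?E" for T S using add_closure.add[OF that] .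
  show "(\<lambda>x. c *s T x) \<in> ?E" if "T \<in> ?E" for c T using degree_op_scale[OF that] .
  show "(\<lambda>x. T (S x)) \<in> ?E" if "T \<in> ?E" "S \<in> ?E" for T S using degree_op_comp[OF that g] .
  show "\<exists>T\<in>?E. T x = y" if "x \<in> A g" "x \<noteq> 0" "y \<in> A g" for x y
    using degree_op_transitive[OF g that] .
qed

text \<open>Graded primeness supplies one connecting factor at a time, starting at the right end;
  each partial product is homogeneous, which permits its next use.\<close>

lemma nonzero_chain:
  assumes "\<And>i. i < n \<Longrightarrow> m i \<in> homog \<and> m i \<noteq> 0" "u \<in> homog" "u \<noteq> 0"
  shows "\<exists>z. (\<forall>i<n. z i \<in> homog) \<and> chain (\<lambda>i. m i * z i) n u \<noteq> 0"
  using assms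
proof (induction n arbitrary: u)
  case (Suc n)
  obtain z0 where z0: "z0 \<in> homog" "m n * z0 * u \<noteq> 0"
    using graded_prime[of "m n" u] Suc.prems by auto
  have "m n * z0 * u \<in> homog" using Suc.prems z0 by (intro homog_mult) auto
  then obtain z where z: "\<forall>i<n. z i \<in> homog" "chain (\<lambda>i. m i * z i) n (m n * z0 * u) \<noteq> 0"
    using Suc.IH[of "m n * z0 * u"] Suc.prems z0 by auto
  have "chain (\<lambda>i. m i * (z(n := z0)) i) n v = chain (\<lambda>i. m i * z i) n v" for v
    by (rule chain_cong) auto
  then show ?case using z z0 by (intro exI[of _ "z(n := z0)"]) (auto simp: less_Suc_eq)
qed auto

lemma exists_nonzero_homog: "\<exists>u\<in>homog. u \<noteq> 0"
proof (rule ccontr)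
  assume "\<not> ?thesis"
  then have "homog \<subseteq> {0}" by auto
  then have "span homog \<subseteq> span {0}" by (rule span_mono)
  then have "x = 0" for x :: 'a using in_span_homog[of x] by auto
  then have "span {x * y | x y :: 'a. True} = {0}" using span_zero by blast
  then show False using square_nonzero by simp
qed

text \<open>By density some \<open>M i\<close> isolates \<open>x i\<close> among the entries of its
  degree. Connecting factors make the product of the values \<open>M i (x i)\<close> nonzero, and
  all permutations but the identity drop out. Expansion into single sandwiches then gives factors
  \<open>y i\<close>, \<open>w i\<close> that can be substituted for variables.\<close>

lemma capelli_nonzero:
  assumes x: "\<And>i. i < n \<Longrightarrow> d i \<in> carrier G \<and> x i \<in> A (d i)" and indep: "indep_family scale n x"
  obtains y w u where "\<And>i. i < n \<Longrightarrow> y i \<in> homog" "\<And>i. i < n \<Longrightarrow> w i \<in> homog" "u \<in> homog"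
    "capelli d n (\<lambda>i x. y i * x * w i) x u \<noteq> 0"
proof -
  have "\<forall>i\<in>{..<n}. \<exists>M. M \<in> add_closure (degree_sandwiches (d i)) \<and>
      (\<forall>j<n. j \<noteq> i \<longrightarrow> d j = d i \<longrightarrow> M (x j) = 0) \<and> M (x i) \<noteq> 0"
  proof
    fix i assume "i \<in> {..<n}"
    then have i: "i < n" by simp
    let ?J = "{j. j < n \<and> j \<noteq> i \<and> d j = d i}"
    have "x i \<notin> span (x ` ?J)" by (rule indep_family_notin_span[OF indep i]) auto
    moreover have "x ` ?J \<subseteq> A (d i)" using x by force
    ultimately have "\<exists>T\<in>add_closure (degree_sandwiches (d i)). (\<forall>w\<in>x ` ?J. T w = 0) \<and> T (x i) \<noteq> 0"
      using separating_operator[of "d i" "x ` ?J" "x i"] x[OF i] by simp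
    then show "\<exists>M. M \<in> add_closure (degree_sandwiches (d i)) \<and>
      (\<forall>j<n. j \<noteq> i \<longrightarrow> d j = d i \<longrightarrow> M (x j) = 0) \<and> M (x i) \<noteq> 0" by auto
  qed
  from bchoice[OF this] obtain M where M: "\<And>i. i < n \<Longrightarrow> M i \<in> add_closure (degree_sandwiches (d i))"
    "\<And>i j. i < n \<Longrightarrow> j < n \<Longrightarrow> j \<noteq> i \<Longrightarrow> d j = d i \<Longrightarrow> M i (x j) = 0"
    "\<And>i. i < n \<Longrightarrow> M i (x i) \<noteq> 0"
    unfolding lessThan_iff by blast
  have "M i (x i) \<in> homog \<and> M i (x i) \<noteq> 0" if "i < n" for i
    using degree_op_degree[OF M(1)[OF that]] x[OF that] M(3)[OF that] by (auto simp: homog_def)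
  moreover obtain u where u: "u \<in> homog" "u \<noteq> 0" using exists_nonzero_homog by blast
  ultimately obtain z where z: "\<forall>i<n. z i \<in> homog" "chain (\<lambda>i. M i (x i) * z i) n u \<noteq> 0"
    using nonzero_chain[of n "\<lambda>i. M i (x i)" u] by auto
  define T where "T i v = M i v * z i" for i v
  have "capelli d n T x u = chain (\<lambda>i. T i (x i)) n u"
    by (rule capelli_diagonal) (auto simp: T_def M(2))
  then have nz: "capelli d n T x u \<noteq> 0" using z by (simp add: T_def)
  \<comment> \<open>The connecting factor \<open>z i\<close> is absorbed on the right. This may
    shift the degree, so the target is \<open>sandwiches\<close> without a degree condition.\<close>
  have "T i \<in> add_closure sandwiches" if i: "i < n" for i
  proof -
    have "(\<lambda>v. N v * z i) \<in> add_closure sandwiches" if "N \<in> add_closure (degree_sandwiches g)" for N g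
      using that
    proof (induction rule: add_closure.induct)
      case (base N)
      then obtain a b h k where N: "N = (\<lambda>x. a * x * b)" "a \<in> A h" "b \<in> A k"
        "h \<in> carrier G" "k \<in> carrier G" "h \<otimes> g \<otimes> k = g" by (rule degree_sandwichesE)
      then have "a \<in> homog" "b * z i \<in> homog" using z i by (auto simp: homog_def[symmetric] intro!: homog_mult)
          (auto simp: homog_def)
      then have "(\<lambda>x. a * x * (b * z i)) \<in> sandwiches" by (auto simp: sandwiches_def)
      then show ?case using N by (auto simp: mult.assoc intro: add_closure.base)
    next
      case (add N N')
      then show ?case using add_closure.add[OF add.IH] by (simp add: distrib_right)
    qed
    from this[OF M(1)[OF i]] show ?thesis unfolding T_def .
  qed
  from capelli_generating_operators[OF this nz] obtain T' where
    T': "\<And>i. i < n \<Longrightarrow> T' i \<in> sandwiches" "capelli d n T' x u \<noteq> 0" by blast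
  then have "\<exists>a b. a \<in> homog \<and> b \<in> homog \<and> T' i = (\<lambda>x. a * x * b)" if "i < n" for i
    using that by (fastforce simp: sandwiches_def)
  then obtain y w where yw: "\<And>i. i < n \<Longrightarrow> y i \<in> homog \<and> w i \<in> homog \<and> T' i = (\<lambda>x. y i * x * w i)"
    by metis
  have "chain (\<lambda>i. T' i (x (\<sigma> i))) n u = chain (\<lambda>i. y i * x (\<sigma> i) * w i) n u" for \<sigma>
    by (rule chain_cong) (simp add: yw)
  then have "capelli d n T' x u = capelli d n (\<lambda>i x. y i * x * w i) x u"
    by (simp add: capelli_def)
  then show ?thesis using that[of y w u] yw u T' by auto
qed

end

section \<open>Transferring non-identities\<close>

text \<open>One noncommutative polynomial without constant term, given by its evaluation maps in
  both algebras. Capelli expressions are thus recognized as polynomials by their shape, before any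
  element of the free algebra is written down.\<close>

inductive poly_pair ::
  "('f \<Rightarrow> 'a::ring \<Rightarrow> 'a) \<Rightarrow> ('f \<Rightarrow> 'b::ring \<Rightarrow> 'b) \<Rightarrow>
     ((nat \<Rightarrow> 'a) \<Rightarrow> 'a) \<Rightarrow> ((nat \<Rightarrow> 'b) \<Rightarrow> 'b) \<Rightarrow> bool"
  for scaleA scaleB where
  var: "poly_pair scaleA scaleB (\<lambda>v. v j) (\<lambda>v. v j)"
| add: "poly_pair scaleA scaleB f f' \<Longrightarrow> poly_pair scaleA scaleB g g' \<Longrightarrow>
    poly_pair scaleA scaleB (\<lambda>v. f v + g v) (\<lambda>v. f' v + g' v)"
| mult: "poly_pair scaleA scaleB f f' \<Longrightarrow> poly_pair scaleA scaleB g g' \<Longrightarrow>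
    poly_pair scaleA scaleB (\<lambda>v. f v * g v) (\<lambda>v. f' v * g' v)"
| scale: "poly_pair scaleA scaleB f f' \<Longrightarrow>
    poly_pair scaleA scaleB (\<lambda>v. scaleA c (f v)) (\<lambda>v. scaleB c (f' v))"

section \<open>Closure properties of the free graded algebra\<close>

lemma free_graded_algebra_add:
  assumes "f \<in> free_graded_algebra G" "g \<in> free_graded_algebra G"
  shows "f + g \<in> free_graded_algebra G"
proof -
  have "fst ` set (letters w) \<subseteq> carrier G" if "w \<in> Poly_Mapping.keys (f + g)" for w
    using that Poly_Mapping.keys_add[of f g] assms unfolding free_graded_algebra_def by blast
  then show ?thesis using assms by (simp add: free_graded_algebra_def lookup_add)
qed

lemma free_graded_algebra_mult:
  assumes "f \<in> free_graded_algebra G" "g \<in> free_graded_algebra G"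
  shows "f * g \<in> free_graded_algebra G"
proof -
  have keys: "\<exists>a\<in>Poly_Mapping.keys f. \<exists>b\<in>Poly_Mapping.keys g. w = a + b"
    if "w \<in> Poly_Mapping.keys (f * g)" for w
    using that Poly_Mapping.keys_mult[of f g] by blast
  have "0 \<notin> Poly_Mapping.keys (f * g)"
  proof
    assume "0 \<in> Poly_Mapping.keys (f * g)"
    then obtain a b where "a \<in> Poly_Mapping.keys f" "0 = a + b" using keys by blast
    moreover from this have "a = 0"
      by (cases a) (simp add: zero_free_word_def plus_free_word_def)
    ultimately show False using assms by (auto simp: free_graded_algebra_def in_keys_iff)
  qed
  moreover have "fst ` set (letters w) \<subseteq> carrier G" if "w \<in> Poly_Mapping.keys (f * g)" for w
  proof -
    obtain a b where ab: "a \<in> Poly_Mapping.keys f" "b \<in> Poly_Mapping.keys g" "w = a + b"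
      using keys[OF \<open>w \<in> _\<close>] by blast
    then have "fst ` set (letters a) \<subseteq> carrier G" "fst ` set (letters b) \<subseteq> carrier G"
      using assms unfolding free_graded_algebra_def by blast+
    then show ?thesis using ab by (simp add: plus_free_word_def image_Un)
  qed
  ultimately show ?thesis by (auto simp: free_graded_algebra_def in_keys_iff)
qed

lemma free_graded_algebra_variable:
  "g \<in> carrier G \<Longrightarrow> Poly_Mapping.single (Word [(g, i)]) 1 \<in> free_graded_algebra G"
  by (auto simp: free_graded_algebra_def lookup_single zero_free_word_def when_def)

lemma lookup_map_mult:
  "Poly_Mapping.lookup (Poly_Mapping.map (\<lambda>x. c * x) f) w = c * (Poly_Mapping.lookup f w :: 'f::field)"
  by (simp add: Poly_Mapping.map.rep_eq when_def)

lemma free_graded_algebra_scale: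
  fixes f :: "('g \<times> nat) free_word \<Rightarrow>\<^sub>0 'f::field"
  assumes "f \<in> free_graded_algebra G"
  shows "Poly_Mapping.map (\<lambda>x. c * x) f \<in> free_graded_algebra G"
  using assms by (auto simp: free_graded_algebra_def in_keys_iff lookup_map_mult)

lemma (in assoc_algebra) substitute_scale:
  "substitute scale s (Poly_Mapping.map (\<lambda>x. c * x) f) = c *s substitute scale s f"
proof -
  have "Poly_Mapping.keys (Poly_Mapping.map (\<lambda>x. c * x) f) \<subseteq> Poly_Mapping.keys f"
    by (auto simp: in_keys_iff lookup_map_mult)
  from substitute_superset[OF finite_keys this] show ?thesis
    by (simp add: substitute_def scale_sum_right lookup_map_mult in_keys_iff)
qed

locale two_graded_algebras =
  A: graded_algebra G scaleA A + B: graded_algebra G scaleB B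
  for G :: "('g, 'm) monoid_scheme" and scaleA :: "'f::field \<Rightarrow> 'a::ring \<Rightarrow> 'a" and A
    and scaleB :: "'f \<Rightarrow> 'b::ring \<Rightarrow> 'b" and B
begin

abbreviation pair :: "((nat \<Rightarrow> 'a) \<Rightarrow> 'a) \<Rightarrow> ((nat \<Rightarrow> 'b) \<Rightarrow> 'b) \<Rightarrow> bool" where
  "pair \<equiv> poly_pair scaleA scaleB"

lemma pair_zero: "pair (\<lambda>v. 0) (\<lambda>v. 0)"
  using poly_pair.scale[OF poly_pair.var[of scaleA scaleB 0], of 0] by simp

lemma pair_signed: "pair f f' \<Longrightarrow> pair (\<lambda>v. signed \<sigma> (f v)) (\<lambda>v. signed \<sigma> (f' v))"
  using poly_pair.scale[of scaleA scaleB f f' "- 1"] by (cases "evenperm \<sigma>") (simp_all add: signed_def)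

lemma pair_sum:
  "(\<And>i. i \<in> I \<Longrightarrow> pair (f i) (f' i)) \<Longrightarrow> pair (\<lambda>v. \<Sum>i\<in>I. f i v) (\<lambda>v. \<Sum>i\<in>I. f' i v)"
  by (induction I rule: infinite_finite_induct) (auto intro: pair_zero poly_pair.add)

lemma pair_chain:
  "(\<And>i. i < n \<Longrightarrow> pair (f i) (f' i)) \<Longrightarrow> pair u u' \<Longrightarrow>
     pair (\<lambda>v. chain (\<lambda>i. f i v) n (u v)) (\<lambda>v. chain (\<lambda>i. f' i v) n (u' v))"
  by (induction n arbitrary: u u') (auto intro: poly_pair.mult)

lemma pair_capelli:
  assumes "\<And>i. i < n \<Longrightarrow> pair (x i) (x' i)" "\<And>i. i < n \<Longrightarrow> pair (y i) (y' i)"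
    "\<And>i. i < n \<Longrightarrow> pair (w i) (w' i)" "pair u u'"
  shows "pair (\<lambda>v. capelli d n (\<lambda>i z. y i v * z * w i v) (\<lambda>i. x i v) (u v))
    (\<lambda>v. capelli d n (\<lambda>i z. y' i v * z * w' i v) (\<lambda>i. x' i v) (u' v))"
  unfolding capelli_def
  by (rule pair_sum, rule pair_signed, rule pair_chain, (rule poly_pair.mult)+)
    (use assms in \<open>auto simp: degree_perms_less\<close>)

text \<open>Entry \<open>j\<close> becomes the variable \<open>(D j, j)\<close>; the second index
  keeps entries of equal degree apart.\<close>

lemma pair_polynomial:
  assumes D: "\<And>j. D j \<in> carrier G" and "pair f f'"
  shows "\<exists>p\<in>free_graded_algebra G. \<forall>s t.
    substitute scaleA s p = f (\<lambda>j. s (D j, j)) \<and> substitute scaleB t p = f' (\<lambda>j. t (D j, j))"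
  using assms(2)
proof induction
  case (var j)
  show ?case
    by (rule bexI[OF _ free_graded_algebra_variable[OF D[of j], of j]])
      (simp add: A.substitute_variable B.substitute_variable)
next
  case (add f f' g g')
  then obtain p q where "p \<in> free_graded_algebra G" "q \<in> free_graded_algebra G"
    "\<forall>s t. substitute scaleA s p = f (\<lambda>j. s (D j, j)) \<and> substitute scaleB t p = f' (\<lambda>j. t (D j, j))"
    "\<forall>s t. substitute scaleA s q = g (\<lambda>j. s (D j, j)) \<and> substitute scaleB t q = g' (\<lambda>j. t (D j, j))"
    by blast
  then show ?case
    by (intro bexI[of _ "p + q"])
      (simp_all add: A.substitute_add B.substitute_add free_graded_algebra_add)
next
  case (mult f f' g g')
  then obtain p q where pq: "p \<in> free_graded_algebra G" "q \<in> free_graded_algebra G"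
    "\<forall>s t. substitute scaleA s p = f (\<lambda>j. s (D j, j)) \<and> substitute scaleB t p = f' (\<lambda>j. t (D j, j))"
    "\<forall>s t. substitute scaleA s q = g (\<lambda>j. s (D j, j)) \<and> substitute scaleB t q = g' (\<lambda>j. t (D j, j))"
    by blast
  then have "Poly_Mapping.lookup p 0 = 0" "Poly_Mapping.lookup q 0 = 0"
    by (auto simp: free_graded_algebra_def)
  then show ?case using pq
    by (intro bexI[of _ "p * q"])
      (simp_all add: A.substitute_mult B.substitute_mult free_graded_algebra_mult)
next
  case (scale f f' c)
  then obtain p where "p \<in> free_graded_algebra G"
    "\<forall>s t. substitute scaleA s p = f (\<lambda>j. s (D j, j)) \<and> substitute scaleB t p = f' (\<lambda>j. t (D j, j))"
    by blast
  then show ?case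
    by (intro bexI[of _ "Poly_Mapping.map (\<lambda>x. c * x) p"])
      (simp_all add: A.substitute_scale B.substitute_scale free_graded_algebra_scale)
qed

lemma transfer_nonzero:
  assumes ids: "graded_identities G scaleA A \<subseteq> graded_identities G scaleB B"
    and "pair f f'" and D: "\<And>j. D j \<in> carrier G"
    and v: "\<And>j. v j \<in> B (D j)" "f' v \<noteq> 0"
  obtains v' where "\<And>j. v' j \<in> A (D j)" "f v' \<noteq> 0"
proof -
  obtain p where p: "p \<in> free_graded_algebra G"
    "\<And>s. substitute scaleA s p = f (\<lambda>j. s (D j, j))" "\<And>t. substitute scaleB t p = f' (\<lambda>j. t (D j, j))"
    using pair_polynomial[where D = D, OF D assms(2)] by blast
  \<comment> \<open>Variables that do not occur receive 0, which lies in every component, so the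
    substitution is admissible.\<close>
  define t where "t = (\<lambda>(g, j). if g = D j then v j else 0)"
  have "\<forall>g\<in>carrier G. \<forall>i. t (g, i) \<in> B g"
    using v B.subspace_0[OF B.subspace_A] by (auto simp: t_def)
  moreover have "substitute scaleB t p \<noteq> 0" using v by (simp add: p t_def)
  ultimately have "p \<notin> graded_identities G scaleB B" by (auto simp: graded_identities_def)
  then have "p \<notin> graded_identities G scaleA A" using ids by blast
  then obtain s where s: "\<forall>g\<in>carrier G. \<forall>i. s (g, i) \<in> A g" "substitute scaleA s p \<noteq> 0"
    using p by (auto simp: graded_identities_def)
  show ?thesis by (rule that[of "\<lambda>j. s (D j, j)"]) (use s D in \<open>auto simp: p\<close>)
qed

end

text \<open>The separators \<open>z\<close> are there because a nonzero Capelli value may have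
  square 0. They are numbered by the factors still to come, so words of equal length use the same
  ones.\<close>

fun block_product :: "('t \<Rightarrow> 'a::times) \<Rightarrow> (nat \<Rightarrow> 'a) \<Rightarrow> 't list \<Rightarrow> 'a \<Rightarrow> 'a" where
  "block_product \<kappa> z [] r = r"
| "block_product \<kappa> z (t # ts) r = \<kappa> t * z (length ts) * block_product \<kappa> z ts r"

lemma block_product_zero [simp]: "block_product \<kappa> z ts (0 :: 'a::ring) = 0"
  by (induction ts) auto

lemma block_product_const:
  "block_product (\<lambda>_. k) z ts r = block_product (\<lambda>_::unit. k) z (replicate (length ts) ()) r"
  by (induction ts) auto

lemma (in two_graded_algebras) pair_block_product:
  assumes "\<And>t. pair (\<kappa> t) (\<kappa>' t)" "\<And>j. pair (z j) (z' j)" "pair r r'"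
  shows "pair (\<lambda>v. block_product (\<lambda>t. \<kappa> t v) (\<lambda>j. z j v) ts (r v))
    (\<lambda>v. block_product (\<lambda>t. \<kappa>' t v) (\<lambda>j. z' j v) ts (r' v))"
  by (induction ts) (auto intro!: poly_pair.mult assms)

lemma (in assoc_algebra) block_product_scale:
  assumes "\<And>t. t \<in> set ts \<Longrightarrow> \<kappa> t = c t *s k"
  shows "block_product \<kappa> z ts r = (\<Prod>t\<leftarrow>ts. c t) *s block_product (\<lambda>_. k) z ts r"
  using assms by (induction ts) (auto simp: scale_mult_left scale_mult_right)

text \<open>Graded primeness yields a separator for each new factor. The one for length
  \<open>m + 1\<close> has index \<open>m\<close>, so those chosen before are unaffected.\<close>

lemma (in simple_graded_algebra) block_product_nonzero:
  assumes k: "k \<in> homog" "k \<noteq> 0"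
  obtains z where "\<And>j. z j \<in> homog" "block_product (\<lambda>_::unit. k) z (replicate m ()) k \<noteq> 0"
proof -
  have "\<exists>z. (\<forall>j. z j \<in> homog) \<and> block_product (\<lambda>_::unit. k) z (replicate m ()) k \<in> homog \<and>
    block_product (\<lambda>_::unit. k) z (replicate m ()) k \<noteq> 0"
  proof (induction m)
    case 0
    show ?case using k by (auto intro!: exI[of _ "\<lambda>_. k"])
  next
    case (Suc m)
    then obtain z where z: "\<forall>j. z j \<in> homog" "block_product (\<lambda>_::unit. k) z (replicate m ()) k \<in> homog"
      "block_product (\<lambda>_::unit. k) z (replicate m ()) k \<noteq> 0" by blast
    obtain z0 where z0: "z0 \<in> homog" "k * z0 * block_product (\<lambda>_::unit. k) z (replicate m ()) k \<noteq> 0"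
      using graded_prime[OF k z(2,3)] by blast
    have "block_product (\<lambda>_::unit. k) (z(m := z0)) ts r = block_product (\<lambda>_::unit. k) z ts r"
      if "length ts \<le> m" for ts r
      using that by (induction ts) auto
    then have eq: "block_product (\<lambda>_::unit. k) (z(m := z0)) (replicate (Suc m) ()) k =
        k * z0 * block_product (\<lambda>_::unit. k) z (replicate m ()) k" by simp
    show ?case
    proof (intro exI conjI)
      show "\<forall>j. (z(m := z0)) j \<in> homog" using z z0 by simp
    qed (unfold eq, use z z0 k in \<open>auto intro: homog_mult\<close>)
  qed
  then show ?thesis using that by blast
qed

section \<open>Structure constants\<close>

text \<open>The positions at which the grading allows a nonzero structure constant.\<close>

definition valid_triple :: "('g, 'm) monoid_scheme \<Rightarrow> nat \<Rightarrow> (nat \<Rightarrow> 'g) \<Rightarrow> nat \<times> nat \<times> nat \<Rightarrow> bool" where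
  "valid_triple G n d = (\<lambda>(i, j, k). i < n \<and> j < n \<and> k < n \<and> d k = d i \<otimes>\<^bsub>G\<^esub> d j)"

definition insert_product :: "(nat \<Rightarrow> 'a::times) \<Rightarrow> nat \<times> nat \<times> nat \<Rightarrow> nat \<Rightarrow> 'a" where
  "insert_product x = (\<lambda>(i, j, k). x(k := x i * x j))"

context graded_algebra
begin

text \<open>The value 0 off the valid triples makes \<open>c\<close> unique as a function for
  independent \<open>x\<close>, so the constants of two algebras can be compared by equality of
  functions.\<close>

definition structure_constants ::
  "nat \<Rightarrow> (nat \<Rightarrow> 'g) \<Rightarrow> (nat \<Rightarrow> 'a) \<Rightarrow> (nat \<times> nat \<times> nat \<Rightarrow> 'f) \<Rightarrow> bool" where
  "structure_constants n d x c \<longleftrightarrow> (\<forall>t. \<not> valid_triple G n d t \<longrightarrow> c t = 0) \<and>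
     (\<forall>i<n. \<forall>j<n. x i * x j = (\<Sum>k<n. c (i, j, k) *s x k))"

definition graded_family :: "nat \<Rightarrow> (nat \<Rightarrow> 'g) \<Rightarrow> (nat \<Rightarrow> 'a) \<Rightarrow> bool" where
  "graded_family n d x \<longleftrightarrow> (\<forall>i<n. d i \<in> carrier G \<and> x i \<in> A (d i))"

text \<open>Cramer's rule for \<open>x i * x j\<close>: its coordinates in degrees other than
  \<open>d k\<close> belong to invalid triples and vanish.\<close>

lemma capelli_insert_product:
  assumes c: "structure_constants n d x c" and t: "valid_triple G n d t"
    and T: "\<And>i. i < n \<Longrightarrow> linear_operator (T i)"
  shows "capelli d n T (insert_product x t) u = c t *s capelli d n T x u"
proof -
  obtain i j k where ijk: "t = (i, j, k)" by (cases t) auto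
  then have lt: "i < n" "j < n" "k < n" "d k = d i \<otimes> d j" using t by (auto simp: valid_triple_def)
  have "insert_product x t = x(k := (\<Sum>l<n. c (i, j, l) *s x l))"
    using c lt by (simp add: insert_product_def ijk structure_constants_def)
  moreover have "c (i, j, l) = 0" if "l < n" "d l \<noteq> d k" for l
    using c lt that by (auto simp: structure_constants_def valid_triple_def)
  ultimately show ?thesis
    using capelli_replace[OF lt(3) T, where d = d and c = "\<lambda>l. c (i, j, l)"] by (simp add: ijk)
qed

text \<open>The permutations preserve degrees, so in every summand the factor at a given position
  has the same degree, and all summands lie in one component.\<close>

lemma capelli_homog:
  assumes x: "graded_family n d x" and y: "\<And>i. i < n \<Longrightarrow> y i \<in> homog" and w: "\<And>i. i < n \<Longrightarrow> w i \<in> homog"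
    and u: "u \<in> homog"
  shows "capelli d n (\<lambda>i z. y i * z * w i) x u \<in> homog"
proof -
  have "\<forall>i\<in>{..<n}. \<exists>h. h \<in> carrier G \<and> y i \<in> A h" "\<forall>i\<in>{..<n}. \<exists>h. h \<in> carrier G \<and> w i \<in> A h"
    using y w by (auto simp: homog_def)
  then obtain \<alpha> \<beta> where \<alpha>: "\<forall>i\<in>{..<n}. \<alpha> i \<in> carrier G \<and> y i \<in> A (\<alpha> i)"
    and \<beta>: "\<forall>i\<in>{..<n}. \<beta> i \<in> carrier G \<and> w i \<in> A (\<beta> i)" by (metis bchoice)
  obtain \<gamma> where \<gamma>: "\<gamma> \<in> carrier G" "u \<in> A \<gamma>" using u by (auto simp: homog_def)
  define \<delta> where "\<delta> i = \<alpha> i \<otimes> d i \<otimes> \<beta> i" for i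
  have "\<exists>\<epsilon>\<in>carrier G. \<forall>f. (\<forall>i<m. f i \<in> A (\<delta> i)) \<longrightarrow> (\<forall>u\<in>A \<gamma>. chain f m u \<in> A \<epsilon>)"
    if "m \<le> n" "\<gamma> \<in> carrier G" for m \<gamma>
    using that
  proof (induction m arbitrary: \<gamma>)
    case (Suc m)
    have \<delta>m: "\<delta> m \<in> carrier G"
      using Suc.prems \<alpha> \<beta> x by (auto simp: \<delta>_def graded_family_def)
    then obtain \<epsilon> where \<epsilon>: "\<epsilon> \<in> carrier G"
      "\<And>f u. (\<forall>i<m. f i \<in> A (\<delta> i)) \<Longrightarrow> u \<in> A (\<delta> m \<otimes> \<gamma>) \<Longrightarrow> chain f m u \<in> A \<epsilon>"
      using Suc.IH[of "\<delta> m \<otimes> \<gamma>"] Suc.prems by auto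
    have "chain f (Suc m) u \<in> A \<epsilon>" if "\<forall>i<Suc m. f i \<in> A (\<delta> i)" "u \<in> A \<gamma>" for f u
      using that \<epsilon>(2)[of f "f m * u"] mult_component[of "\<delta> m" \<gamma> "f m" u] \<delta>m Suc.prems by auto
    then show ?case using \<epsilon>(1) by blast
  qed auto
  from this[of n \<gamma>] \<gamma> obtain \<epsilon> where \<epsilon>: "\<epsilon> \<in> carrier G"
    "\<And>f. (\<forall>i<n. f i \<in> A (\<delta> i)) \<Longrightarrow> chain f n u \<in> A \<epsilon>" by blast
  have "chain (\<lambda>i. y i * x (\<sigma> i) * w i) n u \<in> A \<epsilon>" if \<sigma>: "\<sigma> \<in> degree_perms d n" for \<sigma>
  proof (rule \<epsilon>(2), intro allI impI)
    fix i assume i: "i < n"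
    have "x (\<sigma> i) \<in> A (d i)" "d i \<in> carrier G"
      using x \<sigma> i degree_perms_less[OF \<sigma>, of i] by (auto simp: graded_family_def degree_perms_def dest: spec[of _ "\<sigma> i"])
    then show "y i * x (\<sigma> i) * w i \<in> A (\<delta> i)"
      unfolding \<delta>_def using \<alpha> \<beta> i by (intro mult_component) auto
  qed
  then have "capelli d n (\<lambda>i z. y i * z * w i) x u \<in> A \<epsilon>"
    unfolding capelli_def signed_def
    by (intro subspace_sum[OF subspace_A[OF \<epsilon>(1)]])
      (auto intro: subspace_neg[OF subspace_A[OF \<epsilon>(1)]])
  then show ?thesis using \<epsilon>(1) by (auto simp: homog_def)
qed

end

text \<open>The graded polynomial below evaluates \<open>Q\<close> at the structure constants of the first \<open>n\<close>
  entries of \<open>v\<close>; the remaining entries of \<open>v\<close> are the auxiliary variables. Words are padded to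
  length \<open>m\<close>, so that all terms carry the same nonzero factor. The last Capelli factor makes
  the value zero unless those entries are linearly independent.\<close>

definition capelli_var :: "nat \<Rightarrow> (nat \<Rightarrow> 'g) \<Rightarrow> (nat \<Rightarrow> 'a::ring) \<Rightarrow> (nat \<Rightarrow> 'a) \<Rightarrow> 'a" where
  "capelli_var n d v x = capelli d n (\<lambda>i z. v (n + i) * z * v (2 * n + i)) x (v (3 * n))"

text \<open>\<open>None\<close> is padding and stands for the constant 1; an invalid triple gives 0,
  which agrees with the structure constant there.\<close>

definition block_value ::
  "('g, 'm) monoid_scheme \<Rightarrow> nat \<Rightarrow> (nat \<Rightarrow> 'g) \<Rightarrow> (nat \<times> nat \<times> nat) option \<Rightarrow> (nat \<Rightarrow> 'a::ring) \<Rightarrow> 'a" where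
  "block_value G n d t v = (case t of None \<Rightarrow> capelli_var n d v v
     | Some t \<Rightarrow> if valid_triple G n d t then capelli_var n d v (insert_product v t) else 0)"

definition pad :: "nat \<Rightarrow> 't list \<Rightarrow> 't option list" where
  "pad m w = map Some w @ replicate (m - length w) None"

definition relation_value ::
  "('g, 'm) monoid_scheme \<Rightarrow> nat \<Rightarrow> (nat \<Rightarrow> 'g) \<Rightarrow> nat \<Rightarrow> ('f \<times> (nat \<times> nat \<times> nat) list) list \<Rightarrow>
     ('f \<Rightarrow> 'a::ring \<Rightarrow> 'a) \<Rightarrow> (nat \<Rightarrow> 'a) \<Rightarrow> 'a" where
  "relation_value G n d m Q scale v = (\<Sum>(q, w)\<leftarrow>Q. scale q
     (block_product (\<lambda>t. block_value G n d t v) (\<lambda>j. v (3 * n + 1 + j)) (pad m w) (capelli_var n d v v)))"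

lemma (in two_graded_algebras) pair_capelli_var:
  assumes "\<And>i. i < n \<Longrightarrow> pair (x i) (x' i)"
  shows "pair (\<lambda>v. capelli_var n d v (\<lambda>i. x i v)) (\<lambda>v. capelli_var n d v (\<lambda>i. x' i v))"
  unfolding capelli_var_def by (intro pair_capelli assms poly_pair.var)

lemma (in two_graded_algebras) pair_block_value:
  "pair (block_value G n d t) (block_value G n d t)"
proof (cases t)
  case None
  show ?thesis
    using pair_capelli_var[of n "\<lambda>i v. v i" "\<lambda>i v. v i" d, OF poly_pair.var] None
    by (simp add: block_value_def[abs_def])
next
  case (Some t')
  obtain i j k where t': "t' = (i, j, k)" by (cases t') auto
  have "pair (\<lambda>v. insert_product v t' l) (\<lambda>v. insert_product v t' l)" for l
    by (cases "l = k") (auto simp: insert_product_def t' intro: poly_pair.var poly_pair.mult)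
  then have "pair (\<lambda>v. capelli_var n d v (insert_product v t')) (\<lambda>v. capelli_var n d v (insert_product v t'))"
    by (rule pair_capelli_var)
  then show ?thesis using Some pair_zero
    by (cases "valid_triple G n d t'") (simp_all add: block_value_def[abs_def])
qed

lemma (in two_graded_algebras) pair_relation_value:
  "pair (relation_value G n d m Q scaleA) (relation_value G n d m Q scaleB)"
  unfolding relation_value_def
proof (induction Q)
  case Nil
  show ?case using pair_zero by simp
next
  case (Cons a Q)
  have "pair (\<lambda>v. scaleA (fst a) (block_product (\<lambda>t. block_value G n d t v) (\<lambda>j. v (3 * n + 1 + j))
        (pad m (snd a)) (capelli_var n d v v)))
      (\<lambda>v. scaleB (fst a) (block_product (\<lambda>t. block_value G n d t v) (\<lambda>j. v (3 * n + 1 + j))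
        (pad m (snd a)) (capelli_var n d v v)))"
    using pair_block_value[of n d None]
    by (intro poly_pair.scale pair_block_product pair_block_value poly_pair.var)
      (simp add: block_value_def[abs_def])
  from poly_pair.add[OF this Cons.IH] show ?case by (simp add: case_prod_beta)
qed

text \<open>Each block is a structure constant, or 1 for padding, times one fixed Capelli value. As
  all words have length \<open>m\<close> after padding, the remaining product is common to all terms
  of \<open>Q\<close>.\<close>

lemma (in graded_algebra) relation_value_eq:
  assumes c: "structure_constants n d v c" and m: "\<And>q w. (q, w) \<in> set Q \<Longrightarrow> length w \<le> m"
  shows "relation_value G n d m Q scale v = formal_value (\<lambda>x. x) c Q *s
    block_product (\<lambda>_::unit. capelli_var n d v v) (\<lambda>j. v (3 * n + 1 + j)) (replicate m ()) (capelli_var n d v v)"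
    (is "_ = _ *s ?R")
proof -
  define c' where "c' t = (case t of None \<Rightarrow> 1 | Some t \<Rightarrow> c t)" for t
  have \<kappa>: "block_value G n d t v = c' t *s capelli_var n d v v" for t
  proof (cases t)
    case (Some t')
    show ?thesis
    proof (cases "valid_triple G n d t'")
      case True
      then show ?thesis
        using Some capelli_insert_product[OF c True linear_operator_sandwich]
        by (simp add: block_value_def c'_def capelli_var_def)
    next
      case False
      then have "c t' = 0" using c unfolding structure_constants_def by blast
      then show ?thesis using Some False by (simp add: block_value_def c'_def)
    qed
  qed (simp add: block_value_def c'_def)
  have prod: "(\<Prod>t\<leftarrow>pad m w. c' t) = (\<Prod>t\<leftarrow>w. c t)" for w
  proof -
    have "(\<Prod>t\<leftarrow>map Some w. c' t) = (\<Prod>t\<leftarrow>w. c t)" by (induction w) (auto simp: c'_def)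
    moreover have "(\<Prod>t\<leftarrow>replicate l None. c' t) = 1" for l by (induction l) (auto simp: c'_def)
    ultimately show ?thesis by (simp add: pad_def)
  qed
  have bp: "block_product (\<lambda>t. block_value G n d t v) z (pad m w) r =
      (\<Prod>t\<leftarrow>w. c t) *s block_product (\<lambda>_::unit. capelli_var n d v v) z (replicate m ()) r"
    if "length w \<le> m" for w z r
    using block_product_scale[of "pad m w" "\<lambda>t. block_value G n d t v" c' "capelli_var n d v v" z r]
      block_product_const[of "capelli_var n d v v" z "pad m w" r] that \<kappa> prod
    by (simp add: pad_def)
  then show ?thesis
    using m unfolding relation_value_def formal_value_def
  proof (induction Q)
    case (Cons a Q)
    obtain q w where a: "a = (q, w)" by (cases a)
    have "length w \<le> m" by (rule Cons.prems(2)[of q]) (simp add: a)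
    from bp[OF this] Cons.IH[OF bp Cons.prems(2)[OF list.set_intros(2)]] show ?case
      by (simp del: One_nat_def add_Suc_right add_Suc add: a scale_left_distrib)
  qed simp
qed

text \<open>Every term ends in the Capelli value. A nonzero relation value therefore forces the
  first \<open>n\<close> entries to be independent.\<close>

lemma relation_value_zero:
  assumes "assoc_algebra scale" "capelli_var n d v v = 0"
  shows "relation_value G n d m Q scale v = 0"
proof -
  interpret assoc_algebra scale by fact
  show ?thesis unfolding relation_value_def assms(2) by (induction Q) auto
qed

section \<open>Transfer of relations between structure constants\<close>

locale two_fd_simple =
  A: fd_simple G scaleA A BasisA + B: fd_simple G scaleB B BasisB
  for G :: "('g, 'm) monoid_scheme" and scaleA :: "'f::alg_closed_field \<Rightarrow> 'a::ring \<Rightarrow> 'a"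
    and A BasisA and scaleB :: "'f \<Rightarrow> 'b::ring \<Rightarrow> 'b" and B BasisB
begin

sublocale two_graded_algebras G scaleA A scaleB B ..

text \<open>The data that make the Capelli value of \<open>b\<close> nonzero show that the
  polynomial of \<open>Q\<close> is no identity of \<open>B\<close>, hence none of \<open>A\<close>.
  A substitution in \<open>A\<close> with nonzero value yields both conclusions: its Capelli factor
  is nonzero, and so is \<open>Q\<close> at its structure constants.\<close>

lemma transfer_relation:
  assumes ids: "graded_identities G scaleA A \<subseteq> graded_identities G scaleB B"
    and b: "B.graded_family n d b" "indep_family scaleB n b" "B.structure_constants n d b c"
    and Q: "formal_value (\<lambda>x. x) c Q \<noteq> 0"
  obtains a where "A.graded_family n d a" "indep_family scaleA n a"
    "\<And>c'. A.structure_constants n d a c' \<Longrightarrow> formal_value (\<lambda>x. x) c' Q \<noteq> 0"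
proof -
  have deg: "d i \<in> carrier G \<and> b i \<in> B (d i)" if "i < n" for i
    using b(1) that by (simp add: B.graded_family_def)
  obtain y w u where ywu: "\<And>i. i < n \<Longrightarrow> y i \<in> B.homog" "\<And>i. i < n \<Longrightarrow> w i \<in> B.homog" "u \<in> B.homog"
    "capelli d n (\<lambda>i z. y i * z * w i) b u \<noteq> 0"
    using B.capelli_nonzero[OF deg b(2)] by blast
  define k where "k = capelli d n (\<lambda>i z. y i * z * w i) b u"
  have k: "k \<in> B.homog" "k \<noteq> 0" unfolding k_def using B.capelli_homog[OF b(1) ywu(1-3)] ywu(4) by auto
  \<comment> \<open>The inserted 0 gives the maximum a value for empty \<open>Q\<close>.\<close>
  define m where "m = Max (insert 0 ((\<lambda>(q, w). length w) ` set Q))"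
  have m: "length w \<le> m" if "(q, w) \<in> set Q" for q w
    unfolding m_def using that by (intro Max_ge) (auto intro!: image_eqI[of _ _ "(q, w)"])
  obtain z where z: "\<And>j. z j \<in> B.homog" "block_product (\<lambda>_::unit. k) z (replicate m ()) k \<noteq> 0"
    using B.block_product_nonzero[OF k] by blast
  \<comment> \<open>The layout expected by \<open>capelli_var\<close> and
    \<open>relation_value\<close>: three blocks of length \<open>n\<close> for \<open>b\<close>,
    \<open>y\<close> and \<open>w\<close>, then \<open>u\<close> at \<open>3 * n\<close>, then the
    separators.\<close>
  define v where "v j = (if j < n then b j else if j < 2 * n then y (j - n)
    else if j < 3 * n then w (j - 2 * n) else if j = 3 * n then u else z (j - (3 * n + 1)))" for j
  have "v j \<in> B.homog" if "n \<le> j" for j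
    unfolding v_def using that ywu z by auto
  moreover have vb: "v i = b i" if "i < n" for i using that by (simp add: v_def)
  ultimately have "\<exists>g. g \<in> carrier G \<and> v j \<in> B g \<and> (j < n \<longrightarrow> g = d j)" for j
    using deg[of j] by (cases "j < n") (auto simp: B.homog_def not_less)
  then obtain D where D: "\<And>j. D j \<in> carrier G" "\<And>j. v j \<in> B (D j)" "\<And>j. j < n \<Longrightarrow> D j = d j"
    by metis
  have chain_eq: "chain (\<lambda>i. v (n + i) * v (\<sigma> i) * v (2 * n + i)) n u = chain (\<lambda>i. y i * b (\<sigma> i) * w i) n u"
    if "\<sigma> \<in> degree_perms d n" for \<sigma>
    by (rule chain_cong) (use degree_perms_less[OF that] in \<open>auto simp: v_def\<close>)
  have "v (3 * n) = u" by (simp add: v_def)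
  then have cap: "capelli_var n d v v = k"
    by (simp add: capelli_var_def capelli_def k_def chain_eq)
  have zv: "(\<lambda>j. v (3 * n + 1 + j)) = z" by (auto simp: v_def)
  have "B.structure_constants n d v c"
    using b(3) by (auto simp: B.structure_constants_def vb)
  from B.relation_value_eq[OF this m]
  have "relation_value G n d m Q scaleB v \<noteq> 0"
    using Q z(2) by (simp only: cap zv B.scale_eq_0_iff) simp
  from transfer_nonzero[OF ids pair_relation_value D(1,2) this]
  obtain v' where v': "\<And>j. v' j \<in> A (D j)" "relation_value G n d m Q scaleA v' \<noteq> 0" by blast
  have cap': "capelli_var n d v' v' \<noteq> 0"
    using relation_value_zero[OF A.assoc_algebra_axioms, of n d v' G m Q] v'(2) by blast
  have fam: "d i \<in> carrier G \<and> v' i \<in> A (d i)" if "i < n" for i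
    using deg[OF that] v'(1)[of i] D(3)[OF that] by simp
  have "indep_family scaleA n v'"
    using A.capelli_nonzero_imp_indep[OF fam A.linear_operator_sandwich cap'[unfolded capelli_var_def]] .
  moreover have "formal_value (\<lambda>x. x) c' Q \<noteq> 0" if "A.structure_constants n d v' c'" for c'
    using A.relation_value_eq[OF that m] v'(2) by auto
  ultimately show ?thesis using that[of v'] fam by (simp add: A.graded_family_def)
qed

end

section \<open>Reconstruction from the identities\<close>

context fd_simple
begin

text \<open>A maximal independent set of homogeneous elements spans all of them, hence the
  algebra.\<close>

lemma exists_graded_basis:
  obtains d e where "graded_family dimension d e" "indep_family scale dimension e"
proof -
  obtain B where B: "B \<subseteq> homog" "independent B" "homog \<subseteq> span B"
    using maximal_independent_subset[of homog] by blast
  have "span homog \<subseteq> span B" using span_mono[OF B(3)] by (simp add: span_span)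
  then have "UNIV \<subseteq> span B" using in_span_homog by blast
  then have card: "card B = dimension"
    using basis_card_eq_dim[of B UNIV] B(2) by (simp add: dimension_def)
  have "finite B" by (rule finiteI_independent[OF B(2)])
  then obtain e where e: "bij_betw e {0..<dimension} B"
    using ex_bij_betw_nat_finite[of B] card by auto
  have "\<forall>i\<in>{..<dimension}. \<exists>g. g \<in> carrier G \<and> e i \<in> A g"
  proof
    fix i assume "i \<in> {..<dimension}"
    then have "e i \<in> homog" using bij_betwE[OF e] B(1) by auto
    then show "\<exists>g. g \<in> carrier G \<and> e i \<in> A g" unfolding homog_def by blast
  qed
  from bchoice[OF this] obtain d where "\<forall>i\<in>{..<dimension}. d i \<in> carrier G \<and> e i \<in> A (d i)" ..
  then have "graded_family dimension d e" by (simp add: graded_family_def)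
  moreover have "indep_family scale dimension e"
    by (rule indep_family_if_independent[OF _ B(2)]) (use e in \<open>simp add: atLeast0LessThan\<close>)
  ultimately show ?thesis by (rule that)
qed

lemma exists_structure_constants:
  assumes x: "graded_family dimension d x" "indep_family scale dimension x"
  obtains c where "structure_constants dimension d x c"
proof -
  have deg: "d i \<in> carrier G \<and> x i \<in> A (d i)" if "i < dimension" for i
    using x(1) that by (simp add: graded_family_def)
  have "\<exists>c. x i * x j = (\<Sum>k<dimension. c k *s x k)" for i j
    by (rule indep_family_spans[OF x(2), of "x i * x j"]) blast
  then obtain \<gamma> where \<gamma>: "\<And>i j. x i * x j = (\<Sum>k<dimension. \<gamma> i j k *s x k)" by metis
  define c where "c = (\<lambda>(i, j, k). if valid_triple G dimension d (i, j, k) then \<gamma> i j k else 0)"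
  have "\<gamma> i j k = c (i, j, k)" if "i < dimension" "j < dimension" "k < dimension" for i j k
  proof (cases "d k = d i \<otimes> d j")
    case True
    then show ?thesis using that by (simp add: c_def valid_triple_def)
  next
    case False
    have "x i * x j \<in> A (d i \<otimes> d j)" "d i \<otimes> d j \<in> carrier G"
      using deg that by (auto intro: mult_component)
    then have "\<gamma> i j k = 0"
      using family_coeff_degree[OF deg x(2), of "\<gamma> i j" "d i \<otimes> d j" k] that False
      by (simp flip: \<gamma>)
    then show ?thesis using False by (simp add: c_def valid_triple_def)
  qed
  then have "x i * x j = (\<Sum>k<dimension. c (i, j, k) *s x k)" if "i < dimension" "j < dimension" for i j
    unfolding \<gamma>[of i j] using that by (intro sum.cong) auto
  then have "structure_constants dimension d x c"
    by (auto simp: structure_constants_def c_def)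
  then show ?thesis by (rule that)
qed

text \<open>\<open>(r x) (r y) = r (r (x y))\<close>: one factor \<open>r\<close> belongs to the new
  basis, the other to the constants. Polynomial multiples of structure constants are thus again
  structure constants.\<close>

lemma structure_constants_scale:
  assumes "structure_constants n d x c"
  shows "structure_constants n d (\<lambda>i. r *s x i) (\<lambda>t. r * c t)"
  using assms
  by (auto simp: structure_constants_def scale_mult_left scale_mult_right scale_sum_right
      mult.left_commute mult.commute)

lemma graded_family_scale:
  "graded_family n d x \<Longrightarrow> graded_family n d (\<lambda>i. r *s x i)"
  by (auto simp: graded_family_def subspace_scale[OF subspace_A])

lemma indep_family_scale:
  assumes "indep_family scale n x" "r \<noteq> 0"
  shows "indep_family scale n (\<lambda>i. r *s x i)"
  unfolding indep_family_def
proof (intro allI impI)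
  fix c i assume c: "(\<Sum>i<n. c i *s (r *s x i)) = 0" and i: "i < n"
  then have "(\<Sum>i<n. (c i * r) *s x i) = 0" by simp
  from indep_familyD[OF assms(1) this i] show "c i = 0" using assms(2) by simp
qed

lemma structure_constants_cong:
  "structure_constants n d x c \<Longrightarrow> (\<And>i. i < n \<Longrightarrow> x' i = x i) \<Longrightarrow> structure_constants n d x' c"
  by (simp add: structure_constants_def)

section \<open>Algebra-valued polynomial maps\<close>

definition vector_polynomials :: "'v set \<Rightarrow> (('v \<Rightarrow> 'f) \<Rightarrow> 'a) set" where
  "vector_polynomials V = {f. \<forall>b. (\<lambda>t. representation Basis (f t) b) \<in> polynomial_functions V}"

lemma in_span_Basis: "x \<in> span Basis"
  using span_Basis by simp

lemma vector_polynomials_const: "(\<lambda>_. x) \<in> vector_polynomials V"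
  by (simp add: vector_polynomials_def polynomial_functions.const)

lemma vector_polynomials_add:
  "f \<in> vector_polynomials V \<Longrightarrow> g \<in> vector_polynomials V \<Longrightarrow> (\<lambda>t. f t + g t) \<in> vector_polynomials V"
  by (simp add: vector_polynomials_def representation_add[OF independent_Basis in_span_Basis in_span_Basis]
      polynomial_functions.add)

lemma vector_polynomials_scale:
  "p \<in> polynomial_functions V \<Longrightarrow> f \<in> vector_polynomials V \<Longrightarrow> (\<lambda>t. p t *s f t) \<in> vector_polynomials V"
  by (simp add: vector_polynomials_def representation_scale[OF independent_Basis in_span_Basis]
      polynomial_functions.mult)

lemma vector_polynomials_sum:
  "(\<And>i. i \<in> I \<Longrightarrow> f i \<in> vector_polynomials V) \<Longrightarrow> (\<lambda>t. \<Sum>i\<in>I. f i t) \<in> vector_polynomials V"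
  by (induction I rule: infinite_finite_induct)
    (auto intro: vector_polynomials_const vector_polynomials_add)

lemma sum_representation: "(\<Sum>b\<in>Basis. representation Basis x b *s b) = x"
  by (rule sum_representation_eq[OF independent_Basis in_span_Basis finite_Basis order_refl])

lemma vector_polynomials_mult:
  assumes "f \<in> vector_polynomials V" "g \<in> vector_polynomials V"
  shows "(\<lambda>t. f t * g t) \<in> vector_polynomials V"
proof -
  have "f t * g t = (\<Sum>b\<in>Basis. \<Sum>b'\<in>Basis.
      (representation Basis (f t) b * representation Basis (g t) b') *s (b * b'))" for t
  proof -
    have "f t * g t = (\<Sum>b\<in>Basis. representation Basis (f t) b *s b) *
        (\<Sum>b\<in>Basis. representation Basis (g t) b *s b)"
      by (simp only: sum_representation)
    then show ?thesis
      by (simp add: sum_product scale_mult_left scale_mult_right mult.commute)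
  qed
  moreover have "(\<lambda>t. \<Sum>b\<in>Basis. \<Sum>b'\<in>Basis.
      (representation Basis (f t) b * representation Basis (g t) b') *s (b * b')) \<in> vector_polynomials V"
    using assms
    by (intro vector_polynomials_sum vector_polynomials_scale polynomial_functions.mult
        vector_polynomials_const) (simp_all add: vector_polynomials_def)
  ultimately show ?thesis by simp
qed

lemma vector_polynomials_chain:
  "(\<And>i. i < n \<Longrightarrow> f i \<in> vector_polynomials V) \<Longrightarrow> u \<in> vector_polynomials V \<Longrightarrow>
     (\<lambda>t. chain (\<lambda>i. f i t) n (u t)) \<in> vector_polynomials V"
  by (induction n arbitrary: u) (auto intro: vector_polynomials_mult)

lemma vector_polynomials_capelli:
  assumes "\<And>i. i < n \<Longrightarrow> (\<lambda>t. x t i) \<in> vector_polynomials V"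
  shows "(\<lambda>t. capelli d n (\<lambda>i z. y i * z * w i) (x t) u) \<in> vector_polynomials V"
proof -
  have "(\<lambda>t. signed \<sigma> (chain (\<lambda>i. y i * x t (\<sigma> i) * w i) n u)) \<in> vector_polynomials V"
    if \<sigma>: "\<sigma> \<in> degree_perms d n" for \<sigma>
  proof -
    have "(\<lambda>t. chain (\<lambda>i. y i * x t (\<sigma> i) * w i) n u) \<in> vector_polynomials V"
      using degree_perms_less[OF \<sigma>]
      by (intro vector_polynomials_chain vector_polynomials_mult vector_polynomials_const assms) auto
    then have "(\<lambda>t. (if evenperm \<sigma> then 1 else - 1) *s chain (\<lambda>i. y i * x t (\<sigma> i) * w i) n u)
        \<in> vector_polynomials V"
      by (intro vector_polynomials_scale polynomial_functions.const)
    then show ?thesis by (cases "evenperm \<sigma>") (simp_all add: signed_def)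
  qed
  then show ?thesis unfolding capelli_def by (rule vector_polynomials_sum)
qed

text \<open>Homogeneous families of degrees \<open>d\<close>, parametrized by matrices with entries
  only between equal degrees. Row \<open>dimension\<close> of the parameters is not read, which
  leaves \<open>t (dimension, 0)\<close> free for scaling.\<close>

definition coordinate_family ::
  "(nat \<Rightarrow> 'g) \<Rightarrow> (nat \<Rightarrow> 'a) \<Rightarrow> (nat \<times> nat \<Rightarrow> 'f) \<Rightarrow> nat \<Rightarrow> 'a" where
  "coordinate_family d e t i =
     (if i < dimension then \<Sum>l | l < dimension \<and> d l = d i. t (i, l) *s e l else 0)"

lemma graded_coordinate_family:
  assumes "graded_family dimension d e"
  shows "graded_family dimension d (coordinate_family d e t)"
  unfolding graded_family_def
proof (intro allI impI conjI)
  fix i assume i: "i < dimension"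
  then show di: "d i \<in> carrier G" using assms by (simp add: graded_family_def)
  have "t (i, l) *s e l \<in> A (d i)" if "l < dimension" "d l = d i" for l
    using assms that by (intro subspace_scale subspace_A di) (metis graded_family_def)
  then show "coordinate_family d e t i \<in> A (d i)"
    using i by (auto simp: coordinate_family_def intro!: subspace_sum[OF subspace_A[OF di]])
qed

lemma vector_polynomials_coordinate_family:
  "(\<lambda>t. coordinate_family d e t i) \<in> vector_polynomials ({..dimension} \<times> {..dimension})"
  unfolding coordinate_family_def
  by (cases "i < dimension")
    (auto intro!: vector_polynomials_sum vector_polynomials_scale vector_polynomials_const
      polynomial_functions.var)

lemma coordinate_family_surj:
  assumes e: "graded_family dimension d e" "indep_family scale dimension e"
    and x: "graded_family dimension d x"
  obtains t where "\<And>i. i < dimension \<Longrightarrow> coordinate_family d e t i = x i"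
proof -
  have "\<exists>c. x i = (\<Sum>l<dimension. c l *s e l)" for i
    by (rule indep_family_spans[OF e(2), of "x i"]) blast
  then obtain c where c: "\<And>i. x i = (\<Sum>l<dimension. c i l *s e l)" by metis
  have "coordinate_family d e (\<lambda>(i, l). c i l) i = x i" if i: "i < dimension" for i
  proof -
    have deg: "d l \<in> carrier G \<and> e l \<in> A (d l)" if "l < dimension" for l
      using e(1) that by (simp add: graded_family_def)
    have "c i l = 0" if "l < dimension" "d l \<noteq> d i" for l
      using family_coeff_degree[OF deg e(2), of "c i" "d i" l] that x i
      by (simp add: graded_family_def flip: c)
    then have "(\<Sum>l<dimension. c i l *s e l) = (\<Sum>l | l < dimension \<and> d l = d i. c i l *s e l)"
      by (intro sum.mono_neutral_right) auto
    then show ?thesis using i by (simp add: coordinate_family_def c[of i])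
  qed
  then show ?thesis by (rule that)
qed

text \<open>The coordinate \<open>t (dimension, 0)\<close> is a free scaling parameter.\<close>

definition capelli_coordinate ::
  "(nat \<Rightarrow> 'g) \<Rightarrow> (nat \<Rightarrow> 'a) \<times> (nat \<Rightarrow> 'a) \<times> 'a \<times> 'a \<Rightarrow> (nat \<times> nat \<Rightarrow> 'f) \<Rightarrow> (nat \<Rightarrow> 'a) \<Rightarrow> 'f" where
  "capelli_coordinate d = (\<lambda>(y, w, u, b) t x. t (dimension, 0) *
     representation Basis (capelli d dimension (\<lambda>i z. y i * z * w i) x u) b)"

text \<open>Structure constants with their denominator cleared. Inserting the product into the
  Capelli coordinate gives a polynomial in \<open>t\<close>, defined even where the family is
  dependent.\<close>

definition scaled_constant ::
  "(nat \<Rightarrow> 'g) \<Rightarrow> (nat \<Rightarrow> 'a) \<Rightarrow> (nat \<Rightarrow> 'a) \<times> (nat \<Rightarrow> 'a) \<times> 'a \<times> 'a \<Rightarrow>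
     nat \<times> nat \<times> nat \<Rightarrow> (nat \<times> nat \<Rightarrow> 'f) \<Rightarrow> 'f" where
  "scaled_constant d e \<theta> s t = (if valid_triple G dimension d s
     then capelli_coordinate d \<theta> t (insert_product (coordinate_family d e t) s) else 0)"

lemma capelli_coordinate_polynomial:
  assumes "\<And>i. i < dimension \<Longrightarrow> (\<lambda>t. x t i) \<in> vector_polynomials ({..dimension} \<times> {..dimension})"
  shows "(\<lambda>t. capelli_coordinate d \<theta> t (x t)) \<in> polynomial_functions ({..dimension} \<times> {..dimension})"
proof -
  obtain y w u b where \<theta>: "\<theta> = (y, w, u, b)" by (cases \<theta>)
  show ?thesis
    using vector_polynomials_capelli[OF assms, where d = d and y = y and w = w and u = u]
    by (auto simp: capelli_coordinate_def \<theta> vector_polynomials_def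
        intro!: polynomial_functions.mult polynomial_functions.var)
qed

lemma scaled_constant_polynomial:
  "scaled_constant d e \<theta> s \<in> polynomial_functions ({..dimension} \<times> {..dimension})"
proof (cases "valid_triple G dimension d s")
  case True
  obtain i j k where s: "s = (i, j, k)" by (cases s)
  have "(\<lambda>t. insert_product (coordinate_family d e t) s l) \<in> vector_polynomials ({..dimension} \<times> {..dimension})" for l
    by (cases "l = k") (simp_all add: insert_product_def s vector_polynomials_coordinate_family
        vector_polynomials_mult)
  from capelli_coordinate_polynomial[OF this] show ?thesis
    using True by (simp add: scaled_constant_def[abs_def])
qed (simp add: scaled_constant_def[abs_def] polynomial_functions.const)

lemma scaled_constant_eq:
  assumes "structure_constants dimension d (coordinate_family d e t) c"
  shows "scaled_constant d e \<theta> s t = capelli_coordinate d \<theta> t (coordinate_family d e t) * c s"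
proof (cases "valid_triple G dimension d s")
  case True
  obtain y w u b where \<theta>: "\<theta> = (y, w, u, b)" by (cases \<theta>)
  show ?thesis
    using True capelli_insert_product[OF assms True linear_operator_sandwich]
    by (simp add: scaled_constant_def capelli_coordinate_def \<theta>
        representation_scale[OF independent_Basis in_span_Basis])
next
  case False
  then have "c s = 0" using assms unfolding structure_constants_def by blast
  then show ?thesis using False by (simp add: scaled_constant_def)
qed

lemma capelli_coordinate_nonzero_imp_indep:
  assumes "graded_family dimension d x" "capelli_coordinate d \<theta> t x \<noteq> 0"
  shows "indep_family scale dimension x"
proof -
  obtain y w u b where \<theta>: "\<theta> = (y, w, u, b)" by (cases \<theta>)
  have "capelli d dimension (\<lambda>i z. y i * z * w i) x u \<noteq> 0"
    using assms(2) by (auto simp: capelli_coordinate_def \<theta> representation_zero)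
  then show ?thesis
    by (rule capelli_nonzero_imp_indep[rotated 2])
      (use assms(1) in \<open>auto simp: graded_family_def linear_operator_sandwich\<close>)
qed

text \<open>With the coordinate normalized to 1, the scaled constants at \<open>t\<close> are the
  structure constants of \<open>x\<close> themselves.\<close>

lemma exists_capelli_coordinate:
  assumes e: "graded_family dimension d e" "indep_family scale dimension e"
    and x: "graded_family dimension d x" "indep_family scale dimension x"
  obtains \<theta> t where "\<And>i. i < dimension \<Longrightarrow> coordinate_family d e t i = x i"
    "capelli_coordinate d \<theta> t (coordinate_family d e t) = 1"
proof -
  obtain t where t: "\<And>i. i < dimension \<Longrightarrow> coordinate_family d e t i = x i"
    using coordinate_family_surj[OF e x(1)] by blast
  have deg: "d i \<in> carrier G \<and> x i \<in> A (d i)" if "i < dimension" for i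
    using x(1) that by (simp add: graded_family_def)
  obtain y w u where "\<And>i. i < dimension \<Longrightarrow> y i \<in> homog" "\<And>i. i < dimension \<Longrightarrow> w i \<in> homog" "u \<in> homog"
    and ywu: "capelli d dimension (\<lambda>i z. y i * z * w i) x u \<noteq> 0"
    using capelli_nonzero[OF deg x(2)] by blast
  let ?K = "capelli d dimension (\<lambda>i z. y i * z * w i) x u"
  have "\<exists>b. representation Basis ?K b \<noteq> 0"
  proof (rule ccontr)
    assume "\<not> ?thesis"
    then have "?K = 0" using sum_representation[of ?K] by simp
    then show False using ywu by simp
  qed
  then obtain b where b: "representation Basis ?K b \<noteq> 0" by blast
  \<comment> \<open>The scaling parameter is set to the inverse of the coordinate; the family does
    not change, because it does not read this parameter.\<close>
  define t' where "t' = t((dimension, 0) := inverse (representation Basis ?K b))"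
  have cf: "coordinate_family d e t' = coordinate_family d e t"
    by (auto simp: coordinate_family_def t'_def fun_eq_iff)
  have K: "capelli d dimension (\<lambda>i z. y i * z * w i) (coordinate_family d e t') u = ?K"
    unfolding cf by (rule capelli_cong) (rule t)
  have "capelli_coordinate d (y, w, u, b) t' (coordinate_family d e t') = 1"
    using b by (simp add: capelli_coordinate_def K) (simp add: t'_def)
  then show ?thesis using that[of t' "(y, w, u, b)"] t by (simp add: cf)
qed

end

section \<open>Isomorphism from a common point\<close>

context two_fd_simple
begin

text \<open>The map sends \<open>a i\<close> to \<open>b i\<close>. Equal structure constants make
  it multiplicative, and the common degrees make it graded.\<close>

lemma graded_isomorphic_if_structure_constants_eq:
  assumes n: "n = A.dimension" "n = B.dimension"
    and a: "A.graded_family n d a" "indep_family scaleA n a" "A.structure_constants n d a c"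
    and b: "B.graded_family n d b" "indep_family scaleB n b" "B.structure_constants n d b c"
  shows "graded_isomorphic G scaleA A scaleB B"
proof -
  define \<phi> where "\<phi> x = (\<Sum>i<n. scaleB ((SOME h. x = (\<Sum>i<n. scaleA (h i) (a i))) i) (b i))" for x
  have \<phi>: "\<phi> (\<Sum>i<n. scaleA (h i) (a i)) = (\<Sum>i<n. scaleB (h i) (b i))" for h
  proof -
    let ?P = "\<lambda>k. (\<Sum>i<n. scaleA (h i) (a i)) = (\<Sum>i<n. scaleA (k i) (a i))"
    have "?P (SOME k. ?P k)" by (rule someI[of ?P h]) simp
    then have "(SOME k. ?P k) i = h i" if "i < n" for i
      using A.indep_family_unique[OF a(2), of h "SOME k. ?P k" i] that by simp
    then show ?thesis unfolding \<phi>_def by (intro sum.cong) auto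
  qed
  have spanA: "\<exists>h. x = (\<Sum>i<n. scaleA (h i) (a i))" for x
    unfolding n(1) by (rule A.indep_family_spans[OF a(2)[unfolded n(1)], of x]) blast
  have spanB: "\<exists>h. x = (\<Sum>i<n. scaleB (h i) (b i))" for x
    unfolding n(2) by (rule B.indep_family_spans[OF b(2)[unfolded n(2)], of x]) blast
  have add: "\<phi> (x + y) = \<phi> x + \<phi> y" for x y
  proof -
    obtain h k where "x = (\<Sum>i<n. scaleA (h i) (a i))" "y = (\<Sum>i<n. scaleA (k i) (a i))"
      using spanA by blast
    then show ?thesis using \<phi>[of h] \<phi>[of k] \<phi>[of "\<lambda>i. h i + k i"]
      by (simp add: A.scale_left_distrib B.scale_left_distrib sum.distrib)
  qed
  have scale: "\<phi> (scaleA r x) = scaleB r (\<phi> x)" for r x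
  proof -
    obtain h where "x = (\<Sum>i<n. scaleA (h i) (a i))" using spanA by blast
    then show ?thesis using \<phi>[of h] \<phi>[of "\<lambda>i. r * h i"]
      by (simp add: A.scale_sum_right B.scale_sum_right)
  qed
  have sum: "\<phi> (sum f I) = (\<Sum>i\<in>I. \<phi> (f i))" for f and I :: "nat set"
  proof (induction I rule: infinite_finite_induct)
    case (insert i I)
    then show ?case by (simp add: add)
  qed (use scale[of 0 0] in simp_all)
  have basis: "\<phi> (a i * a j) = b i * b j" if "i < n" "j < n" for i j
    using \<phi>[of "\<lambda>k. c (i, j, k)"] a(3) b(3) that
    by (simp add: A.structure_constants_def B.structure_constants_def)
  have mult: "\<phi> (x * y) = \<phi> x * \<phi> y" for x y
  proof -
    obtain h k where hk: "x = (\<Sum>i<n. scaleA (h i) (a i))" "y = (\<Sum>i<n. scaleA (k i) (a i))"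
      using spanA by blast
    have "\<phi> (x * y) = (\<Sum>i<n. \<Sum>j<n. scaleB (h i) (scaleB (k j) (b i * b j)))"
      by (simp add: hk sum_product A.scale_mult_left A.scale_mult_right sum scale basis
          mult.commute[where 'a = 'f] cong: sum.cong_simp)
    also have "\<dots> = \<phi> x * \<phi> y"
      by (simp add: hk \<phi> sum_product B.scale_mult_left B.scale_mult_right
          mult.commute[where 'a = 'f])
    finally show ?thesis .
  qed
  have "inj \<phi>"
  proof (rule injI)
    fix x y assume "\<phi> x = \<phi> y"
    moreover obtain h k where hk: "x = (\<Sum>i<n. scaleA (h i) (a i))" "y = (\<Sum>i<n. scaleA (k i) (a i))"
      using spanA by blast
    ultimately have "(\<Sum>i<n. scaleB (h i) (b i)) = (\<Sum>i<n. scaleB (k i) (b i))" by (simp add: \<phi>)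
    then have "h i = k i" if "i < n" for i using B.indep_family_unique[OF b(2)] that by blast
    then show "x = y" by (simp add: hk)
  qed
  moreover have "surj \<phi>"
  proof (rule surjI)
    fix y
    obtain h where "y = (\<Sum>i<n. scaleB (h i) (b i))" using spanB by blast
    then have "\<exists>x. \<phi> x = y" using \<phi>[of h] by blast
    then show "\<phi> (SOME x. \<phi> x = y) = y" by (rule someI_ex)
  qed
  ultimately have bij: "bij \<phi>" by (simp add: bij_def)
  have degA: "d i \<in> carrier G \<and> a i \<in> A (d i)" and degB: "d i \<in> carrier G \<and> b i \<in> B (d i)"
    if "i < n" for i
    using a(1) b(1) that by (simp_all add: A.graded_family_def B.graded_family_def)
  have image: "\<phi> ` A g = B g" if g: "g \<in> carrier G" for g
  proof
    show "\<phi> ` A g \<subseteq> B g"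
    proof
      fix z assume "z \<in> \<phi> ` A g"
      then obtain x where x: "x \<in> A g" "z = \<phi> x" by blast
      obtain h where h: "x = (\<Sum>i<n. scaleA (h i) (a i))" using spanA by blast
      have "h i = 0" if "i < n" "d i \<noteq> g" for i
        using A.family_coeff_degree[OF degA a(2), of h g i] x(1) g that by (simp add: h)
      then have "scaleB (h i) (b i) \<in> B g" if "i < n" for i
        using degB[OF that] that B.subspace_scale[OF B.subspace_A[OF g]] B.subspace_0[OF B.subspace_A[OF g]]
        by (cases "d i = g") auto
      then show "z \<in> B g"
        unfolding x(2) h \<phi> by (intro B.subspace_sum B.subspace_A g) auto
    qed
  next
    show "B g \<subseteq> \<phi> ` A g"
    proof
      fix z assume z: "z \<in> B g"
      obtain h where h: "z = (\<Sum>i<n. scaleB (h i) (b i))" using spanB by blast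
      have "h i = 0" if "i < n" "d i \<noteq> g" for i
        using B.family_coeff_degree[OF degB b(2), of h g i] z g that by (simp add: h)
      then have "scaleA (h i) (a i) \<in> A g" if "i < n" for i
        using degA[OF that] that A.subspace_scale[OF A.subspace_A[OF g]] A.subspace_0[OF A.subspace_A[OF g]]
        by (cases "d i = g") auto
      then have "(\<Sum>i<n. scaleA (h i) (a i)) \<in> A g" by (intro A.subspace_sum A.subspace_A g) auto
      then show "z \<in> \<phi> ` A g" unfolding h \<phi>[symmetric] by (rule imageI)
    qed
  qed
  have "Vector_Spaces.linear scaleA scaleB \<phi>"
    unfolding Vector_Spaces.linear_iff
    using add scale A.vector_space_axioms B.vector_space_axioms by blast
  then show ?thesis
    unfolding graded_isomorphic_def graded_isomorphism_def using mult bij image by blast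
qed

theorem graded_isomorphic_if_identities_eq:
  assumes ids: "graded_identities G scaleA A = graded_identities G scaleB B"
  shows "graded_isomorphic G scaleA A scaleB B"
proof -
  interpret swap: two_fd_simple G scaleB B BasisB scaleA A BasisA ..
  define n where "n = A.dimension"
  \<comment> \<open>Transferring the constant polynomial 1 carries over only the existence of an
    independent family with given degrees. Used in both directions, it equates the
    dimensions.\<close>
  let ?one = "[(1 :: 'f, [] :: (nat \<times> nat \<times> nat) list)]"
  have one: "formal_value (\<lambda>x. x) c ?one \<noteq> 0" for c by (simp add: formal_value_def)
  have "A.dimension \<le> B.dimension"
  proof -
    obtain d e where e: "A.graded_family A.dimension d e" "indep_family scaleA A.dimension e"
      by (rule A.exists_graded_basis)
    obtain c where "A.structure_constants A.dimension d e c"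
      by (rule A.exists_structure_constants[OF e])
    from swap.transfer_relation[OF equalityD2[OF ids] e this one] obtain b
      where "indep_family scaleB A.dimension b" by blast
    then show ?thesis by (rule B.indep_family_le_dimension)
  qed
  moreover obtain d b0 where b0: "B.graded_family B.dimension d b0" "indep_family scaleB B.dimension b0"
    by (rule B.exists_graded_basis)
  moreover obtain c0 where c0: "B.structure_constants B.dimension d b0 c0"
    by (rule B.exists_structure_constants[OF b0])
  from transfer_relation[OF equalityD1[OF ids] b0 c0 one] obtain e
    where e: "A.graded_family B.dimension d e" "indep_family scaleA B.dimension e" by blast
  moreover have "B.dimension \<le> A.dimension" using A.indep_family_le_dimension e by blast
  ultimately have n: "n = A.dimension" "n = B.dimension" by (simp_all add: n_def)
  \<comment> \<open>\<open>e\<close> is a basis of \<open>A\<close> with the degrees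
    \<open>d\<close> found in \<open>B\<close>, so one list serves both algebras.\<close>
  note e = e[folded n(2)] and e' = e[folded n(2), unfolded n(1)]
  note A_dim = n(1)[symmetric] and B_dim = n(2)[symmetric]
  define V where "V = {..n} \<times> {..n}"
  define X where "X = A.coordinate_family d e"
  define S where "S \<theta> t = A.capelli_coordinate d \<theta> t (X t)" for \<theta> t
  define P where "P \<theta> s t = A.scaled_constant d e \<theta> s t" for \<theta> s t
  have S_poly: "S \<theta> \<in> polynomial_functions V" for \<theta>
    unfolding S_def X_def V_def n(1)
    by (rule A.capelli_coordinate_polynomial[OF A.vector_polynomials_coordinate_family])
  have P_poly: "P \<theta> s \<in> polynomial_functions V" for \<theta> s
    unfolding P_def V_def n(1) by (rule A.scaled_constant_polynomial)
  have X_graded: "A.graded_family n d (X t)" for t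
    unfolding X_def n(1) by (rule A.graded_coordinate_family[OF e'(1)])
  have X_indep: "indep_family scaleA n (X t)" if "S \<theta> t \<noteq> 0" for \<theta> t
    using A.capelli_coordinate_nonzero_imp_indep[of d "X t" \<theta> t] X_graded[of t] that
    by (simp add: A_dim S_def)
  have A_const: "\<exists>c. A.structure_constants n d x c"
    if "A.graded_family n d x" "indep_family scaleA n x" for x
    using A.exists_structure_constants[of d x] that by (auto simp: A_dim)
  have B_const: "\<exists>c. B.structure_constants n d x c"
    if "B.graded_family n d x" "indep_family scaleB n x" for x
    using B.exists_structure_constants[of d x] that by (auto simp: B_dim)
  have P_eq: "P \<theta> s t = S \<theta> t * c s" if "A.structure_constants n d (X t) c" for \<theta> s t c
    using A.scaled_constant_eq[of d e t c \<theta> s] that by (simp add: P_def S_def X_def A_dim)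
  define fv where "fv = (formal_value (\<lambda>x. x) :: _ \<Rightarrow> ('f \<times> (nat \<times> nat \<times> nat) list) list \<Rightarrow> 'f)"
  have fv_poly: "(\<lambda>t. fv (\<lambda>s. P \<theta> s t) Q) \<in> polynomial_functions V" for \<theta> Q
  proof -
    have prod: "(\<lambda>t. \<Prod>s\<leftarrow>w. P \<theta> s t) \<in> polynomial_functions V" for w
      by (induction w) (auto intro: polynomial_functions.intros P_poly)
    show ?thesis
      unfolding fv_def formal_value_def
    proof (induction Q)
      case (Cons a Q)
      have "(\<lambda>t. fst a * (\<Prod>s\<leftarrow>snd a. P \<theta> s t)) \<in> polynomial_functions V"
        by (intro polynomial_functions.mult polynomial_functions.const prod)
      from polynomial_functions.add[OF this Cons.IH] show ?case by (simp add: case_prod_beta)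
    qed (simp add: polynomial_functions.const)
  qed
  \<comment> \<open>At the basis \<open>e\<close> itself some Capelli coordinate can be normalized
    to 1; the map is built from this fixed \<open>\<theta>\<close>.\<close>
  obtain \<theta> t0 where \<theta>: "S \<theta> t0 \<noteq> 0"
    using A.exists_capelli_coordinate[OF e' e'] by (auto simp: S_def X_def) (metis zero_neq_one)
  define C where "C = {c. \<exists>b. B.graded_family n d b \<and> indep_family scaleB n b \<and> B.structure_constants n d b c}"
  have "\<exists>t. S \<theta> t \<noteq> 0 \<and> (\<lambda>s. P \<theta> s t) \<in> C"
  proof (rule polynomial_image_meets_dense_set[OF _ P_poly S_poly \<theta>])
    show "finite V" by (simp add: V_def)
  next
    fix Q
    show "(\<forall>t. formal_value (\<lambda>x. x) (\<lambda>s. P \<theta> s t) Q = 0) \<longleftrightarrow> (\<forall>c\<in>C. formal_value (\<lambda>x. x) c Q = 0)"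
      unfolding fv_def[symmetric]
    proof (intro iffI ballI allI; rule ccontr)
      fix c assume zero: "\<forall>t. fv (\<lambda>s. P \<theta> s t) Q = 0" and c: "c \<in> C" "fv c Q \<noteq> 0"
      obtain b where "B.graded_family n d b" "indep_family scaleB n b" "B.structure_constants n d b c"
        using c(1) by (auto simp: C_def)
      from transfer_relation[OF equalityD1[OF ids] this c(2)[unfolded fv_def]] obtain a where
        a: "A.graded_family n d a" "indep_family scaleA n a"
        "\<And>c'. A.structure_constants n d a c' \<Longrightarrow> fv c' Q \<noteq> 0"
        unfolding fv_def by blast
      \<comment> \<open>The fixed coordinate \<open>\<theta>\<close> may vanish at \<open>a\<close>,
        so a second one, adapted to \<open>a\<close>, is used to reach the constants of
        \<open>a\<close>.\<close>
      obtain \<theta>' t where t: "\<And>i. i < n \<Longrightarrow> X t i = a i" "S \<theta>' t = 1"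
      proof (rule A.exists_capelli_coordinate[OF e' a(1,2)[unfolded n(1)]])
        fix \<theta>' t
        assume "\<And>i. i < A.dimension \<Longrightarrow> A.coordinate_family d e t i = a i"
          "A.capelli_coordinate d \<theta>' t (A.coordinate_family d e t) = 1"
        then show thesis by (intro that[of t \<theta>']) (simp_all add: S_def X_def n(1))
      qed
      obtain c' where c': "A.structure_constants n d a c'" using A_const[OF a(1,2)] by blast
      have "A.structure_constants n d (X t) c'" by (rule A.structure_constants_cong[OF c' t(1)])
      then have "(\<lambda>s. P \<theta>' s t) = c'" using P_eq t(2) by auto
      then have "fv (\<lambda>s. P \<theta>' s t) Q \<noteq> 0" using a(3)[OF c'] by simp
      \<comment> \<open>The two normalizations agree, up to rescaling, wherever \<open>S \<theta>\<close> does not vanish.\<close>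
      then obtain t1 where t1: "fv (\<lambda>s. P \<theta>' s t1) Q \<noteq> 0" "S \<theta> t1 \<noteq> 0"
        using polynomial_functions_no_zero_divisors[OF fv_poly S_poly _ \<theta>] by (metis mult_eq_0_iff)
      obtain c1 where c1: "A.structure_constants n d (X t1) c1"
        using A_const[OF X_graded X_indep[OF t1(2)]] by blast
      \<comment> \<open>Only the scaling parameter changes, by the ratio that turns the value of
        \<open>S \<theta>\<close> into that of \<open>S \<theta>'\<close> while the family stays the
        same.\<close>
      define t2 where "t2 = t1((n, 0) := t1 (n, 0) * (S \<theta>' t1 / S \<theta> t1))"
      have X2: "X t2 = X t1"
        by (auto simp: X_def A.coordinate_family_def t2_def fun_eq_iff A_dim)
      have "\<exists>r. \<forall>t. X t = X t1 \<longrightarrow> S \<theta> t = t (n, 0) * r"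
        by (cases \<theta>) (auto simp: S_def A.capelli_coordinate_def A_dim)
      then obtain r where "S \<theta> t2 = t2 (n, 0) * r" "S \<theta> t1 = t1 (n, 0) * r" using X2 by blast
      then have "S \<theta> t2 = S \<theta> t1 * (S \<theta>' t1 / S \<theta> t1)" by (simp add: t2_def)
      then have S2: "S \<theta> t2 = S \<theta>' t1" using t1(2) by simp
      have "A.structure_constants n d (X t2) c1" using c1 by (simp only: X2)
      then have "(\<lambda>s. P \<theta> s t2) = (\<lambda>s. P \<theta>' s t1)" using P_eq[OF c1] P_eq S2 by auto
      then show False using zero t1(1) by metis
    next
      fix t assume zero: "\<forall>c\<in>C. fv c Q = 0" and "fv (\<lambda>s. P \<theta> s t) Q \<noteq> 0"
      then obtain t1 where t1: "fv (\<lambda>s. P \<theta> s t1) Q \<noteq> 0" "S \<theta> t1 \<noteq> 0"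
        using polynomial_functions_no_zero_divisors[OF fv_poly S_poly _ \<theta>] by (metis mult_eq_0_iff)
      note indep = X_indep[OF t1(2)]
      obtain c1 where c1: "A.structure_constants n d (X t1) c1"
        using A_const[OF X_graded indep] by blast
      \<comment> \<open>These are the structure constants of the basis \<open>X t1\<close> rescaled
        by the nonzero \<open>S \<theta> t1\<close>, so \<open>Q\<close> can be transferred to
        \<open>B\<close>.\<close>
      have "(\<lambda>s. P \<theta> s t1) = (\<lambda>s. S \<theta> t1 * c1 s)" using P_eq[OF c1] by auto
      then have nz: "fv (\<lambda>s. S \<theta> t1 * c1 s) Q \<noteq> 0" using t1(1) by simp
      from swap.transfer_relation[OF equalityD2[OF ids] A.graded_family_scale[OF X_graded]
          A.indep_family_scale[OF indep t1(2)] A.structure_constants_scale[OF c1] nz[unfolded fv_def]]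
      obtain b where b: "B.graded_family n d b" "indep_family scaleB n b"
        "\<And>c'. B.structure_constants n d b c' \<Longrightarrow> fv c' Q \<noteq> 0"
        unfolding fv_def by blast
      then show False using zero B_const[OF b(1,2)] by (auto simp: C_def)
    qed
  qed
  then obtain t where t: "S \<theta> t \<noteq> 0" "(\<lambda>s. P \<theta> s t) \<in> C" by blast
  \<comment> \<open>Off the zero set of \<open>S \<theta>\<close> the family \<open>X t\<close> is a
    basis, and after rescaling it has the constants of some basis of \<open>B\<close>.\<close>
  note indep = X_indep[OF t(1)]
  obtain c where c: "A.structure_constants n d (X t) c" using A_const[OF X_graded indep] by blast
  have "(\<lambda>s. P \<theta> s t) = (\<lambda>s. S \<theta> t * c s)" using P_eq[OF c] by auto
  then obtain b where b: "B.graded_family n d b" "indep_family scaleB n b"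
    "B.structure_constants n d b (\<lambda>s. S \<theta> t * c s)"
    using t(2) by (auto simp: C_def)
  show ?thesis
    by (rule graded_isomorphic_if_structure_constants_eq[OF n A.graded_family_scale[OF X_graded]
          A.indep_family_scale[OF indep t(1)] A.structure_constants_scale[OF c] b])
qed

end

section \<open>The converse: invariance of identities under isomorphism\<close>

lemma (in two_graded_algebras) identities_eq_if_graded_isomorphic:
  assumes "graded_isomorphic G scaleA A scaleB B"
  shows "graded_identities G scaleA A = graded_identities G scaleB B"
proof -
  obtain \<phi> where lin: "Vector_Spaces.linear scaleA scaleB \<phi>" and mult: "\<And>x y. \<phi> (x * y) = \<phi> x * \<phi> y"
    and bij: "bij \<phi>" and image: "\<And>g. g \<in> carrier G \<Longrightarrow> \<phi> ` A g = B g"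
    using assms unfolding graded_isomorphic_def graded_isomorphism_def by blast
  interpret \<phi>: Vector_Spaces.linear scaleA scaleB \<phi> by (rule lin)
  have word: "\<phi> (word_value s w) = word_value (\<lambda>x. \<phi> (s x)) w" for s and w :: "('g \<times> nat) list"
    by (induction s w rule: word_value.induct) (simp_all add: mult \<phi>.zero)
  have subst: "\<phi> (substitute scaleA s f) = substitute scaleB (\<lambda>x. \<phi> (s x)) f"
    for s and f :: "('g \<times> nat) free_word \<Rightarrow>\<^sub>0 'f"
    by (simp add: substitute_def \<phi>.sum \<phi>.scale word)
  have zero: "\<phi> x = 0 \<longleftrightarrow> x = 0" for x
    using bij_is_inj[OF bij] \<phi>.zero by (metis injD)
  show ?thesis
  proof (intro equalityI subsetI)
    fix f assume f: "f \<in> graded_identities G scaleA A"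
    have "substitute scaleB s f = 0" if s: "\<forall>g\<in>carrier G. \<forall>i. s (g, i) \<in> B g" for s
    proof -
      \<comment> \<open>A substitution in \<open>B\<close> is pulled back; since
        \<open>\<phi>\<close> maps \<open>A g\<close> onto \<open>B g\<close> and is injective, the
        preimages lie in the right components.\<close>
      define s' where "s' x = inv_into UNIV \<phi> (s x)" for x
      have \<phi>s': "\<phi> (s' x) = s x" for x
        unfolding s'_def by (rule surj_f_inv_f[OF bij_is_surj[OF bij]])
      have "s' (g, i) \<in> A g" if g: "g \<in> carrier G" for g i
      proof -
        obtain x where x: "x \<in> A g" "s (g, i) = \<phi> x" using s g image[OF g] by blast
        then have "s' (g, i) = x"
          unfolding s'_def by (simp add: inv_f_f[OF bij_is_inj[OF bij]])
        then show ?thesis using x by simp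
      qed
      then have "substitute scaleA s' f = 0" using f by (auto simp: graded_identities_def)
      then show ?thesis using subst[of s' f] by (simp add: \<phi>s' \<phi>.zero)
    qed
    then show "f \<in> graded_identities G scaleB B" using f by (auto simp: graded_identities_def)
  next
    fix f assume f: "f \<in> graded_identities G scaleB B"
    have "substitute scaleA s f = 0" if s: "\<forall>g\<in>carrier G. \<forall>i. s (g, i) \<in> A g" for s
    proof -
      have "\<phi> (s (g, i)) \<in> B g" if "g \<in> carrier G" for g i using s that image by blast
      then have "\<phi> (substitute scaleA s f) = 0"
        unfolding subst using f by (auto simp: graded_identities_def)
      then show ?thesis by (simp add: zero)
    qed
    then show "f \<in> graded_identities G scaleA A" using f by (auto simp: graded_identities_def)
  qed
qed

theorem corollary5p5:
  fixes G :: "('g, 'm) monoid_scheme"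
    and scaleA :: "'f::alg_closed_field \<Rightarrow> 'a::ring \<Rightarrow> 'a" and A :: "'g \<Rightarrow> 'a set"
    and scaleB :: "'f \<Rightarrow> 'b::ring \<Rightarrow> 'b" and B :: "'g \<Rightarrow> 'b set"
  assumes "group G"
    and "simple_graded_algebra G scaleA A"
    and "\<exists>Basis. finite_dimensional_vector_space scaleA Basis"
    and "simple_graded_algebra G scaleB B"
    and "\<exists>Basis. finite_dimensional_vector_space scaleB Basis"
    and "CHAR('f) = 0 \<or> (\<forall>H. subgroup H G \<and> finite H \<longrightarrow> coprime (CHAR('f)) (card H))"
    and "\<forall>H. subgroup H G \<longrightarrow> H \<lhd> G"
  shows "graded_identities G scaleA A = graded_identities G scaleB B \<longleftrightarrow>
    graded_isomorphic G scaleA A scaleB B"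
proof -
  obtain BasisA BasisB where "finite_dimensional_vector_space scaleA BasisA"
    "finite_dimensional_vector_space scaleB BasisB"
    using assms(3,5) by blast
  with assms(2,4) interpret two_fd_simple G scaleA A BasisA scaleB B BasisB
    by (simp add: two_fd_simple_def fd_simple_def)
  show ?thesis
    using graded_isomorphic_if_identities_eq identities_eq_if_graded_isomorphic by blast
qed

end
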